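(* Let $F=(f^{(\ell)})_{\ell=1}^\infty,G=(g^{(j)})_{j=1}^\infty\in\mathfrak{G}_\infty$. For each $k\in\mathbb{N}$, define $$[F,G]_{\mathfrak{G}_\infty}^{(k)}:=\lim_{N\to\infty}[F,G]_{\mathfrak{G}_N}^{(k)}.$$ Then the limit exists in the topology of $\mathfrak{G}_\infty$ and $$[F,G]_{\mathfrak{G}_\infty}^{(k)}=\sum_{\substack{\ell,j\ge1\\\ell+j-1=k}}\mathrm{Sym}_k\big(f^{(\ell)}\wedge_1g^{(j)}\big),$$ where for $\ell+j-1=k$ $$f^{(\ell)}\wedge_1g^{(j)}(\underline{z}_k):=\ell j\Big(\nabla_{x_1}f^{(\ell)}(z_1,\dots,z_\ell)\cdot\nabla_{v_1}g^{(j)}(z_1,z_{\ell+1},\dots,z_k)-\nabla_{x_1}g^{(j)}(z_1,\dots,z_j)\cdot\nabla_{v_1}f^{(\ell)}(z_1,z_{j+1},\dots,z_k)\Big)$$ and $\mathrm{Sym}_k(h)(z_1,\dots,z_k):=\frac1{k!}\sum_{\pi\in\mathbb{S}_k}h(z_{\pi(1)},\dots,z_{\pi(k)})$ for $h\in\mathcal{C}^\infty((\mathbb{R}^{2d})^k)$. Moreover, $(\mathfrak{G}_\infty,[\cdot,\cdot]_{\mathfrak{G}_\infty})$ is a Lie algebra, and the bracket $[\cdot,\cdot]_{\mathfrak{G}_\infty}$ is boundedly hypocontinuous.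
   Context: Fix $d\in\mathbb{N}$. Points of $\mathbb{R}^{2d}$ are $z=(x,v)$; $\underline{z}_k=(z_1,\dots,z_k)$. For $k\in\mathbb{N}$, $\mathfrak{g}_k$ is the real vector space of smooth functions $f:(\mathbb{R}^{2d})^k\to\mathbb{R}$ invariant under permutations of $z_1,\dots,z_k\in\mathbb{R}^{2d}$, with the topology generated by the seminorms $\sup_{|\alpha|\le n}\|\partial^\alpha f\|_{L^\infty(K)}$ ($K$ compact, $n\in\mathbb{N}$), and $[f,g]_{\mathfrak{g}_k}:=k\sum_{i=1}^k(\nabla_{x_i}f\cdot\nabla_{v_i}g-\nabla_{v_i}f\cdot\nabla_{x_i}g)$. $\mathfrak{G}_N:=\bigoplus_{k=1}^N\mathfrak{g}_k$. $P_k^N$ is the set of $k$-tuples of distinct elements of $\{1,\dots,N\}$; $\epsilon_{k,N}:\mathfrak{g}_k\to\mathfrak{g}_N$, $\epsilon_{k,N}(f)(z_1,\dots,z_N)=\frac1{|P_k^N|}\sum_{(j_1,\dots,j_k)\in P_k^N}f(z_{j_1},\dots,z_{j_k})$, is injective, and $$[F,G]_{\mathfrak{G}_N}^{(k)}:=\epsilon_{k,N}^{-1}\Big(\sum_{\substack{1\le\ell,j\le N\\\min(\ell+j-1,N)=k}}[\epsilon_{\ell,N}(f^{(\ell)}),\epsilon_{j,N}(g^{(j)})]_{\mathfrak{g}_N}\Big),\quad1\le k\le N$$ (the sum lies in the image of $\epsilon_{k,N}$). $\mathfrak{G}_\infty:=\bigoplus_{k=1}^\infty\mathfrak{g}_k$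 with the locally convex direct sum topology; its elements are sequences with finitely many nonzero components, so any $F,G\in\mathfrak{G}_\infty$ belong to $\mathfrak{G}_N$ (via the natural inclusion $\mathfrak{G}_N\subset\mathfrak{G}_\infty$) for all large $N$, and $[F,G]_{\mathfrak{G}_N}^{(k)}\in\mathfrak{g}_k\subset\mathfrak{G}_\infty$ is then defined. A Lie algebra is a real locally convex space with a bilinear antisymmetric bracket satisfying the Jacobi identity. A bilinear map $\beta:E\times E\to E$ is boundedly hypocontinuous if it is separately continuous and for every bounded $B\subset E$ and $0$-neighbourhood $V$ there is a $0$-neighbourhood $U$ with $\beta(B\times U)\subset V$ and $\beta(U\times B)\subset V$. *)

theory Defs
  imports
    "HOL-Analysis.Analysis"
    "HOL-Library.Function_Algebras"
    "HOL-Combinatorics.Permutations"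
begin

section \<open>Real vector spaces of functions\<close>

instantiation "fun" :: (type, real_vector) real_vector
begin

definition scaleR_fun :: "real \<Rightarrow> ('a \<Rightarrow> 'b) \<Rightarrow> 'a \<Rightarrow> 'b" where
  "scaleR_fun c f = (\<lambda>x. c *\<^sub>R f x)"

instance
  by standard (auto simp: scaleR_fun_def fun_eq_iff scaleR_add_right scaleR_add_left)

end


section \<open>Locally convex spaces and Lie algebras\<close>

text \<open>Spaces are given by a carrier \<open>V\<close>, a linear subspace of an ambient real vector space, and
  an abstract topology \<open>T\<close> on \<open>V\<close>.  Locally convex spaces are Hausdorff.\<close>

definition zero_nbhd :: "'a::real_vector topology \<Rightarrow> 'a set \<Rightarrow> bool" where
  "zero_nbhd T U \<longleftrightarrow> U \<subseteq> topspace T \<and> (\<exists>W. openin T W \<and> 0 \<in> W \<and> W \<subseteq> U)"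

definition locally_convex_space :: "'a::real_vector set \<Rightarrow> 'a topology \<Rightarrow> bool" where
  "locally_convex_space V T \<longleftrightarrow>
     subspace V \<and> topspace T = V \<and> Hausdorff_space T \<and>
     continuous_map (prod_topology T T) T (\<lambda>(x, y). x + y) \<and>
     continuous_map (prod_topology euclideanreal T) T (\<lambda>(c, x). c *\<^sub>R x) \<and>
     (\<forall>U. zero_nbhd T U \<longrightarrow> (\<exists>W. zero_nbhd T W \<and> convex W \<and> W \<subseteq> U))"

definition bilinear_on :: "'a::real_vector set \<Rightarrow> ('a \<Rightarrow> 'a \<Rightarrow> 'a) \<Rightarrow> bool" where
  "bilinear_on V \<beta> \<longleftrightarrow>
     (\<forall>x\<in>V. \<forall>y\<in>V. \<beta> x y \<in> V) \<and>
     (\<forall>x\<in>V. \<forall>y\<in>V. \<forall>z\<in>V. \<beta> (x + y) z = \<beta> x z + \<beta> y z \<and> \<beta> z (x + y) = \<beta> z x + \<beta> z y) \<and>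
     (\<forall>c. \<forall>x\<in>V. \<forall>y\<in>V. \<beta> (c *\<^sub>R x) y = c *\<^sub>R \<beta> x y \<and> \<beta> x (c *\<^sub>R y) = c *\<^sub>R \<beta> x y)"

definition lie_algebra :: "'a::real_vector set \<Rightarrow> 'a topology \<Rightarrow> ('a \<Rightarrow> 'a \<Rightarrow> 'a) \<Rightarrow> bool" where
  "lie_algebra V T br \<longleftrightarrow>
     locally_convex_space V T \<and> bilinear_on V br \<and>
     (\<forall>x\<in>V. \<forall>y\<in>V. br x y = - br y x) \<and>
     (\<forall>x\<in>V. \<forall>y\<in>V. \<forall>z\<in>V. br x (br y z) + br y (br z x) + br z (br x y) = 0)"

definition tvs_bounded :: "'a::real_vector topology \<Rightarrow> 'a set \<Rightarrow> bool" where
  "tvs_bounded T B \<longleftrightarrow>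
     B \<subseteq> topspace T \<and> (\<forall>U. zero_nbhd T U \<longrightarrow> (\<exists>s>0. \<forall>t>s. B \<subseteq> (\<lambda>x. t *\<^sub>R x) ` U))"

definition boundedly_hypocontinuous ::
    "'a::real_vector set \<Rightarrow> 'a topology \<Rightarrow> ('a \<Rightarrow> 'a \<Rightarrow> 'a) \<Rightarrow> bool" where
  "boundedly_hypocontinuous V T \<beta> \<longleftrightarrow>
     bilinear_on V \<beta> \<and>
     (\<forall>x\<in>V. continuous_map T T (\<lambda>y. \<beta> x y) \<and> continuous_map T T (\<lambda>y. \<beta> y x)) \<and>
     (\<forall>B U. tvs_bounded T B \<and> zero_nbhd T U \<longrightarrow>
        (\<exists>W. zero_nbhd T W \<and> (\<forall>b\<in>B. \<forall>w\<in>W. \<beta> b w \<in> U \<and> \<beta> w b \<in> U)))"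

definition seminorm_on :: "'a::real_vector set \<Rightarrow> ('a \<Rightarrow> real) \<Rightarrow> bool" where
  "seminorm_on V p \<longleftrightarrow>
     (\<forall>x\<in>V. \<forall>y\<in>V. p (x + y) \<le> p x + p y) \<and> (\<forall>c. \<forall>x\<in>V. p (c *\<^sub>R x) = \<bar>c\<bar> * p x)"

definition seminorm_topology :: "'a::real_vector set \<Rightarrow> ('a \<Rightarrow> real) set \<Rightarrow> 'a topology" where
  "seminorm_topology V P =
     topology_generated_by {{y \<in> V. p (y - x) < r} | p x r. p \<in> P \<and> x \<in> V \<and> r > 0}"


section \<open>Smooth symmetric functions of \<open>k\<close> phase-space variables\<close>

text \<open>A point of \<open>(\<real>\<^sup>2\<^sup>d)\<^sup>k\<close> is represented by any \<open>z :: nat \<Rightarrow> phase\<close>, of which only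
  \<open>z 1, \<dots>, z k\<close> matter; a function on \<open>(\<real>\<^sup>2\<^sup>d)\<^sup>k\<close> is a function of such \<open>z\<close> that depends only on these
  coordinates.  The type \<open>'d\<close> has \<open>d\<close> elements.\<close>

type_synonym 'd phase = "(real ^ 'd) \<times> (real ^ 'd)"
type_synonym 'd kfun = "(nat \<Rightarrow> 'd phase) \<Rightarrow> real"

definition depends_on_first :: "nat \<Rightarrow> 'd::finite kfun \<Rightarrow> bool" where
  "depends_on_first k f \<longleftrightarrow> (\<forall>z w. (\<forall>i\<in>{1..k}. z i = w i) \<longrightarrow> f z = f w)"

definition partial :: "nat \<Rightarrow> 'd phase \<Rightarrow> 'd::finite kfun \<Rightarrow> 'd kfun" where
  "partial i b f z = deriv (\<lambda>t. f (z(i := z i + t *\<^sub>R b))) 0"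

text \<open>A list of coordinate directions \<open>(i, b)\<close> plays the role of a multi-index whose order is the
  length of the list; for smooth functions the order of the entries is immaterial.\<close>

definition directions :: "nat \<Rightarrow> (nat \<times> 'd::finite phase) set" where
  "directions k = {1..k} \<times> Basis"

fun partials :: "(nat \<times> 'd phase) list \<Rightarrow> 'd::finite kfun \<Rightarrow> 'd kfun" where
  "partials [] f = f"
| "partials ((i, b) # \<alpha>) f = partial i b (partials \<alpha> f)"

text \<open>Continuity refers to the product topology on \<open>nat \<Rightarrow> phase\<close>; for functions depending only on
  the first \<open>k\<close> coordinates this is continuity on \<open>(\<real>\<^sup>2\<^sup>d)\<^sup>k\<close>.\<close>

definition smooth :: "nat \<Rightarrow> 'd::finite kfun \<Rightarrow> bool" where
  "smooth k f \<longleftrightarrow>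
     (\<forall>\<alpha> \<in> lists (directions k).
        continuous_on UNIV (partials \<alpha> f) \<and>
        (\<forall>(i, b) \<in> directions k. \<forall>z.
           (\<lambda>t. partials \<alpha> f (z(i := z i + t *\<^sub>R b))) differentiable (at (0::real))))"

definition g_space :: "nat \<Rightarrow> 'd::finite kfun set" where
  "g_space k = {f. depends_on_first k f \<and> smooth k f \<and>
                   (\<forall>\<pi>. \<pi> permutes {1..k} \<longrightarrow> (\<forall>z. f (z \<circ> \<pi>) = f z))}"

text \<open>Compact sets of \<open>nat \<Rightarrow> phase\<close> project onto exactly the compact sets of \<open>(\<real>\<^sup>2\<^sup>d)\<^sup>k\<close>.  The
  functions are continuous, so the \<open>L\<^sup>\<infinity>\<close> norms are suprema; \<open>K\<close> is taken nonempty below because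
  \<open>Sup {}\<close> is unspecified on the reals.\<close>

definition g_seminorm :: "nat \<Rightarrow> nat \<Rightarrow> (nat \<Rightarrow> 'd phase) set \<Rightarrow> 'd::finite kfun \<Rightarrow> real" where
  "g_seminorm k n K f =
     (SUP (\<alpha>, z) \<in> {\<alpha> \<in> lists (directions k). length \<alpha> \<le> n} \<times> K. \<bar>partials \<alpha> f z\<bar>)"

definition g_topology :: "nat \<Rightarrow> 'd::finite kfun topology" where
  "g_topology k =
     seminorm_topology (g_space k) {g_seminorm k n K | n K. compact K \<and> K \<noteq> {}}"

definition grad_x :: "nat \<Rightarrow> 'd::finite kfun \<Rightarrow> (nat \<Rightarrow> 'd phase) \<Rightarrow> real ^ 'd" where
  "grad_x i f z = (\<chi> a. partial i (axis a 1, 0) f z)"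

definition grad_v :: "nat \<Rightarrow> 'd::finite kfun \<Rightarrow> (nat \<Rightarrow> 'd phase) \<Rightarrow> real ^ 'd" where
  "grad_v i f z = (\<chi> a. partial i (0, axis a 1) f z)"

definition g_bracket :: "nat \<Rightarrow> 'd::finite kfun \<Rightarrow> 'd kfun \<Rightarrow> 'd kfun" where
  "g_bracket k f g z =
     real k * (\<Sum>i=1..k. grad_x i f z \<bullet> grad_v i g z - grad_v i f z \<bullet> grad_x i g z)"


section \<open>The \<open>N\<close>-particle hierarchy bracket\<close>

definition tuples :: "nat \<Rightarrow> nat \<Rightarrow> (nat \<Rightarrow> nat) set" where
  "tuples k N = {j \<in> {1..k} \<rightarrow>\<^sub>E {1..N}. inj_on j {1..k}}"

definition eps :: "nat \<Rightarrow> nat \<Rightarrow> 'd::finite kfun \<Rightarrow> 'd kfun" where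
  "eps k N f z = (1 / real (card (tuples k N))) * (\<Sum>j \<in> tuples k N. f (z \<circ> j))"

text \<open>The \<open>k\<close>-th component of the bracket of \<open>F\<close> and \<open>G\<close> in \<open>\<GG>\<^sub>N\<close>; it only involves the
  components of \<open>F\<close> and \<open>G\<close> up to \<open>N\<close>, so \<open>F\<close> and \<open>G\<close> may be elements of \<open>\<GG>\<^sub>\<infinity>\<close>.\<close>

definition bracket_N ::
    "nat \<Rightarrow> (nat \<Rightarrow> 'd::finite kfun) \<Rightarrow> (nat \<Rightarrow> 'd kfun) \<Rightarrow> nat \<Rightarrow> 'd kfun" where
  "bracket_N N F G k =
     inv_into (g_space k) (eps k N)
       (\<Sum>(l, j) \<in> {(l, j). l \<in> {1..N} \<and> j \<in> {1..N} \<and> min (l + j - 1) N = k}.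
          g_bracket N (eps l N (F l)) (eps j N (G j)))"


section \<open>The direct sum \<open>\<GG>\<^sub>\<infinity>\<close> and its bracket\<close>

text \<open>Sequences are indexed from \<open>1\<close>; the entry at \<open>0\<close> is a dummy.\<close>

definition G_inf :: "(nat \<Rightarrow> 'd::finite kfun) set" where
  "G_inf = {F. F 0 = 0 \<and> (\<forall>k\<ge>1. F k \<in> g_space k) \<and> finite {k. F k \<noteq> 0}}"

definition incl :: "nat \<Rightarrow> 'd::finite kfun \<Rightarrow> nat \<Rightarrow> 'd kfun" where
  "incl k f = (\<lambda>m. if m = k then f else 0)"

text \<open>The locally convex direct sum topology, i.e. the finest locally convex topology for which all
  inclusions of summands are continuous: it is generated by all seminorms whose restriction to each
  summand is continuous.\<close>

definition G_inf_topology :: "(nat \<Rightarrow> 'd::finite kfun) topology" where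
  "G_inf_topology =
     seminorm_topology G_inf
       {p. seminorm_on G_inf p \<and>
           (\<forall>k\<ge>1. continuous_map (g_topology k) euclideanreal (p \<circ> incl k))}"

definition bracket_inf_lim ::
    "(nat \<Rightarrow> 'd::finite kfun) \<Rightarrow> (nat \<Rightarrow> 'd kfun) \<Rightarrow> nat \<Rightarrow> (nat \<Rightarrow> 'd kfun)" where
  "bracket_inf_lim F G k =
     (THE L. limitin G_inf_topology (\<lambda>N. incl k (bracket_N N F G k)) L sequentially)"

definition bracket_inf ::
    "(nat \<Rightarrow> 'd::finite kfun) \<Rightarrow> (nat \<Rightarrow> 'd kfun) \<Rightarrow> nat \<Rightarrow> 'd kfun" where
  "bracket_inf F G = (\<lambda>k. if k = 0 then 0 else bracket_inf_lim F G k k)"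

definition Sym :: "nat \<Rightarrow> 'd::finite kfun \<Rightarrow> 'd kfun" where
  "Sym k h z = (1 / fact k) * (\<Sum>\<pi> | \<pi> permutes {1..k}. h (z \<circ> \<pi>))"

text \<open>The tuple \<open>(z\<^sub>1, z\<^sub>l\<^sub>+\<^sub>1, z\<^sub>l\<^sub>+\<^sub>2, \<dots>)\<close>.\<close>

definition skip :: "nat \<Rightarrow> (nat \<Rightarrow> 'd::finite phase) \<Rightarrow> nat \<Rightarrow> 'd phase" where
  "skip l z = (\<lambda>i. if i = 1 then z 1 else z (l + i - 1))"

definition wedge1 :: "nat \<Rightarrow> nat \<Rightarrow> 'd::finite kfun \<Rightarrow> 'd kfun \<Rightarrow> 'd kfun" where
  "wedge1 l j f g z =
     real l * real j *
       (grad_x 1 f z \<bullet> grad_v 1 g (skip l z) - grad_x 1 g z \<bullet> grad_v 1 f (skip j z))"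

end

theory Submission
  imports Defs
begin

text \<open>
  Since every component depends only on its first \<open>l\<close> variables, \<open>\<epsilon>\<^sub>l\<^sub>,\<^sub>N f\<close> is the average \<open>Sym N f\<close> of \<open>f\<close>
  over all permutations of \<open>{1..N}\<close>.  By equivariance of the Poisson bracket,
  \<open>[\<epsilon> f, \<epsilon> g]\<close> is the average over \<open>\<rho> \<in> S\<^sub>N\<close> of \<open>N Sym\<^sub>N {f, g \<circ> \<rho>}\<close>, and the symmetry of \<open>f\<close> and \<open>g\<close> makes
  each term depend only on the overlap \<open>r = |\<rho>{1..j} \<inter> {1..l}|\<close>.  Terms with \<open>r = 0\<close> vanish, and the
  coefficient of the \<open>r\<close>-th term is \<open>N P(overlap = r)\<close>.  The first two moments of the overlap of a
  random permutation show that it tends to \<open>l j\<close> for \<open>r = 1\<close> and to \<open>0\<close> for \<open>r \<ge> 2\<close>; what remains is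
  \<open>Sym (f \<and>\<^sub>1 g)\<close>.  The Jacobi identity is inherited from the Poisson bracket in \<open>N\<close> variables, by
  injectivity of \<open>\<epsilon>\<close> and passage to the limit in the coefficients.  For hypocontinuity, a bounded subset of the
  direct sum lives in finitely many summands, and each component of the bracket is bilinear in the first
  derivatives.\<close>

section \<open>Smooth functions of infinitely many variables\<close>

text \<open>The overlap is hypergeometric, but no closed formula is used. Its first moment is exact
  for every \<open>N\<close>, so \<open>N P(overlap = 1)\<close> is \<open>l j\<close> minus terms
  controlled by the second factorial moment, which is O(1/N) after multiplication by
  \<open>N\<close>. The factor \<open>N\<close> itself is the prefactor in \<open>g_bracket\<close>.

  Both levels of an iterated \<open>N\<close>-particle bracket carry coefficients that depend on
  \<open>N\<close>, so one limit cannot simply be inserted into the other. Every bracket is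
  therefore expanded over finitely many functions free of \<open>N\<close>, with only scalars
  varying. The same device reduces convergence in the direct sum topology to convergence of finitely
  many numbers.

  In the estimate for degrees \<open>l\<close> and \<open>j\<close>, the order of differentiation
  and the compact set depend on both \<open>l\<close> and \<open>j\<close>, so no single seminorm on
  the \<open>l\<close>-th summand need serve all \<open>j\<close>. For a first argument from a
  bounded set this is harmless: with finitely many \<open>l\<close>, its size is absorbed into the
  weights of a seminorm of the second argument.\<close>

lemma schwarz_real:
  fixes \<phi> \<phi>1 \<phi>2 \<phi>12 \<phi>21 :: "real \<Rightarrow> real \<Rightarrow> real"
  assumes d1: "\<And>s t. ((\<lambda>s. \<phi> s t) has_real_derivative \<phi>1 s t) (at s)"
    and d2: "\<And>s t. ((\<lambda>t. \<phi> s t) has_real_derivative \<phi>2 s t) (at t)"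
    and d12: "\<And>s t. ((\<lambda>t. \<phi>1 s t) has_real_derivative \<phi>12 s t) (at t)"
    and d21: "\<And>s t. ((\<lambda>s. \<phi>2 s t) has_real_derivative \<phi>21 s t) (at s)"
    and c12: "isCont (\<lambda>(s, t). \<phi>12 s t) (0, 0)"
    and c21: "isCont (\<lambda>(s, t). \<phi>21 s t) (0, 0)"
  shows "\<phi>12 0 0 = \<phi>21 0 0"
proof -
  \<comment> \<open>The second difference
    \<open>\<phi> h h - \<phi> h 0 - \<phi> 0 h + \<phi> 0 0\<close> is read in two orders. The mean
    value theorem, applied twice in each order, gives \<open>h^2\<close> times a value of either
    mixed derivative. Separate derivatives are all that the directional notion of smoothness
    supplies.\<close>
  have ex: "\<exists>\<xi> \<eta> \<xi>' \<eta>'. \<phi>12 \<xi> \<eta> = \<phi>21 \<xi>' \<eta>' \<and> 0 < \<xi> \<and> \<xi> < h \<and> 0 < \<eta> \<and> \<eta> < h \<and>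
      0 < \<xi>' \<and> \<xi>' < h \<and> 0 < \<eta>' \<and> \<eta>' < h" if "h > 0" for h
  proof -
    have "((\<lambda>s. \<phi> s h - \<phi> s 0) has_real_derivative \<phi>1 s h - \<phi>1 s 0) (at s)" for s
      by (intro derivative_intros d1)
    from MVT2[OF \<open>h > 0\<close> this] obtain \<xi> where \<xi>: "0 < \<xi>" "\<xi> < h"
      and 1: "\<phi> h h - \<phi> h 0 - (\<phi> 0 h - \<phi> 0 0) = (h - 0) * (\<phi>1 \<xi> h - \<phi>1 \<xi> 0)" by blast
    from MVT2[OF \<open>h > 0\<close> d12] obtain \<eta> where \<eta>: "0 < \<eta>" "\<eta> < h"
      and 2: "\<phi>1 \<xi> h - \<phi>1 \<xi> 0 = (h - 0) * \<phi>12 \<xi> \<eta>" by blast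
    have "((\<lambda>t. \<phi> h t - \<phi> 0 t) has_real_derivative \<phi>2 h t - \<phi>2 0 t) (at t)" for t
      by (intro derivative_intros d2)
    from MVT2[OF \<open>h > 0\<close> this] obtain \<eta>' where \<eta>': "0 < \<eta>'" "\<eta>' < h"
      and 3: "\<phi> h h - \<phi> 0 h - (\<phi> h 0 - \<phi> 0 0) = (h - 0) * (\<phi>2 h \<eta>' - \<phi>2 0 \<eta>')" by blast
    from MVT2[OF \<open>h > 0\<close> d21] obtain \<xi>' where \<xi>': "0 < \<xi>'" "\<xi>' < h"
      and 4: "\<phi>2 h \<eta>' - \<phi>2 0 \<eta>' = (h - 0) * \<phi>21 \<xi>' \<eta>'" by blast
    have "(h - 0) * ((h - 0) * \<phi>12 \<xi> \<eta>) = (h - 0) * ((h - 0) * \<phi>21 \<xi>' \<eta>')"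
      using 1 3 unfolding 2 4 by linarith
    then have "\<phi>12 \<xi> \<eta> = \<phi>21 \<xi>' \<eta>'" using that by simp
    then show ?thesis using \<xi> \<eta> \<xi>' \<eta>' by blast
  qed
  have "\<bar>\<phi>12 0 0 - \<phi>21 0 0\<bar> \<le> e" if "e > 0" for e
  proof -
    from c12 that obtain r where r: "r > 0"
      "\<And>x. dist x (0, 0) < r \<Longrightarrow> dist ((\<lambda>(s, t). \<phi>12 s t) x) (\<phi>12 0 0) < e / 2"
      unfolding continuous_at_eps_delta by (metis (no_types, lifting) case_prod_conv half_gt_zero)
    from c21 that obtain r' where r': "r' > 0"
      "\<And>x. dist x (0, 0) < r' \<Longrightarrow> dist ((\<lambda>(s, t). \<phi>21 s t) x) (\<phi>21 0 0) < e / 2"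
      unfolding continuous_at_eps_delta by (metis (no_types, lifting) case_prod_conv half_gt_zero)
    \<comment> \<open>The halving pays for bounding the distance from the origin by the sum of the
      two coordinates.\<close>
    define h where "h = min r r' / 2"
    have h: "h > 0" "2 * h \<le> r" "2 * h \<le> r'" using r(1) r'(1) by (auto simp: h_def)
    obtain \<xi> \<eta> \<xi>' \<eta>' where eq: "\<phi>12 \<xi> \<eta> = \<phi>21 \<xi>' \<eta>'"
      and b: "0 < \<xi>" "\<xi> < h" "0 < \<eta>" "\<eta> < h" "0 < \<xi>'" "\<xi>' < h" "0 < \<eta>'" "\<eta>' < h"
      using ex[OF h(1)] by blast
    have small: "dist (x, y) (0, 0) < 2 * h" if "0 < x" "x < h" "0 < y" "y < h" for x y :: real
      using that sqrt_sum_squares_le_sum_abs[of x y] by (simp add: dist_prod_def dist_real_def)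
    have "dist (\<phi>12 \<xi> \<eta>) (\<phi>12 0 0) < e / 2" "dist (\<phi>21 \<xi>' \<eta>') (\<phi>21 0 0) < e / 2"
      using r(2)[of "(\<xi>, \<eta>)"] r'(2)[of "(\<xi>', \<eta>')"] small[of \<xi> \<eta>] small[of \<xi>' \<eta>'] b h by auto
    then show ?thesis unfolding dist_real_def eq by linarith
  qed
  then have "\<bar>\<phi>12 0 0 - \<phi>21 0 0\<bar> \<le> 0" by (rule field_le_epsilon[of _ 0, simplified])
  then show ?thesis by simp
qed


section \<open>Derivatives along coordinate lines\<close>

definition shift :: "nat \<Rightarrow> 'd phase \<Rightarrow> real \<Rightarrow> (nat \<Rightarrow> 'd::finite phase) \<Rightarrow> nat \<Rightarrow> 'd phase" where
  "shift i b t z = z(i := z i + t *\<^sub>R b)"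

lemma shift_0 [simp]: "shift i b 0 z = z"
  by (simp add: shift_def)

lemma shift_shift: "shift i b s (shift i b t z) = shift i b (s + t) z"
  by (simp add: shift_def scaleR_add_left add_ac)

lemma shift_commute: "shift i b s (shift j c t z) = shift j c t (shift i b s z)"
  by (auto simp: shift_def add_ac)

lemma continuous_on_shift2:
  "continuous_on UNIV (\<lambda>x. shift i b (fst x) (shift j c (snd x) z))"
proof (rule continuous_on_coordinatewise_then_product)
  fix m
  have eq: "shift i b (fst x) (shift j c (snd x) z) m =
      z m + (if m = j then snd x *\<^sub>R c else 0) + (if m = i then fst x *\<^sub>R b else 0)" for x
    by (simp add: shift_def)
  show "continuous_on UNIV (\<lambda>x. shift i b (fst x) (shift j c (snd x) z) m)"
    unfolding eq by (cases "m = i"; cases "m = j") (auto intro!: continuous_intros)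
qed

definition dir_differentiable :: "'d::finite kfun \<Rightarrow> bool" where
  "dir_differentiable f \<longleftrightarrow>
     (\<forall>i. \<forall>b\<in>Basis. \<forall>z. (\<lambda>t. f (shift i b t z)) differentiable (at (0::real)))"

lemma dir_differentiableD:
  assumes "dir_differentiable f" "b \<in> Basis"
  shows "((\<lambda>t. f (shift i b t z)) has_real_derivative partial i b f z) (at 0)"
  using assms unfolding dir_differentiable_def partial_def shift_def[symmetric]
  by (simp add: DERIV_deriv_iff_real_differentiable)

lemma dir_differentiableI:
  assumes "\<And>i b z. b \<in> Basis \<Longrightarrow> ((\<lambda>t. f (shift i b t z)) has_real_derivative D i b z) (at 0)"
  shows "dir_differentiable f"
  using assms unfolding dir_differentiable_def real_differentiable_def by blast

lemma partial_eqI: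
  assumes "\<And>z. ((\<lambda>t. f (shift i b t z)) has_real_derivative D z) (at 0)"
  shows "partial i b f = D"
  using assms unfolding partial_def shift_def[symmetric] by (blast intro: DERIV_imp_deriv)

text \<open>Moving the base point along the line turns the derivative at \<open>0\<close> into the
  derivative at any \<open>t\<close>; the mean value argument behind \<open>partial_commute\<close>
  needs it on the whole line.\<close>

lemma dir_differentiableD_at:
  assumes "dir_differentiable f" "b \<in> Basis"
  shows "((\<lambda>t. f (shift i b t z)) has_real_derivative partial i b f (shift i b t z)) (at t)"
proof -
  have "((\<lambda>s. f (shift i b (s + t) z)) has_real_derivative partial i b f (shift i b t z)) (at 0)"
    using dir_differentiableD[OF assms, of i "shift i b t z"] by (simp add: shift_shift)
  then show ?thesis
    using DERIV_shift[of "\<lambda>t. f (shift i b t z)" _ 0 t] by simp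
qed

definition smooth_all :: "'d::finite kfun \<Rightarrow> bool" where
  "smooth_all f \<longleftrightarrow>
     (\<forall>\<alpha> \<in> lists (UNIV \<times> Basis).
        continuous_on UNIV (partials \<alpha> f) \<and> dir_differentiable (partials \<alpha> f))"

lemma partials_append: "partials (\<alpha> @ \<beta>) f = partials \<alpha> (partials \<beta> f)"
  by (induction \<alpha>) auto

lemma smooth_all_continuous: "smooth_all f \<Longrightarrow> continuous_on UNIV f"
  unfolding smooth_all_def using partials.simps(1) by (metis lists.Nil)

lemma smooth_all_dir_differentiable: "smooth_all f \<Longrightarrow> dir_differentiable f"
  unfolding smooth_all_def using partials.simps(1) by (metis lists.Nil)

lemma smooth_all_partial:
  assumes "smooth_all f" "b \<in> Basis"
  shows "smooth_all (partial i b f)"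
  unfolding smooth_all_def
proof
  fix \<alpha> :: "(nat \<times> 'a phase) list" assume "\<alpha> \<in> lists (UNIV \<times> Basis)"
  then have "\<alpha> @ [(i, b)] \<in> lists (UNIV \<times> Basis)" using assms(2) by auto
  with assms(1) have "continuous_on UNIV (partials (\<alpha> @ [(i, b)]) f) \<and>
      dir_differentiable (partials (\<alpha> @ [(i, b)]) f)"
    unfolding smooth_all_def by blast
  then show "continuous_on UNIV (partials \<alpha> (partial i b f)) \<and> dir_differentiable (partials \<alpha> (partial i b f))"
    by (simp add: partials_append)
qed

lemma smooth_all_partials:
  "smooth_all f \<Longrightarrow> \<alpha> \<in> lists (UNIV \<times> Basis) \<Longrightarrow> smooth_all (partials \<alpha> f)"
  by (induction \<alpha>) (auto intro: smooth_all_partial)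

text \<open>The smooth functions are the largest class of continuous, directionally differentiable
  functions closed under \<open>partial\<close>, so it is enough to exhibit one class of this kind
  that contains \<open>f\<close>.\<close>

lemma smooth_all_coinduct:
  assumes "X f"
    and "\<And>h. X h \<Longrightarrow> continuous_on UNIV h"
    and "\<And>h. X h \<Longrightarrow> dir_differentiable h"
    and "\<And>h i b. X h \<Longrightarrow> b \<in> Basis \<Longrightarrow> X (partial i b h)"
  shows "smooth_all f"
proof -
  have "X (partials \<alpha> f)" if "\<alpha> \<in> lists (UNIV \<times> Basis)" for \<alpha>
    using that by (induction \<alpha>) (auto intro: assms)
  then show ?thesis unfolding smooth_all_def using assms(2,3) by blast
qed

text \<open>Relabelling of the particles. Precomposition in \<open>z\<close> makes it a left action
  on functions, see \<open>act_act\<close>.\<close>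

definition act :: "(nat \<Rightarrow> nat) \<Rightarrow> 'd::finite kfun \<Rightarrow> 'd kfun" where
  "act \<rho> f z = f (z \<circ> \<rho>)"

lemma act_act: "act \<rho> (act \<sigma> f) = act (\<rho> \<circ> \<sigma>) f"
  by (simp add: act_def fun_eq_iff comp_assoc)

text \<open>After relabelling by \<open>\<rho>\<close>, particle \<open>i\<close> of
  \<open>z\<close> sits in slot \<open>inv \<rho> i\<close>; the inverse in
  \<open>partial_act\<close> has this origin.\<close>

lemma shift_comp:
  assumes "bij \<rho>"
  shows "shift i b t z \<circ> \<rho> = shift (inv \<rho> i) b t (z \<circ> \<rho>)"
  using assms unfolding shift_def fun_eq_iff
  by (auto simp: bij_is_surj surj_f_inv_f inv_f_f[OF bij_is_inj] bij_inv_eq_iff)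

lemma partial_act:
  assumes "bij \<rho>"
  shows "partial i b (act \<rho> f) = act \<rho> (partial (inv \<rho> i) b f)"
  unfolding partial_def act_def shift_def[symmetric] shift_comp[OF assms] ..

lemma partial_add:
  assumes "dir_differentiable f" "dir_differentiable g" "b \<in> Basis"
  shows "partial i b (f + g) = partial i b f + partial i b g"
  by (rule partial_eqI) (auto intro!: derivative_eq_intros dir_differentiableD assms)

lemma partial_scaleR:
  assumes "dir_differentiable f" "b \<in> Basis"
  shows "partial i b (c *\<^sub>R f) = c *\<^sub>R partial i b f"
  by (rule partial_eqI) (auto simp: scaleR_fun_def intro!: derivative_eq_intros dir_differentiableD assms)

lemma partial_mult:
  assumes "dir_differentiable f" "dir_differentiable g" "b \<in> Basis"
  shows "partial i b (f * g) = partial i b f * g + f * partial i b g"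
  by (rule partial_eqI) (auto intro!: derivative_eq_intros dir_differentiableD assms)

lemma dir_differentiable_add:
  "dir_differentiable f \<Longrightarrow> dir_differentiable g \<Longrightarrow> dir_differentiable (f + g)"
  by (rule dir_differentiableI[where D = "\<lambda>i b z. partial i b f z + partial i b g z"])
    (auto intro!: derivative_eq_intros dir_differentiableD)

lemma dir_differentiable_scaleR:
  "dir_differentiable f \<Longrightarrow> dir_differentiable (c *\<^sub>R f)"
  by (rule dir_differentiableI[where D = "\<lambda>i b z. c * partial i b f z"])
    (auto simp: scaleR_fun_def intro!: derivative_eq_intros dir_differentiableD)

lemma dir_differentiable_mult:
  "dir_differentiable f \<Longrightarrow> dir_differentiable g \<Longrightarrow> dir_differentiable (f * g)"
  by (rule dir_differentiableI[where D = "\<lambda>i b z. partial i b f z * g z + f z * partial i b g z"])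
    (auto intro!: derivative_eq_intros dir_differentiableD)

lemma dir_differentiable_act:
  assumes "bij \<rho>" "dir_differentiable f"
  shows "dir_differentiable (act \<rho> f)"
  using assms(2) unfolding dir_differentiable_def act_def shift_comp[OF assms(1)] by blast

lemma continuous_act: "continuous_on UNIV f \<Longrightarrow> continuous_on UNIV (act \<rho> f)"
  unfolding act_def
  by (rule continuous_on_compose2[of UNIV f]) (auto simp: comp_def intro!: continuous_on_coordinatewise_then_product)

text \<open>Derivatives of a member of this closure are again members, so coinduction yields all closure
  properties of smoothness at once.\<close>

inductive smooth_hull :: "'d::finite kfun \<Rightarrow> bool" where
  base: "smooth_all f \<Longrightarrow> smooth_hull f"
| add: "smooth_hull f \<Longrightarrow> smooth_hull g \<Longrightarrow> smooth_hull (f + g)"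
| scaleR: "smooth_hull f \<Longrightarrow> smooth_hull (c *\<^sub>R f)"
| mult: "smooth_hull f \<Longrightarrow> smooth_hull g \<Longrightarrow> smooth_hull (f * g)"
| act: "bij \<rho> \<Longrightarrow> smooth_hull f \<Longrightarrow> smooth_hull (act \<rho> f)"

lemma smooth_hull_step:
  "smooth_hull f \<Longrightarrow> continuous_on UNIV f \<and> dir_differentiable f \<and>
     (\<forall>i. \<forall>b\<in>Basis. smooth_hull (partial i b f))"
proof (induction rule: smooth_hull.induct)
  case (base f)
  then show ?case
    by (auto intro: smooth_hull.base smooth_all_partial smooth_all_continuous smooth_all_dir_differentiable)
next
  case (add f g)
  moreover from add have "continuous_on UNIV (f + g)"
    unfolding plus_fun_def by (auto intro: continuous_on_add)
  ultimately show ?case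
    by (simp add: partial_add smooth_hull.add dir_differentiable_add del: plus_fun_apply)
next
  case (scaleR f c)
  moreover from scaleR have "continuous_on UNIV (c *\<^sub>R f)"
    unfolding scaleR_fun_def by (intro continuous_on_scaleR continuous_on_const) simp
  ultimately show ?case
    by (simp add: partial_scaleR smooth_hull.scaleR dir_differentiable_scaleR)
next
  case (mult f g)
  moreover from mult have "continuous_on UNIV (f * g)"
    unfolding times_fun_def by (auto intro: continuous_on_mult)
  ultimately show ?case
    by (simp add: partial_mult smooth_hull.add smooth_hull.mult dir_differentiable_mult
        del: plus_fun_apply times_fun_apply)
next
  case (act \<rho> f)
  then show ?case
    by (auto simp: partial_act dir_differentiable_act continuous_act intro: smooth_hull.act)
qed

lemma smooth_all_hull: "smooth_hull f \<Longrightarrow> smooth_all f"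
  by (rule smooth_all_coinduct[of smooth_hull]) (use smooth_hull_step in blast)+

lemma smooth_all_add: "smooth_all f \<Longrightarrow> smooth_all g \<Longrightarrow> smooth_all (f + g)"
  and smooth_all_scaleR: "smooth_all f \<Longrightarrow> smooth_all (c *\<^sub>R f)"
  and smooth_all_mult: "smooth_all f \<Longrightarrow> smooth_all g \<Longrightarrow> smooth_all (f * g)"
  and smooth_all_act: "bij \<rho> \<Longrightarrow> smooth_all f \<Longrightarrow> smooth_all (act \<rho> f)"
  by (blast intro: smooth_all_hull smooth_hull.intros)+

lemma partial_zero: "partial i b 0 = 0"
  by (rule partial_eqI) simp

lemma partials_zero: "partials \<alpha> 0 = 0"
proof (induction \<alpha>)
  case (Cons a \<alpha>)
  then show ?case by (cases a) (simp only: partials.simps partial_zero)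
qed (simp only: partials.simps)

lemma smooth_all_zero: "smooth_all 0"
  unfolding smooth_all_def partials_zero
  by (auto simp: zero_fun_def dir_differentiable_def)

lemma smooth_all_sum: "(\<And>x. x \<in> A \<Longrightarrow> smooth_all (f x)) \<Longrightarrow> smooth_all (sum f A)"
  by (induction A rule: infinite_finite_induct) (auto intro: smooth_all_add smooth_all_zero)

lemma smooth_all_minus: "smooth_all f \<Longrightarrow> smooth_all (- f)"
  using smooth_all_scaleR[of f "-1"] by simp

lemma smooth_all_diff: "smooth_all f \<Longrightarrow> smooth_all g \<Longrightarrow> smooth_all (f - g)"
  unfolding diff_conv_add_uminus by (intro smooth_all_add smooth_all_minus)

lemma partial_sum:
  assumes "\<And>x. x \<in> A \<Longrightarrow> smooth_all (f x)" "b \<in> Basis"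
  shows "partial i b (sum f A) = (\<Sum>x\<in>A. partial i b (f x))"
  using assms
  by (induction A rule: infinite_finite_induct)
    (auto simp: partial_zero partial_add smooth_all_dir_differentiable smooth_all_sum)

lemma partial_diff:
  assumes "smooth_all f" "smooth_all g" "b \<in> Basis"
  shows "partial i b (f - g) = partial i b f - partial i b g"
  using partial_add[of f "- g" b i] partial_scaleR[of g b i "-1"] assms
  by (simp add: smooth_all_dir_differentiable smooth_all_minus)

text \<open>The slice through \<open>z\<close> spanned by the two directions is a function on the
  plane, to which \<open>schwarz_real\<close> applies. Shifts in the same slot add up, so the case
  \<open>i = j\<close> is covered as well.\<close>

lemma partial_commute:
  assumes f: "smooth_all f" and b: "b \<in> Basis" "c \<in> Basis"
  shows "partial i b (partial j c f) = partial j c (partial i b f)"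
proof
  fix z
  note [simp] = smooth_all_dir_differentiable smooth_all_partial b f
  have D: "dir_differentiable h \<Longrightarrow> ((\<lambda>s. h (shift i b s (shift j c t z))) has_real_derivative
      partial i b h (shift i b s (shift j c t z))) (at s)"
    "dir_differentiable h \<Longrightarrow> ((\<lambda>t. h (shift i b s (shift j c t z))) has_real_derivative
      partial j c h (shift i b s (shift j c t z))) (at t)" for h s t
    using dir_differentiableD_at[of h b i "shift j c t z" s]
      dir_differentiableD_at[of h c j "shift i b s z" t] b by (auto simp: shift_commute[of i b])
  have C: "isCont (\<lambda>(s, t). h (shift i b s (shift j c t z))) (0, 0)" if "smooth_all h" for h
  proof -
    have "continuous_on UNIV (\<lambda>x. h (shift i b (fst x) (shift j c (snd x) z)))"
      by (rule continuous_on_compose2[OF smooth_all_continuous[OF that] continuous_on_shift2]) auto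
    then show ?thesis by (simp add: continuous_on_eq_continuous_at case_prod_unfold)
  qed
  have "partial j c (partial i b f) (shift i b 0 (shift j c 0 z)) =
    partial i b (partial j c f) (shift i b 0 (shift j c 0 z))"
    by (rule schwarz_real[of "\<lambda>s t. f (shift i b s (shift j c t z))"
      "\<lambda>s t. partial i b f (shift i b s (shift j c t z))"
      "\<lambda>s t. partial j c f (shift i b s (shift j c t z))"]) (auto intro!: D C)
  then show "partial i b (partial j c f) z = partial j c (partial i b f) z" by simp
qed

section \<open>Functions of the first k particles\<close>

lemma depends_on_first_partial:
  assumes "depends_on_first k f"
  shows "depends_on_first k (partial i b f)"
  unfolding depends_on_first_def
proof (intro allI impI)
  fix z w :: "nat \<Rightarrow> 'a phase" assume "\<forall>i\<in>{1..k}. z i = w i"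
  then have "f (shift i b t z) = f (shift i b t w)" for t
    by (intro assms[unfolded depends_on_first_def, rule_format]) (auto simp: shift_def)
  then show "partial i b f z = partial i b f w"
    unfolding partial_def shift_def[symmetric] by simp
qed

lemma partial_depends_on_first:
  assumes "depends_on_first k f" "i \<notin> {1..k}"
  shows "partial i b f = 0"
proof (rule partial_eqI)
  fix z
  have "f (shift i b t z) = f z" for t
    using assms by (intro assms(1)[unfolded depends_on_first_def, rule_format]) (auto simp: shift_def)
  then show "((\<lambda>t. f (shift i b t z)) has_real_derivative 0 z) (at 0)" by simp
qed

lemma depends_on_first_partials: "depends_on_first k f \<Longrightarrow> depends_on_first k (partials \<alpha> f)"
  by (induction \<alpha>) (auto intro: depends_on_first_partial)

text \<open>A direction beyond particle \<open>k\<close> annihilates the function wherever it stands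
  in the list, and further derivatives of \<open>0\<close> vanish. Hence suprema over
  \<open>directions k\<close> control derivatives in all directions.\<close>

lemma partials_depends_on_first:
  assumes "depends_on_first k f" "\<alpha> \<in> lists (UNIV \<times> Basis)" "\<alpha> \<notin> lists (directions k)"
  shows "partials \<alpha> f = 0"
  using assms(2,3)
proof (induction \<alpha>)
  case (Cons a \<alpha>)
  show ?case
  proof (cases "\<alpha> \<in> lists (directions k)")
    case True
    obtain i b where a: "a = (i, b)" by (cases a)
    have "a \<in> UNIV \<times> Basis" using Cons.hyps by blast
    then have b: "b \<in> Basis" unfolding a by blast
    have "i \<notin> {1..k}"
    proof
      assume "i \<in> {1..k}"
      then have "a \<in> directions k" using b unfolding a directions_def by blast
      then show False using Cons.prems True unfolding Cons_in_lists_iff by blast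
    qed
    with a show ?thesis
      by (simp add: partial_depends_on_first[OF depends_on_first_partials[OF assms(1)]])
  next
    case False
    then have "partials \<alpha> f = 0" by (rule Cons.IH)
    then show ?thesis by (cases a) (simp only: partials.simps partial_zero)
  qed
qed simp

lemma smooth_iff_smooth_all:
  assumes "depends_on_first k f"
  shows "smooth k f \<longleftrightarrow> smooth_all f"
proof
  assume s: "smooth k f"
  have "continuous_on UNIV (partials \<alpha> f) \<and> dir_differentiable (partials \<alpha> f)"
    if \<alpha>: "\<alpha> \<in> lists (UNIV \<times> Basis)" for \<alpha>
  proof (cases "\<alpha> \<in> lists (directions k)")
    case True
    have "(\<lambda>t. partials \<alpha> f (shift i b t z)) differentiable (at 0)" if "b \<in> Basis" for i b z
    proof (cases "i \<in> {1..k}")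
      case True
      then show ?thesis
        using s that \<open>\<alpha> \<in> lists (directions k)\<close> unfolding smooth_def shift_def[symmetric] directions_def by blast
    next
      case False
      then have "partials \<alpha> f (shift i b t z) = partials \<alpha> f z" for t
        using depends_on_first_partials[OF assms, of \<alpha>] unfolding depends_on_first_def shift_def
        by (metis fun_upd_apply)
      then show ?thesis by simp
    qed
    then show ?thesis using s True unfolding smooth_def dir_differentiable_def by blast
  next
    case False
    then show ?thesis using partials_depends_on_first[OF assms \<alpha>] by (simp add: zero_fun_def dir_differentiable_def)
  qed
  then show "smooth_all f" unfolding smooth_all_def by blast
next
  assume "smooth_all f"
  moreover have "lists (directions k) \<subseteq> lists (UNIV \<times> (Basis :: 'a phase set))"
    by (auto simp: directions_def)
  ultimately show "smooth k f"
    unfolding smooth_all_def smooth_def dir_differentiable_def shift_def directions_def by blast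
qed

section \<open>Symmetrization over permutations\<close>

definition perms :: "nat \<Rightarrow> (nat \<Rightarrow> nat) set" where
  "perms k = {\<pi>. \<pi> permutes {1..k}}"

lemma mem_perms [simp]: "\<pi> \<in> perms k \<longleftrightarrow> \<pi> permutes {1..k}"
  by (simp add: perms_def)

lemma finite_perms [simp]: "finite (perms k)"
  by (simp add: perms_def finite_permutations)

lemma card_perms: "card (perms k) = fact k"
  unfolding perms_def by (rule card_permutations) auto

lemma sum_perms_left:
  "q permutes {1..k} \<Longrightarrow> (\<Sum>p\<in>perms k. f (q \<circ> p)) = sum f (perms k)"
  unfolding perms_def by (rule setum_permutations_compose_left[symmetric])

lemma sum_perms_right:
  "q permutes {1..k} \<Longrightarrow> (\<Sum>p\<in>perms k. f (p \<circ> q)) = sum f (perms k)"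
  unfolding perms_def by (rule sum_permutations_compose_right[symmetric])

lemma sum_fun_apply: "sum f A x = (\<Sum>a\<in>A. f a x)"
  by (induction A rule: infinite_finite_induct) auto

text \<open>The complements of \<open>X\<close> and of its image in the finite set \<open>S\<close>
  have the same size, so any bijection between them completes \<open>q\<close>.\<close>

lemma extend_inj_on_permutes:
  assumes "finite S" "X \<subseteq> S" "q ` X \<subseteq> S" "inj_on q X"
  obtains \<pi> where "\<pi> permutes S" "\<And>x. x \<in> X \<Longrightarrow> \<pi> x = q x"
proof -
  have "card (S - X) = card (S - q ` X)"
    using assms by (simp add: card_Diff_subset finite_subset card_image)
  then obtain h where h: "bij_betw h (S - X) (S - q ` X)"
    using finite_same_card_bij[of "S - X" "S - q ` X"] assms(1) by auto
  define \<pi> where "\<pi> = (\<lambda>x. if x \<in> X then q x else if x \<in> S then h x else x)"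
  have "bij_betw \<pi> X (q ` X)"
    using inj_on_imp_bij_betw[OF assms(4)] by (rule bij_betw_cong[THEN iffD1, rotated]) (simp add: \<pi>_def)
  moreover have "bij_betw \<pi> (S - X) (S - q ` X)"
    using h by (rule bij_betw_cong[THEN iffD1, rotated]) (simp add: \<pi>_def)
  ultimately have "bij_betw \<pi> (X \<union> (S - X)) (q ` X \<union> (S - q ` X))"
    by (rule bij_betw_combine) auto
  then have "bij_betw \<pi> S S" using assms(2,3) by (simp add: Un_absorb1)
  then have "\<pi> permutes S" by (rule bij_imp_permutes) (use assms(2) in \<open>auto simp: \<pi>_def\<close>)
  then show ?thesis by (rule that) (simp add: \<pi>_def)
qed

lemma depends_on_firstD:
  "depends_on_first k f \<Longrightarrow> (\<And>i. i \<in> {1..k} \<Longrightarrow> z i = w i) \<Longrightarrow> f z = f w"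
  unfolding depends_on_first_def by blast

lemma act_cong:
  "depends_on_first k f \<Longrightarrow> (\<And>i. i \<in> {1..k} \<Longrightarrow> \<sigma> i = \<tau> i) \<Longrightarrow> act \<sigma> f = act \<tau> f"
  unfolding act_def fun_eq_iff by (auto intro: depends_on_firstD)

lemma depends_on_first_mono: "depends_on_first k f \<Longrightarrow> k \<le> m \<Longrightarrow> depends_on_first m f"
  unfolding depends_on_first_def by auto

lemma depends_on_first_act:
  "depends_on_first k f \<Longrightarrow> \<rho> ` {1..k} \<subseteq> {1..m} \<Longrightarrow> depends_on_first m (act \<rho> f)"
  unfolding depends_on_first_def act_def by (simp add: image_subset_iff)

lemma depends_on_first_zero: "depends_on_first k 0"
  unfolding depends_on_first_def zero_fun_apply by blast

lemma depends_on_first_add: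
  "depends_on_first k f \<Longrightarrow> depends_on_first k g \<Longrightarrow> depends_on_first k (f + g)"
  unfolding depends_on_first_def plus_fun_apply by metis

lemma depends_on_first_mult:
  "depends_on_first k f \<Longrightarrow> depends_on_first k g \<Longrightarrow> depends_on_first k (f * g)"
  unfolding depends_on_first_def times_fun_apply by metis

lemma depends_on_first_diff:
  "depends_on_first k f \<Longrightarrow> depends_on_first k g \<Longrightarrow> depends_on_first k (f - g)"
  unfolding depends_on_first_def minus_apply by metis

lemma depends_on_first_scaleR: "depends_on_first k f \<Longrightarrow> depends_on_first k (c *\<^sub>R f)"
  unfolding depends_on_first_def scaleR_fun_def by metis

lemma depends_on_first_sum:
  "(\<And>x. x \<in> A \<Longrightarrow> depends_on_first k (f x)) \<Longrightarrow> depends_on_first k (sum f A)"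
  by (induction A rule: infinite_finite_induct)
    (simp_all only: sum.infinite sum.empty sum.insert not_False_eq_True insertI1 insertI2
      depends_on_first_zero depends_on_first_add)

lemma g_space_iff:
  "f \<in> g_space k \<longleftrightarrow>
     depends_on_first k f \<and> smooth_all f \<and> (\<forall>\<pi>\<in>perms k. act \<pi> f = f)"
proof -
  have "(\<forall>\<pi>. \<pi> permutes {1..k} \<longrightarrow> (\<forall>z. f (z \<circ> \<pi>) = f z)) \<longleftrightarrow> (\<forall>\<pi>\<in>perms k. act \<pi> f = f)"
    by (simp only: act_def fun_eq_iff Ball_def mem_perms)
  then show ?thesis
    unfolding g_space_def mem_Collect_eq by (simp only: smooth_iff_smooth_all cong: conj_cong)
qed

lemma g_space_act: "f \<in> g_space k \<Longrightarrow> \<pi> permutes {1..k} \<Longrightarrow> act \<pi> f = f"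
  unfolding g_space_iff by (metis mem_perms)

lemma g_space_depends: "f \<in> g_space k \<Longrightarrow> depends_on_first k f"
  unfolding g_space_iff by blast

lemma g_space_smooth: "f \<in> g_space k \<Longrightarrow> smooth_all f"
  unfolding g_space_iff by blast

lemma act_add: "act \<rho> (f + g) = act \<rho> f + act \<rho> g"
  and act_scaleR: "act \<rho> (c *\<^sub>R f) = c *\<^sub>R act \<rho> f"
  and act_sum: "act \<rho> (sum h A) = (\<Sum>x\<in>A. act \<rho> (h x))"
  and act_zero: "act \<rho> 0 = 0"
  and act_mult: "act \<rho> (f * g) = act \<rho> f * act \<rho> g"
  by (auto simp: act_def fun_eq_iff scaleR_fun_def sum_fun_apply)

lemma subspace_g_space: "subspace (g_space k)"
  unfolding subspace_def Ball_def[of "g_space k"] g_space_iff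
  by (auto simp only: smooth_all_zero smooth_all_add smooth_all_scaleR act_zero act_add act_scaleR
      depends_on_first_zero depends_on_first_add depends_on_first_scaleR)

text \<open>A symmetric function sees only the set of particles that it is fed, not their order: the
  inverse of \<open>\<tau>\<close> after \<open>\<sigma>\<close> permutes \<open>{1..l}\<close> and
  is absorbed by \<open>f\<close>.\<close>

lemma act_eq_act:
  assumes f: "f \<in> g_space l" and "inj_on \<sigma> {1..l}" "inj_on \<tau> {1..l}" "\<sigma> ` {1..l} = \<tau> ` {1..l}"
  shows "act \<sigma> f = act \<tau> f"
proof -
  define q where "q = inv_into {1..l} \<tau> \<circ> \<sigma>"
  have \<sigma>: "\<sigma> i \<in> \<tau> ` {1..l}" if "i \<in> {1..l}" for i using that assms(4) by blast
  have "inj_on q {1..l}"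
    unfolding q_def using assms by (intro comp_inj_on) (auto intro: inj_on_inv_into)
  moreover have "q ` {1..l} \<subseteq> {1..l}"
    using inv_into_into[OF \<sigma>] by (auto simp: q_def simp del: atLeastAtMost_iff)
  ultimately obtain \<kappa> where \<kappa>: "\<kappa> permutes {1..l}" "\<And>i. i \<in> {1..l} \<Longrightarrow> \<kappa> i = q i"
    using extend_inj_on_permutes[of "{1..l}" "{1..l}" q] by auto
  have "act \<sigma> f = act (\<tau> \<circ> \<kappa>) f"
    by (rule act_cong[OF g_space_depends[OF f]]) (use f_inv_into_f[OF \<sigma>] \<kappa>(2) in \<open>simp add: q_def\<close>)
  also have "\<dots> = act \<tau> (act \<kappa> f)" by (simp add: act_act)
  finally show ?thesis unfolding g_space_act[OF f \<kappa>(1)] .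
qed

lemma Sym_eq: "Sym k h = (1 / fact k) *\<^sub>R (\<Sum>\<pi>\<in>perms k. act \<pi> h)"
  by (simp add: fun_eq_iff Sym_def scaleR_fun_def sum_fun_apply act_def perms_def)

lemma Sym_zero: "Sym k 0 = 0"
  and Sym_add: "Sym k (f + g) = Sym k f + Sym k g"
  and Sym_scaleR: "Sym k (c *\<^sub>R f) = c *\<^sub>R Sym k f"
  and Sym_diff: "Sym k (f - g) = Sym k f - Sym k g"
  by (simp_all add: fun_eq_iff Sym_def scaleR_fun_def sum.distrib sum_subtractf sum_distrib_left
      distrib_left right_diff_distrib mult.left_commute)

lemma Sym_sum: "Sym k (sum h A) = (\<Sum>x\<in>A. Sym k (h x))"
proof (induction A rule: infinite_finite_induct)
  case (insert x A)
  then show ?case by (simp only: sum.insert[OF insert.hyps(1,2)] Sym_add)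
qed (simp_all only: sum.infinite sum.empty Sym_zero not_False_eq_True)

lemma act_Sym:
  assumes "\<pi> permutes {1..k}"
  shows "act \<pi> (Sym k h) = Sym k h"
  unfolding Sym_eq act_scaleR act_sum act_act
  using sum_perms_left[OF assms, of "\<lambda>p. act p h"] by (rule arg_cong)

lemma Sym_act:
  assumes "\<pi> permutes {1..k}"
  shows "Sym k (act \<pi> h) = Sym k h"
  unfolding Sym_eq act_scaleR act_sum act_act
  using sum_perms_right[OF assms, of "\<lambda>p. act p h"] by (rule arg_cong)

lemma perms_mono: "\<pi> permutes {1..k} \<Longrightarrow> k \<le> n \<Longrightarrow> \<pi> permutes {1..n::nat}"
  by (rule permutes_subset) auto

text \<open>The permutations of \<open>{1..k}\<close> form a subgroup of those of
  \<open>{1..n}\<close>, and the larger average swallows the smaller one.\<close>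

lemma Sym_Sym:
  assumes "k \<le> n"
  shows "Sym n (Sym k h) = Sym n h"
proof -
  have "(\<Sum>\<pi>\<in>perms k. Sym n (act \<pi> h)) = (\<Sum>\<pi>\<in>perms k. Sym n h)"
    using perms_mono[OF _ assms] by (intro sum.cong refl Sym_act) auto
  then have *: "(\<Sum>\<pi>\<in>perms k. Sym n (act \<pi> h)) z = fact k * Sym n h z" for z
    by (simp only: sum_fun_apply) (simp add: card_perms)
  have "Sym n (Sym k h) z = Sym n h z" for z
    unfolding Sym_eq[of k] Sym_scaleR Sym_sum
    by (simp add: scaleR_fun_def *)
  then show ?thesis by blast
qed

lemma Sym_in_g_space:
  assumes "smooth_all h" "depends_on_first k h"
  shows "Sym k h \<in> g_space k"
  unfolding g_space_iff
proof (intro conjI ballI)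
  show "depends_on_first k (Sym k h)"
    unfolding Sym_eq using assms(2)
    by (intro depends_on_first_scaleR depends_on_first_sum depends_on_first_act[of k]) (auto simp: permutes_image)
  show "smooth_all (Sym k h)"
    unfolding Sym_eq using assms(1)
    by (intro smooth_all_scaleR smooth_all_sum smooth_all_act) (auto simp: permutes_bij)
qed (auto intro: act_Sym)

section \<open>The embeddings \<open>eps\<close> as averages over permutations\<close>

lemma tuples_extend:
  assumes "j \<in> tuples k n" "k \<le> n"
  obtains \<tau> where "\<tau> permutes {1..n}" "\<And>i. i \<in> {1..k} \<Longrightarrow> \<tau> i = j i"
  using assms extend_inj_on_permutes[of "{1..n}" "{1..k}" j]
  by (auto simp: tuples_def PiE_iff image_subset_iff)

lemma finite_tuples: "finite (tuples k n)"
  by (rule finite_subset[of _ "{1..k} \<rightarrow>\<^sub>E {1..n}"]) (auto simp: tuples_def intro: finite_PiE)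

lemma tuples_nonempty:
  assumes "k \<le> n"
  shows "tuples k n \<noteq> {}"
proof -
  have "restrict id {1..k} \<in> tuples k n"
    using assms by (auto simp: tuples_def inj_on_def)
  then show ?thesis by blast
qed

lemma restrict_comp_tuples:
  assumes "\<pi> permutes {1..n}" "j \<in> tuples k n"
  shows "restrict (\<pi> \<circ> j) {1..k} \<in> tuples k n"
proof -
  have "inj_on (\<pi> \<circ> j) {1..k}"
    using assms by (auto simp: tuples_def intro: comp_inj_on permutes_inj_on)
  then have "inj_on (restrict (\<pi> \<circ> j) {1..k}) {1..k}"
    by (simp only: inj_on_restrict_eq)
  moreover have "restrict (\<pi> \<circ> j) {1..k} \<in> {1..k} \<rightarrow>\<^sub>E {1..n}"
    using assms(2) permutes_in_image[OF assms(1)] unfolding restrict_PiE_iff tuples_def by fastforce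
  ultimately show ?thesis unfolding tuples_def by blast
qed

text \<open>Composition with \<open>\<pi>\<close> permutes the tuples. A tuple is an extensional
  function, hence the \<open>restrict\<close> after each composition.\<close>

lemma eps_act:
  assumes f: "depends_on_first k f" and \<pi>: "\<pi> permutes {1..n}"
  shows "act \<pi> (eps k n f) = eps k n f"
proof
  fix z
  let ?r = "\<lambda>\<pi> j. restrict (\<pi> \<circ> j) {1..k}"
  have inv: "?r (inv \<sigma>) (?r \<sigma> j) = j" if "\<sigma> permutes {1..n}" "j \<in> tuples k n" for \<sigma> j
    using that permutes_inverses[OF that(1)] unfolding tuples_def by (auto simp: fun_eq_iff PiE_iff extensional_def)
  have inv': "?r \<sigma> (?r (inv \<sigma>) j) = j" if "\<sigma> permutes {1..n}" "j \<in> tuples k n" for \<sigma> j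
    using that permutes_inverses[OF that(1)] unfolding tuples_def by (auto simp: fun_eq_iff PiE_iff extensional_def)
  have "(\<Sum>j\<in>tuples k n. f (z \<circ> j)) = (\<Sum>j\<in>tuples k n. f (z \<circ> ?r \<pi> j))"
    by (rule sum.reindex_bij_witness[of _ "?r \<pi>" "?r (inv \<pi>)"])
      (use inv[OF \<pi>] inv'[OF \<pi>] restrict_comp_tuples[OF \<pi>] restrict_comp_tuples[OF permutes_inv[OF \<pi>]] in simp_all)
  also have "\<dots> = (\<Sum>j\<in>tuples k n. f (z \<circ> \<pi> \<circ> j))"
    by (intro sum.cong refl depends_on_firstD[OF f]) auto
  finally show "act \<pi> (eps k n f) z = eps k n f z"
    by (simp add: act_def eps_def)
qed

text \<open>\<open>eps k n f\<close> is symmetric, so it equals its own average over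
  \<open>perms n\<close>. In that average every tuple extends to a permutation that reindexing
  removes, so all tuples contribute the same.\<close>

lemma eps_eq_Sym:
  assumes f: "depends_on_first k f" and kn: "k \<le> n"
  shows "eps k n f = Sym n f"
proof
  fix z
  let ?T = "tuples k n"
  have *: "(\<Sum>\<pi>\<in>perms n. f (z \<circ> \<pi> \<circ> j)) = (\<Sum>\<pi>\<in>perms n. f (z \<circ> \<pi>))" if "j \<in> ?T" for j
  proof -
    obtain \<tau> where \<tau>: "\<tau> permutes {1..n}" "\<And>i. i \<in> {1..k} \<Longrightarrow> \<tau> i = j i"
      using tuples_extend[OF \<open>j \<in> ?T\<close> kn] by blast
    have "(\<Sum>\<pi>\<in>perms n. f (z \<circ> \<pi> \<circ> j)) = (\<Sum>\<pi>\<in>perms n. f (z \<circ> (\<pi> \<circ> \<tau>)))"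
      by (intro sum.cong refl depends_on_firstD[OF f]) (use \<tau> in auto)
    then show ?thesis using sum_perms_right[OF \<tau>(1), of "\<lambda>\<pi>. f (z \<circ> \<pi>)"] by simp
  qed
  have T: "card ?T \<noteq> 0" using finite_tuples tuples_nonempty[OF kn] by simp
  have "fact n * eps k n f z = (\<Sum>\<pi>\<in>perms n. eps k n f (z \<circ> \<pi>))"
    using eps_act[OF f] by (simp add: act_def fun_eq_iff card_perms)
  also have "\<dots> = (1 / real (card ?T)) * (\<Sum>j\<in>?T. \<Sum>\<pi>\<in>perms n. f (z \<circ> \<pi> \<circ> j))"
    unfolding eps_def by (subst sum.swap) (simp add: sum_distrib_left)
  also have "\<dots> = (\<Sum>\<pi>\<in>perms n. f (z \<circ> \<pi>))"
    using * T by simp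
  finally show "eps k n f z = Sym n f z"
    by (simp add: Sym_def perms_def field_simps)
qed

text \<open>Induction on the number of nonzero particles: at a configuration with \<open>m\<close> of them, every summand with
  fewer vanishes by induction, and all others equal the value to be shown zero.\<close>

lemma Sym_eq_0_imp:
  assumes f: "f \<in> g_space k" and kn: "k \<le> n" and 0: "Sym n f = 0"
  shows "f = 0"
proof
  define supp where "supp w = {i \<in> {1..k}. w i \<noteq> 0}" for w :: "nat \<Rightarrow> 'a phase"
  note dep = g_space_depends[OF f]
  have "f w = 0" for w
  proof (induction "card (supp w)" arbitrary: w rule: less_induct)
    case less
    \<comment> \<open>Particles beyond \<open>k\<close> are set to zero, so that a permutation of
      \<open>{1..n}\<close> cannot bring additional nonzero particles into the first
      \<open>k\<close> slots.\<close>
    define u where "u = (\<lambda>i. if i \<in> {1..k} then w i else 0)"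
    have u: "f u = f w" "supp u = supp w" by (auto simp: u_def supp_def intro: depends_on_firstD[OF dep])
    have fin: "finite (supp w)" and supp_sub: "supp w \<subseteq> {1..k}" for w by (auto simp: supp_def)
    have *: "f (u \<circ> \<pi>) \<in> {0, f u}" if \<pi>: "\<pi> permutes {1..n}" for \<pi>
    proof -
      let ?X = "supp (u \<circ> \<pi>)"
      have inj: "inj_on \<pi> ?X" using permutes_inj_on[OF \<pi>] .
      have sub: "\<pi> ` ?X \<subseteq> supp u" by (auto simp: supp_def u_def split: if_splits)
      show ?thesis
      proof (cases "card ?X < card (supp w)")
        case True
        then show ?thesis using less by simp
      next
        case False
        then have im: "\<pi> ` ?X = supp u"
          using sub card_image[OF inj] u(2) fin by (intro card_seteq) auto
        then obtain \<tau> where \<tau>: "\<tau> permutes {1..k}" "\<And>x. x \<in> ?X \<Longrightarrow> \<tau> x = \<pi> x"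
          using extend_inj_on_permutes[of "{1..k}" ?X \<pi>] inj supp_sub by (metis finite_atLeastAtMost)
        have "(u \<circ> \<pi>) i = (u \<circ> \<tau>) i" if i: "i \<in> {1..k}" for i
        proof (cases "i \<in> ?X")
          case False
          have "\<tau> i \<notin> \<tau> ` ?X" using False permutes_inj[OF \<tau>(1)] by (auto simp: inj_eq)
          then have "\<tau> i \<notin> supp u" using im \<tau>(2) by force
          moreover have "\<tau> i \<in> {1..k}" using i permutes_in_image[OF \<tau>(1)] by blast
          ultimately show ?thesis using False i by (simp add: supp_def)
        qed (use \<tau> in auto)
        then have "f (u \<circ> \<pi>) = f (u \<circ> \<tau>)" by (rule depends_on_firstD[OF dep])
        also have "\<dots> = f u" using g_space_act[OF f \<tau>(1)] by (metis act_def)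
        finally show ?thesis by simp
      qed
    qed
    have "(\<Sum>\<pi>\<in>perms n. f (u \<circ> \<pi>)) = 0"
      using fun_cong[OF 0, of u] by (simp add: Sym_def perms_def)
    \<comment> \<open>Multiplication by \<open>f u\<close> turns every summand into \<open>0\<close>
      or the square of \<open>f u\<close>. A vanishing sum then forces each summand to vanish, among
      them the one of the identity.\<close>
    then have "(\<Sum>\<pi>\<in>perms n. f (u \<circ> \<pi>) * f u) = 0" by (simp only: sum_distrib_right[symmetric] mult_zero_left)
    moreover have "f (u \<circ> \<pi>) * f u \<ge> 0" if "\<pi> \<in> perms n" for \<pi> using *[of \<pi>] that by auto
    ultimately have "f (u \<circ> id) * f u = 0"
      using sum_nonneg_eq_0_iff[of "perms n" "\<lambda>\<pi>. f (u \<circ> \<pi>) * f u"] permutes_id[of "{1..n}"]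
      by (metis (no_types, lifting) finite_perms mem_perms)
    then show ?case using u by simp
  qed
  then show "f z = 0 z" for z by simp
qed

lemma inj_on_eps:
  assumes "k \<le> n"
  shows "inj_on (eps k n) (g_space k)"
proof (rule inj_onI)
  fix f g :: "'a kfun" assume fg: "f \<in> g_space k" "g \<in> g_space k" "eps k n f = eps k n g"
  then have "Sym n (f - g) = 0"
    using eps_eq_Sym[OF g_space_depends assms] by (metis Sym_diff diff_self)
  moreover have "f - g \<in> g_space k" using fg subspace_diff[OF subspace_g_space] by blast
  ultimately have "f - g = 0" using Sym_eq_0_imp assms by blast
  then show "f = g" by simp
qed

section \<open>The Poisson bracket and overlaps\<close>

lemma act_id: "act id f = f"
  by (rule ext) (simp add: act_def)

definition px :: "nat \<Rightarrow> 'd \<Rightarrow> 'd::finite kfun \<Rightarrow> 'd kfun" where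
  "px i c = partial i (axis c 1, 0)"

definition pv :: "nat \<Rightarrow> 'd \<Rightarrow> 'd::finite kfun \<Rightarrow> 'd kfun" where
  "pv i c = partial i (0, axis c 1)"

lemma x_dir: "(axis c 1, 0) \<in> (Basis :: 'd::finite phase set)"
  and v_dir: "(0, axis c 1) \<in> (Basis :: 'd::finite phase set)"
  by (auto simp: Basis_prod_def axis_in_Basis_iff)

lemma px_add: "smooth_all f \<Longrightarrow> smooth_all g \<Longrightarrow> px i c (f + g) = px i c f + px i c g"
  and pv_add: "smooth_all f \<Longrightarrow> smooth_all g \<Longrightarrow> pv i c (f + g) = pv i c f + pv i c g"
  and px_scaleR: "smooth_all f \<Longrightarrow> px i c (a *\<^sub>R f) = a *\<^sub>R px i c f"
  and pv_scaleR: "smooth_all f \<Longrightarrow> pv i c (a *\<^sub>R f) = a *\<^sub>R pv i c f"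
  and px_mult: "smooth_all f \<Longrightarrow> smooth_all g \<Longrightarrow> px i c (f * g) = px i c f * g + f * px i c g"
  and pv_mult: "smooth_all f \<Longrightarrow> smooth_all g \<Longrightarrow> pv i c (f * g) = pv i c f * g + f * pv i c g"
  and px_diff: "smooth_all f \<Longrightarrow> smooth_all g \<Longrightarrow> px i c (f - g) = px i c f - px i c g"
  and pv_diff: "smooth_all f \<Longrightarrow> smooth_all g \<Longrightarrow> pv i c (f - g) = pv i c f - pv i c g"
  unfolding px_def pv_def
  by (rule partial_add partial_scaleR partial_mult partial_diff x_dir v_dir smooth_all_dir_differentiable | assumption)+

lemma px_zero: "px i c 0 = 0" and pv_zero: "pv i c 0 = 0"
  unfolding px_def pv_def by (rule partial_zero)+

lemma px_sum: "(\<And>x. x \<in> A \<Longrightarrow> smooth_all (f x)) \<Longrightarrow> px i c (sum f A) = (\<Sum>x\<in>A. px i c (f x))"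
  and pv_sum: "(\<And>x. x \<in> A \<Longrightarrow> smooth_all (f x)) \<Longrightarrow> pv i c (sum f A) = (\<Sum>x\<in>A. pv i c (f x))"
  unfolding px_def pv_def by (rule partial_sum x_dir v_dir | assumption)+

lemma smooth_px: "smooth_all f \<Longrightarrow> smooth_all (px i c f)"
  and smooth_pv: "smooth_all f \<Longrightarrow> smooth_all (pv i c f)"
  unfolding px_def pv_def by (rule smooth_all_partial x_dir v_dir | assumption)+

text \<open>The bracket of \<open>g_bracket\<close> without its prefactor, which is split off so
  that it can be merged with probabilities into \<open>coef\<close>.\<close>

definition pb :: "nat \<Rightarrow> 'd::finite kfun \<Rightarrow> 'd kfun \<Rightarrow> 'd kfun" where
  "pb n f g = (\<Sum>i=1..n. \<Sum>c\<in>UNIV. px i c f * pv i c g - pv i c f * px i c g)"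

lemma pb_apply:
  "pb n f g z = (\<Sum>i=1..n. \<Sum>c\<in>UNIV. px i c f z * pv i c g z - pv i c f z * px i c g z)"
  unfolding pb_def sum_fun_apply by simp

lemma g_bracket_eq_pb: "g_bracket n f g = real n *\<^sub>R pb n f g"
  unfolding fun_eq_iff g_bracket_def scaleR_fun_def pb_apply grad_x_def grad_v_def px_def pv_def
  by (simp add: inner_vec_def sum_subtractf)

lemma smooth_pb: "smooth_all f \<Longrightarrow> smooth_all g \<Longrightarrow> smooth_all (pb n f g)"
  unfolding pb_def by (intro smooth_all_sum smooth_all_diff smooth_all_mult smooth_px smooth_pv)

lemma depends_on_first_pb:
  "depends_on_first k f \<Longrightarrow> depends_on_first k g \<Longrightarrow> depends_on_first k (pb n f g)"
  unfolding pb_def px_def pv_def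
  by (intro depends_on_first_sum depends_on_first_diff depends_on_first_mult depends_on_first_partial)

lemma pb_antisym: "pb n f g = - pb n g f"
proof
  fix z
  show "pb n f g z = (- pb n g f) z"
    unfolding fun_Compl_def pb_apply sum_negf[symmetric] by (intro sum.cong refl) simp
qed

lemma pb_add_right:
  "smooth_all g \<Longrightarrow> smooth_all h \<Longrightarrow> pb n f (g + h) = pb n f g + pb n f h"
  by (rule ext) (simp add: pb_apply px_add pv_add algebra_simps flip: sum.distrib)

lemma pb_scaleR_right: "smooth_all g \<Longrightarrow> pb n f (a *\<^sub>R g) = a *\<^sub>R pb n f g"
proof
  fix z
  assume g: "smooth_all g"
  show "pb n f (a *\<^sub>R g) z = (a *\<^sub>R pb n f g) z"
    unfolding pb_apply px_scaleR[OF g] pv_scaleR[OF g] unfolding scaleR_fun_def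
    by (simp add: sum_distrib_left algebra_simps)
qed

lemma pb_zero_right: "pb n f 0 = 0"
  by (rule ext) (simp only: pb_apply px_zero pv_zero zero_fun_apply mult_zero_right diff_zero sum.neutral_const)

lemma pb_sum_right:
  "(\<And>x. x \<in> A \<Longrightarrow> smooth_all (g x)) \<Longrightarrow> pb n f (sum g A) = (\<Sum>x\<in>A. pb n f (g x))"
proof (induction A rule: infinite_finite_induct)
  case (insert x A)
  then show ?case unfolding sum.insert[OF insert.hyps(1,2)] by (simp only: insertI1 insertI2 pb_add_right smooth_all_sum)
qed (simp_all only: sum.infinite sum.empty not_False_eq_True pb_zero_right)

lemma pb_add_left:
  assumes "smooth_all f" "smooth_all h"
  shows "pb n (f + h) g = pb n f g + pb n h g"
  unfolding pb_antisym[of n _ g] pb_add_right[OF assms] by simp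

lemma pb_scaleR_left: "smooth_all f \<Longrightarrow> pb n (a *\<^sub>R f) g = a *\<^sub>R pb n f g"
  unfolding pb_antisym[of n _ g] by (simp only: pb_scaleR_right scaleR_minus_right)

lemma pb_sum_left:
  "(\<And>x. x \<in> A \<Longrightarrow> smooth_all (f x)) \<Longrightarrow> pb n (sum f A) g = (\<Sum>x\<in>A. pb n (f x) g)"
  unfolding pb_antisym[of n _ g] by (simp only: pb_sum_right sum_negf)

lemma pb_act:
  assumes "\<pi> permutes {1..n}"
  shows "pb n (act \<pi> f) (act \<pi> g) = act \<pi> (pb n f g)"
proof
  fix z
  have b: "bij \<pi>" using assms by (rule permutes_bij)
  let ?t = "\<lambda>i. \<Sum>c\<in>UNIV. px i c f (z \<circ> \<pi>) * pv i c g (z \<circ> \<pi>) - pv i c f (z \<circ> \<pi>) * px i c g (z \<circ> \<pi>)"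
  have "pb n (act \<pi> f) (act \<pi> g) z = (\<Sum>i=1..n. ?t (inv \<pi> i))"
    unfolding pb_apply px_def pv_def partial_act[OF b] by (simp add: act_def)
  also have "\<dots> = (\<Sum>i=1..n. ?t i)"
    using sum.permute[OF permutes_inv[OF assms], of ?t] by (simp add: comp_def)
  also have "\<dots> = act \<pi> (pb n f g) z"
    unfolding act_def pb_apply ..
  finally show "pb n (act \<pi> f) (act \<pi> g) z = act \<pi> (pb n f g) z" .
qed

lemma px_depends: "depends_on_first k f \<Longrightarrow> i \<notin> {1..k} \<Longrightarrow> px i c f = 0"
  and pv_depends: "depends_on_first k f \<Longrightarrow> i \<notin> {1..k} \<Longrightarrow> pv i c f = 0"
  unfolding px_def pv_def by (rule partial_depends_on_first; assumption)+

text \<open>Each product differentiates both functions in the same particle, so a particle seen by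
  only one of them contributes nothing and the shared particles remain.\<close>

lemma pb_act_right:
  assumes f: "depends_on_first l f" and g: "depends_on_first j g"
    and \<rho>: "\<rho> permutes {1..n}" and "l \<le> n"
  shows "pb n f (act \<rho> g) z = (\<Sum>i\<in>\<rho> ` {1..j} \<inter> {1..l}. \<Sum>c\<in>UNIV.
    px i c f z * pv (inv \<rho> i) c g (z \<circ> \<rho>) - pv i c f z * px (inv \<rho> i) c g (z \<circ> \<rho>))"
proof -
  have b: "bij \<rho>" using \<rho> by (rule permutes_bij)
  have D: "px i c (act \<rho> g) z = px (inv \<rho> i) c g (z \<circ> \<rho>)" "pv i c (act \<rho> g) z = pv (inv \<rho> i) c g (z \<circ> \<rho>)" for i c
    unfolding px_def pv_def partial_act[OF b] by (simp_all add: act_def)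
  have "inv \<rho> i \<notin> {1..j}" if "i \<notin> \<rho> ` {1..j}" for i
    using that permutes_inverses(1)[OF \<rho>] by (metis imageI)
  then have "px i c f z * pv (inv \<rho> i) c g (z \<circ> \<rho>) - pv i c f z * px (inv \<rho> i) c g (z \<circ> \<rho>) = 0"
    if "i \<notin> \<rho> ` {1..j} \<inter> {1..l}" for i c
    using that px_depends[OF f] pv_depends[OF f] px_depends[OF g] pv_depends[OF g]
    by (metis IntI diff_self mult_zero_left mult_zero_right zero_fun_apply)
  then show ?thesis
    unfolding pb_apply D using \<open>l \<le> n\<close> by (intro sum.mono_neutral_right) auto
qed

text \<open>Derivatives of \<open>f\<close> in particles beyond \<open>k\<close> vanish, so the
  bracket can be taken with a number of particles that does not grow with \<open>N\<close>.\<close>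

lemma pb_change_n:
  assumes f: "depends_on_first k f" and "k \<le> n"
  shows "pb n f g = pb k f g"
proof
  fix z
  show "pb n f g z = pb k f g z"
    unfolding pb_apply using \<open>k \<le> n\<close> px_depends[OF f] pv_depends[OF f]
    by (intro sum.mono_neutral_right) auto
qed

text \<open>In the double average over \<open>\<pi>\<close> and \<open>\<rho>\<close>, substituting
  \<open>\<pi> \<circ> \<rho>\<close> for \<open>\<rho>\<close> lets \<open>\<pi>\<close> act on
  both arguments. Equivariance moves it outside, where it becomes the outer
  \<open>Sym\<close>.\<close>

lemma pb_Sym:
  assumes f: "smooth_all f" and g: "smooth_all g"
  shows "pb n (Sym n f) (Sym n g) = (1 / fact n) *\<^sub>R (\<Sum>\<rho>\<in>perms n. Sym n (pb n f (act \<rho> g)))"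
proof -
  have s: "smooth_all (act \<pi> h)" if "\<pi> \<in> perms n" "smooth_all h" for \<pi> and h :: "'a kfun"
    using that by (auto intro: smooth_all_act permutes_bij)
  have "pb n (Sym n f) (Sym n g) = (1 / fact n) *\<^sub>R (1 / fact n) *\<^sub>R
      (\<Sum>\<rho>\<in>perms n. \<Sum>\<pi>\<in>perms n. pb n (act \<pi> f) (act \<rho> g))"
    unfolding Sym_eq
    by (simp only: pb_scaleR_left pb_scaleR_right pb_sum_left pb_sum_right smooth_all_sum smooth_all_scaleR s f g
        scaleR_sum_right[symmetric])
  also have "(\<Sum>\<rho>\<in>perms n. \<Sum>\<pi>\<in>perms n. pb n (act \<pi> f) (act \<rho> g)) =
      (\<Sum>\<pi>\<in>perms n. \<Sum>\<rho>\<in>perms n. pb n (act \<pi> f) (act \<rho> g))"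
    by (rule sum.swap)
  also have "(\<Sum>\<pi>\<in>perms n. \<Sum>\<rho>\<in>perms n. pb n (act \<pi> f) (act \<rho> g)) =
      (\<Sum>\<pi>\<in>perms n. \<Sum>\<rho>\<in>perms n. act \<pi> (pb n f (act \<rho> g)))"
  proof (rule sum.cong[OF refl])
    fix \<pi> assume "\<pi> \<in> perms n"
    then have \<pi>: "\<pi> permutes {1..n}" by simp
    show "(\<Sum>\<rho>\<in>perms n. pb n (act \<pi> f) (act \<rho> g)) = (\<Sum>\<rho>\<in>perms n. act \<pi> (pb n f (act \<rho> g)))"
      unfolding sum_perms_left[OF \<pi>, of "\<lambda>\<rho>. pb n (act \<pi> f) (act \<rho> g)", symmetric]
        act_act[symmetric] pb_act[OF \<pi>] ..
  qed
  also have "\<dots> = (\<Sum>\<rho>\<in>perms n. \<Sum>\<pi>\<in>perms n. act \<pi> (pb n f (act \<rho> g)))"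
    by (rule sum.swap)
  finally show ?thesis unfolding Sym_eq scaleR_sum_right .
qed

section \<open>Classification of permutations by their overlap\<close>

definition overlap :: "nat \<Rightarrow> nat \<Rightarrow> (nat \<Rightarrow> nat) \<Rightarrow> nat" where
  "overlap l j \<rho> = card (\<rho> ` {1..j} \<inter> {1..l})"

lemma overlap_le: "overlap l j \<rho> \<le> min l j"
proof -
  have "overlap l j \<rho> \<le> card {1..l}" unfolding overlap_def by (intro card_mono) auto
  moreover have "overlap l j \<rho> \<le> card (\<rho> ` {1..j})" unfolding overlap_def by (intro card_mono) auto
  moreover have "card (\<rho> ` {1..j}) \<le> card {1..j}" by (rule card_image_le) simp
  ultimately show ?thesis by simp
qed

lemma pb_overlap_0:
  assumes "depends_on_first l f" "depends_on_first j g" "\<rho> permutes {1..n}" "l \<le> n" "overlap l j \<rho> = 0"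
  shows "pb n f (act \<rho> g) = 0"
proof
  fix z
  have "\<rho> ` {1..j} \<inter> {1..l} = {}" using assms(5) by (simp add: overlap_def)
  then show "pb n f (act \<rho> g) z = 0 z"
    unfolding pb_act_right[OF assms(1-4)] by simp
qed

text \<open>The overlap fixes the sizes of all cells that the two index sets cut out, so the cells
  for \<open>\<rho>\<close> and for \<open>\<rho>'\<close> can be matched one by one and the
  matching extended to a permutation.\<close>

lemma overlap_transitive:
  assumes \<rho>: "\<rho> permutes {1..n}" and \<rho>': "\<rho>' permutes {1..n}" and "l \<le> n" "j \<le> n"
    and eq: "overlap l j \<rho> = overlap l j \<rho>'"
  obtains \<sigma> where "\<sigma> permutes {1..n}" "\<sigma> ` {1..l} = {1..l}" "\<sigma> ` \<rho> ` {1..j} = \<rho>' ` {1..j}"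
proof -
  define A A' L where "A = \<rho> ` {1..j}" and "A' = \<rho>' ` {1..j}" and "L = {1..l}"
  have fin: "finite A" "finite A'" "finite L" by (auto simp: A_def A'_def L_def)
  have sub: "A \<subseteq> {1..n}" "A' \<subseteq> {1..n}" "L \<subseteq> {1..n}"
    using \<open>l \<le> n\<close> image_mono[of "{1..j}" "{1..n}" \<rho>] image_mono[of "{1..j}" "{1..n}" \<rho>'] \<open>j \<le> n\<close>
    unfolding A_def A'_def L_def permutes_image[OF \<rho>] permutes_image[OF \<rho>'] by simp_all
  have cA: "card A = j" "card A' = j"
    using card_image[OF permutes_inj_on[OF \<rho>]] card_image[OF permutes_inj_on[OF \<rho>']] by (simp_all add: A_def A'_def)
  have cI: "card (A \<inter> L) = card (A' \<inter> L)" using eq by (simp add: overlap_def A_def A'_def L_def)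
  have cD: "card (A - L) = card (A' - L)" "card (L - A) = card (L - A')"
    using fin cA cI by (simp_all add: card_Diff_subset_Int Int_commute[of L])
  obtain h1 where h1: "bij_betw h1 (A \<inter> L) (A' \<inter> L)"
    using finite_same_card_bij[OF _ _ cI] fin by (meson finite_Int finite_Diff)
  obtain h2 where h2: "bij_betw h2 (A - L) (A' - L)"
    using finite_same_card_bij[OF _ _ cD(1)] fin by (meson finite_Int finite_Diff)
  obtain h3 where h3: "bij_betw h3 (L - A) (L - A')"
    using finite_same_card_bij[OF _ _ cD(2)] fin by (meson finite_Int finite_Diff)
  define q where "q = (\<lambda>x. if x \<in> L then if x \<in> A then h1 x else h3 x else h2 x)"
  have q1: "bij_betw q (A \<inter> L) (A' \<inter> L)"
    using h1 by (rule bij_betw_cong[THEN iffD1, rotated]) (simp add: q_def)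
  have q2: "bij_betw q (A - L) (A' - L)"
    using h2 by (rule bij_betw_cong[THEN iffD1, rotated]) (simp add: q_def)
  have q3: "bij_betw q (L - A) (L - A')"
    using h3 by (rule bij_betw_cong[THEN iffD1, rotated]) (simp add: q_def)
  have "bij_betw q ((A \<inter> L) \<union> (A - L)) ((A' \<inter> L) \<union> (A' - L))"
    by (rule bij_betw_combine[OF q1 q2]) auto
  then have qA: "bij_betw q A A'" by (simp only: Int_Diff_Un)
  have "bij_betw q ((A \<inter> L) \<union> (L - A)) ((A' \<inter> L) \<union> (L - A'))"
    by (rule bij_betw_combine[OF q1 q3]) auto
  then have qL: "bij_betw q L L" by (simp only: Int_Diff_Un Int_commute[of _ L])
  have "bij_betw q (A \<union> (L - A)) (A' \<union> (L - A'))"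
    by (rule bij_betw_combine[OF qA q3]) auto
  then have qX: "bij_betw q (A \<union> L) (A' \<union> L)" by simp
  have im: "q ` (A \<union> L) \<subseteq> {1..n}" and inj: "inj_on q (A \<union> L)"
    using bij_betw_imp_surj_on[OF qX] bij_betw_imp_inj_on[OF qX] sub(2,3) by simp_all
  have "A \<union> L \<subseteq> {1..n}" using sub(1,3) by (rule Un_least)
  then obtain \<sigma> where \<sigma>: "\<sigma> permutes {1..n}" "\<And>x. x \<in> A \<union> L \<Longrightarrow> \<sigma> x = q x"
    by (rule extend_inj_on_permutes[OF finite_atLeastAtMost _ im inj]) blast
  have "\<sigma> ` A = q ` A" "\<sigma> ` L = q ` L" by (rule image_cong[OF refl \<sigma>(2)]; blast)+
  then have "\<sigma> ` A = A'" "\<sigma> ` L = L" using qA qL by (simp_all add: bij_betw_def)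
  then show ?thesis using \<sigma>(1) by (intro that[of \<sigma>]) (simp_all only: A_def A'_def L_def)
qed

text \<open>The permutation from \<open>overlap_transitive\<close> preserves \<open>{1..l}\<close>
  and hence fixes the symmetric \<open>f\<close>, while it carries \<open>act \<rho> g\<close> to
  \<open>act \<rho>' g\<close>. The outer average does not notice it.\<close>

lemma Sym_pb_overlap_eq:
  assumes f: "f \<in> g_space l" and g: "g \<in> g_space j"
    and \<rho>: "\<rho> permutes {1..n}" and \<rho>': "\<rho>' permutes {1..n}" and "l \<le> n" "j \<le> n"
    and eq: "overlap l j \<rho> = overlap l j \<rho>'"
  shows "Sym n (pb n f (act \<rho> g)) = Sym n (pb n f (act \<rho>' g))"
proof -
  obtain \<sigma> where \<sigma>: "\<sigma> permutes {1..n}" "\<sigma> ` {1..l} = {1..l}" "\<sigma> ` \<rho> ` {1..j} = \<rho>' ` {1..j}"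
    using overlap_transitive[OF assms(3-7)] by blast
  have "act \<sigma> f = act id f"
    by (rule act_eq_act[OF f]) (simp_all only: permutes_inj_on[OF \<sigma>(1)] inj_on_id \<sigma>(2) image_id id_apply)
  then have 1: "act \<sigma> f = f" unfolding act_id .
  have 2: "act \<sigma> (act \<rho> g) = act \<rho>' g"
    unfolding act_act
  proof (rule act_eq_act[OF g])
    show "inj_on (\<sigma> \<circ> \<rho>) {1..j}" by (rule permutes_inj_on[OF permutes_compose[OF \<rho> \<sigma>(1)]])
    show "inj_on \<rho>' {1..j}" by (rule permutes_inj_on[OF \<rho>'])
    show "(\<sigma> \<circ> \<rho>) ` {1..j} = \<rho>' ` {1..j}" using \<sigma>(3) by (simp only: image_comp)
  qed
  have "pb n f (act \<rho>' g) = act \<sigma> (pb n f (act \<rho> g))"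
    using pb_act[OF \<sigma>(1), of f "act \<rho> g"] unfolding 1 2 .
  then show ?thesis by (simp only: Sym_act[OF \<sigma>(1)])
qed

text \<open>A representative of the permutations of overlap \<open>r\<close> that moves only the first \<open>l + j - 1\<close> indices and
  hence does not depend on \<open>N\<close>; for \<open>r = 1\<close> it is the index shift behind \<open>skip\<close>.\<close>

definition rep :: "nat \<Rightarrow> nat \<Rightarrow> nat \<Rightarrow> nat \<Rightarrow> nat" where
  "rep l j r = (SOME \<rho>. \<rho> permutes {1..l + j - 1} \<and>
     (\<forall>i\<in>{1..j}. \<rho> i = (if i \<le> r then i else l + i - r)))"

lemma rep:
  assumes "1 \<le> r" "r \<le> min l j"
  shows rep_permutes: "rep l j r permutes {1..l + j - 1}"
    and rep_eq: "i \<in> {1..j} \<Longrightarrow> rep l j r i = (if i \<le> r then i else l + i - r)"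
proof -
  \<comment> \<open>Indices beyond \<open>r\<close> go to \<open>l + 1, ..., l + j - r\<close>:
    outside \<open>{1..l}\<close>, and inside \<open>{1..l + j - 1}\<close> because
    \<open>r \<ge> 1\<close>.\<close>
  obtain \<rho> where "\<rho> permutes {1..l + j - 1}" "\<And>i. i \<in> {1..j} \<Longrightarrow> \<rho> i = (if i \<le> r then i else l + i - r)"
  proof (rule extend_inj_on_permutes[of "{1..l + j - 1}" "{1..j}" "\<lambda>i. if i \<le> r then i else l + i - r"])
    show "inj_on (\<lambda>i. if i \<le> r then i else l + i - r) {1..j}"
      using assms by (auto simp: inj_on_def)
  qed (use assms in auto)
  then have "\<exists>\<rho>. \<rho> permutes {1..l + j - 1} \<and> (\<forall>i\<in>{1..j}. \<rho> i = (if i \<le> r then i else l + i - r))"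
    by blast
  from someI_ex[OF this, folded rep_def]
  show "rep l j r permutes {1..l + j - 1}"
    "i \<in> {1..j} \<Longrightarrow> rep l j r i = (if i \<le> r then i else l + i - r)" by blast+
qed

lemma overlap_rep:
  assumes "1 \<le> r" "r \<le> min l j"
  shows "rep l j r ` {1..j} \<inter> {1..l} = {1..r}" "overlap l j (rep l j r) = r"
proof -
  have "rep l j r ` {1..j} = (\<lambda>i. if i \<le> r then i else l + i - r) ` {1..j}"
    using rep_eq[OF assms] by (intro image_cong) auto
  then show *: "rep l j r ` {1..j} \<inter> {1..l} = {1..r}"
    using assms by (auto simp: image_iff split: if_splits)
  show "overlap l j (rep l j r) = r" unfolding overlap_def * by simp
qed

section \<open>The N-particle bracket and its coefficients\<close>

text \<open>The contribution of exactly \<open>r\<close> shared particles. Only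
  \<open>l + j - r\<close> particles are involved, but it is placed in degree
  \<open>l + j - 1\<close> for every \<open>r\<close>, because the hierarchy bracket assigns the
  whole bracket of a pair to that component.\<close>

definition overlap_bracket :: "nat \<Rightarrow> nat \<Rightarrow> nat \<Rightarrow> 'd::finite kfun \<Rightarrow> 'd kfun \<Rightarrow> 'd kfun" where
  "overlap_bracket l j r f g = Sym (l + j - 1) (pb (l + j - 1) f (act (rep l j r) g))"

lemma depends_on_first_rep:
  assumes "depends_on_first j g" "1 \<le> r" "r \<le> min l j"
  shows "depends_on_first (l + j - 1) (act (rep l j r) g)"
proof (rule depends_on_first_act[OF assms(1)])
  have "rep l j r ` {1..j} \<subseteq> rep l j r ` {1..l + j - 1}"
    using assms(2,3) by (intro image_mono) auto
  then show "rep l j r ` {1..j} \<subseteq> {1..l + j - 1}"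
    unfolding permutes_image[OF rep_permutes[OF assms(2,3)]] .
qed

lemma smooth_rep:
  assumes "smooth_all g" "1 \<le> r" "r \<le> min l j"
  shows "smooth_all (act (rep l j r) g)"
  by (rule smooth_all_act[OF permutes_bij[OF rep_permutes[OF assms(2,3)]] assms(1)])

lemma overlap_bracket_in_g_space:
  assumes "f \<in> g_space l" "g \<in> g_space j" "1 \<le> r" "r \<le> min l j"
  shows "overlap_bracket l j r f g \<in> g_space (l + j - 1)"
  unfolding overlap_bracket_def
proof (rule Sym_in_g_space)
  show "smooth_all (pb (l + j - 1) f (act (rep l j r) g))"
    by (rule smooth_pb[OF g_space_smooth[OF assms(1)] smooth_rep[OF g_space_smooth[OF assms(2)] assms(3,4)]])
  have "depends_on_first (l + j - 1) f"
    using g_space_depends[OF assms(1)] by (rule depends_on_first_mono) (use assms(3,4) in auto)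
  then show "depends_on_first (l + j - 1) (pb (l + j - 1) f (act (rep l j r) g))"
    by (rule depends_on_first_pb[OF _ depends_on_first_rep[OF g_space_depends[OF assms(2)] assms(3,4)]])
qed

lemma overlap_bracket_add_right:
  assumes "g \<in> g_space j" "h \<in> g_space j" "1 \<le> r" "r \<le> min l j"
  shows "overlap_bracket l j r f (g + h) = overlap_bracket l j r f g + overlap_bracket l j r f h"
  unfolding overlap_bracket_def act_add
  unfolding pb_add_right[OF smooth_rep[OF g_space_smooth[OF assms(1)] assms(3,4)] smooth_rep[OF g_space_smooth[OF assms(2)] assms(3,4)]]
  by (rule Sym_add)

lemma overlap_bracket_scaleR_right:
  assumes "g \<in> g_space j" "1 \<le> r" "r \<le> min l j"
  shows "overlap_bracket l j r f (a *\<^sub>R g) = a *\<^sub>R overlap_bracket l j r f g"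
  unfolding overlap_bracket_def act_scaleR
  unfolding pb_scaleR_right[OF smooth_rep[OF g_space_smooth[OF assms(1)] assms(2,3)]]
  by (rule Sym_scaleR)

lemma overlap_bracket_add_left:
  assumes "f \<in> g_space l" "h \<in> g_space l"
  shows "overlap_bracket l j r (f + h) g = overlap_bracket l j r f g + overlap_bracket l j r h g"
  unfolding overlap_bracket_def pb_add_left[OF assms[THEN g_space_smooth]] by (rule Sym_add)

lemma overlap_bracket_scaleR_left:
  assumes "f \<in> g_space l"
  shows "overlap_bracket l j r (a *\<^sub>R f) g = a *\<^sub>R overlap_bracket l j r f g"
  unfolding overlap_bracket_def pb_scaleR_left[OF assms[THEN g_space_smooth]] by (rule Sym_scaleR)

text \<open>\<open>N\<close> times the probability that a uniformly random permutation of \<open>{1..N}\<close> has overlap \<open>r\<close>.\<close>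

definition coef :: "nat \<Rightarrow> nat \<Rightarrow> nat \<Rightarrow> nat \<Rightarrow> real" where
  "coef n l j r = real n / fact n * real (card {\<rho> \<in> perms n. overlap l j \<rho> = r})"

text \<open>For \<open>l + j - 1 \<le> n\<close>, the preimage under the embedding of the
  \<open>n\<close>-particle bracket of the embedded \<open>f\<close> and \<open>g\<close>, see
  \<open>g_bracket_Sym\<close>. Here \<open>n\<close> enters through the scalars \<open>coef\<close>
  alone.\<close>

definition star :: "nat \<Rightarrow> nat \<Rightarrow> nat \<Rightarrow> 'd::finite kfun \<Rightarrow> 'd kfun \<Rightarrow> 'd kfun" where
  "star n l j f g = (\<Sum>r=1..min l j. coef n l j r *\<^sub>R overlap_bracket l j r f g)"

lemma star_in_g_space:
  assumes "f \<in> g_space l" "g \<in> g_space j"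
  shows "star n l j f g \<in> g_space (l + j - 1)"
  unfolding star_def
  by (intro subspace_sum subspace_scale subspace_g_space overlap_bracket_in_g_space assms) auto

text \<open>Three reductions remove \<open>n\<close> from all but the outer average:
  \<open>\<rho>\<close> is replaced by the representative of its overlap, the bracket needs only
  \<open>l + j - 1\<close> particles, and \<open>Sym_Sym\<close> inserts an inner
  symmetrization.\<close>

lemma Sym_pb_overlap:
  assumes f: "f \<in> g_space l" and g: "g \<in> g_space j" and n: "l + j - 1 \<le> n" "1 \<le> l" "1 \<le> j"
    and \<rho>: "\<rho> permutes {1..n}"
  shows "Sym n (pb n f (act \<rho> g)) =
    (if overlap l j \<rho> = 0 then 0 else Sym n (overlap_bracket l j (overlap l j \<rho>) f g))"
proof (cases "overlap l j \<rho> = 0")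
  case True
  have "pb n f (act \<rho> g) = 0"
    by (rule pb_overlap_0[OF g_space_depends[OF f] g_space_depends[OF g] \<rho> _ True]) (use n in auto)
  then show ?thesis using True by (simp only: Sym_zero if_True simp_thms(6))
next
  case False
  define r where "r = overlap l j \<rho>"
  have r: "1 \<le> r" "r \<le> min l j" using False overlap_le[of l j \<rho>] by (auto simp: r_def)
  have rp: "rep l j r permutes {1..n}" by (rule perms_mono[OF rep_permutes[OF r] n(1)])
  have "Sym n (pb n f (act \<rho> g)) = Sym n (pb n f (act (rep l j r) g))"
    by (rule Sym_pb_overlap_eq[OF f g \<rho> rp]) (use n overlap_rep(2)[OF r] in \<open>auto simp: r_def\<close>)
  also have "pb n f (act (rep l j r) g) = pb (l + j - 1) f (act (rep l j r) g)"
    by (rule pb_change_n[OF depends_on_first_mono[OF g_space_depends[OF f]] n(1)]) (use n in auto)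
  also have "Sym n \<dots> = Sym n (overlap_bracket l j r f g)"
    unfolding overlap_bracket_def by (rule Sym_Sym[OF n(1), symmetric])
  finally show ?thesis using False by (simp only: r_def if_False)
qed

text \<open>When the permutations in \<open>pb_Sym\<close> are sorted by overlap, the class sizes
  combine with the prefactor \<open>n\<close> and the normalization \<open>1 / fact n\<close> to
  \<open>coef\<close>.\<close>

lemma g_bracket_Sym:
  assumes f: "f \<in> g_space l" and g: "g \<in> g_space j" and n: "l + j - 1 \<le> n" "1 \<le> l" "1 \<le> j"
  shows "g_bracket n (Sym n f) (Sym n g) = Sym n (star n l j f g)"
proof -
  let ?H = "\<lambda>r. if r = 0 then 0 else Sym n (overlap_bracket l j r f g)"
  let ?S = "\<lambda>r. {\<rho> \<in> perms n. overlap l j \<rho> = r}"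
  have "(\<Sum>\<rho>\<in>perms n. Sym n (pb n f (act \<rho> g))) = (\<Sum>\<rho>\<in>perms n. ?H (overlap l j \<rho>))"
    by (rule sum.cong[OF refl], rule Sym_pb_overlap[OF f g n]) simp
  also have "\<dots> = (\<Sum>r=0..min l j. \<Sum>\<rho>\<in>?S r. ?H (overlap l j \<rho>))"
    by (rule sum.group[symmetric]) (use overlap_le in auto)
  also have "\<dots> = (\<Sum>r=0..min l j. real (card (?S r)) *\<^sub>R ?H r)"
  proof (rule sum.cong[OF refl])
    fix r
    have "(\<Sum>\<rho>\<in>?S r. ?H (overlap l j \<rho>)) = (\<Sum>\<rho>\<in>?S r. ?H r)"
      by (rule sum.cong) auto
    then show "(\<Sum>\<rho>\<in>?S r. ?H (overlap l j \<rho>)) = real (card (?S r)) *\<^sub>R ?H r"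
      unfolding sum_constant_scaleR .
  qed
  also have "\<dots> = (\<Sum>r=1..min l j. real (card (?S r)) *\<^sub>R Sym n (overlap_bracket l j r f g))"
  proof (rule sum.mono_neutral_cong_right)
    show "\<forall>i\<in>{0..min l j} - {1..min l j}. real (card (?S i)) *\<^sub>R ?H i = 0"
    proof
      fix i assume "i \<in> {0..min l j} - {1..min l j}"
      then have "i = 0" by auto
      then show "real (card (?S i)) *\<^sub>R ?H i = 0" by (simp only: if_True scaleR_zero_right simp_thms(6))
    qed
  qed auto
  finally have *: "(\<Sum>\<rho>\<in>perms n. Sym n (pb n f (act \<rho> g))) =
      (\<Sum>r=1..min l j. real (card (?S r)) *\<^sub>R Sym n (overlap_bracket l j r f g))" .
  show ?thesis
    unfolding g_bracket_eq_pb pb_Sym[OF g_space_smooth[OF f] g_space_smooth[OF g]] * star_def Sym_sum Sym_scaleR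
      coef_def scaleR_sum_right scaleR_scaleR
    by (simp only: mult.assoc mult.left_commute times_divide_eq_right mult_1_right divide_inverse_commute)
qed

definition pairs :: "nat \<Rightarrow> (nat \<times> nat) set" where
  "pairs k = {(l, j). 1 \<le> l \<and> 1 \<le> j \<and> l + j - 1 = k}"

lemma finite_pairs [simp]: "finite (pairs k)"
  by (rule finite_subset[of _ "{1..k} \<times> {1..k}"]) (auto simp: pairs_def)

text \<open>Below the top component the truncation by \<open>min\<close> is inactive. At
  \<open>k = n\<close> all pairs with \<open>l + j - 1 \<ge> n\<close> would be collected, hence the
  strict inequality.\<close>

lemma pairs_eq:
  assumes "k < n"
  shows "{(l, j). l \<in> {1..n} \<and> j \<in> {1..n} \<and> min (l + j - 1) n = k} = pairs k"
  using assms by (auto simp: pairs_def)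

text \<open>The sum of brackets is exhibited as \<open>eps k n\<close> of a member of
  \<open>g_space k\<close>; injectivity then makes \<open>inv_into\<close> return just that
  member.\<close>

lemma bracket_N_eq:
  assumes k: "k < n" and F: "\<And>l. 1 \<le> l \<Longrightarrow> F l \<in> g_space l" and G: "\<And>j. 1 \<le> j \<Longrightarrow> G j \<in> g_space j"
  shows "bracket_N n F G k = (\<Sum>(l, j)\<in>pairs k. star n l j (F l) (G j))"
proof -
  let ?s = "\<Sum>(l, j)\<in>pairs k. star n l j (F l) (G j)"
  have mem: "star n l j (F l) (G j) \<in> g_space k" if "(l, j) \<in> pairs k" for l j
    using that star_in_g_space[OF F G, of l j n] by (auto simp: pairs_def)
  have s: "?s \<in> g_space k"
    by (intro subspace_sum subspace_g_space) (use mem in auto)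
  have "(\<Sum>(l, j)\<in>pairs k. g_bracket n (eps l n (F l)) (eps j n (G j))) =
      (\<Sum>(l, j)\<in>pairs k. Sym n (star n l j (F l) (G j)))"
  proof (rule sum.cong[OF refl], clarsimp simp only: split_paired_all prod.case)
    fix l j assume lj: "(l, j) \<in> pairs k"
    then have *: "1 \<le> l" "1 \<le> j" "l \<le> n" "j \<le> n" "l + j - 1 \<le> n" using k by (auto simp: pairs_def)
    show "g_bracket n (eps l n (F l)) (eps j n (G j)) = Sym n (star n l j (F l) (G j))"
      unfolding eps_eq_Sym[OF g_space_depends[OF F[OF *(1)]] *(3)] eps_eq_Sym[OF g_space_depends[OF G[OF *(2)]] *(4)]
      by (rule g_bracket_Sym[OF F[OF *(1)] G[OF *(2)] *(5,1,2)])
  qed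
  also have "\<dots> = Sym n ?s" by (simp only: Sym_sum case_prod_unfold)
  also have "\<dots> = eps k n ?s"
    by (rule eps_eq_Sym[OF g_space_depends[OF s] less_imp_le[OF k], symmetric])
  finally have "bracket_N n F G k = inv_into (g_space k) (eps k n) (eps k n ?s)"
    unfolding bracket_N_def pairs_eq[OF k] by (rule arg_cong)
  then show ?thesis
    unfolding inv_into_f_f[OF inj_on_eps[OF less_imp_le[OF k]] s] .
qed

section \<open>Moments of the overlap of a random permutation\<close>

lemma sum_perms_left_cancel:
  assumes "\<tau> permutes {1..n}" "\<And>\<rho>. F (\<tau> \<circ> \<rho>) = G \<rho>"
  shows "sum G (perms n) = sum F (perms n)"
  using sum_perms_left[OF assms(1), of F] assms(2) by simp

text \<open>Transposing two values shows that \<open>\<rho> a\<close> is equally likely to be any of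
  the \<open>n\<close> points.\<close>

lemma sum_perms_of_bool1:
  assumes "a \<in> {1..n}" "b \<in> {1..n}"
  shows "real n * (\<Sum>\<rho>\<in>perms n. of_bool (\<rho> a = b)) = fact n"
proof -
  have eq: "(\<Sum>\<rho>\<in>perms n. of_bool (\<rho> a = b')) = (\<Sum>\<rho>\<in>perms n. of_bool (\<rho> a = b) :: real)" if "b' \<in> {1..n}" for b'
    by (rule sum_perms_left_cancel[OF permutes_swap_id[OF assms(2) that]]) (auto simp: Transposition.transpose_def)
  have "(\<Sum>b'=1..n. of_bool (\<rho> a = b')) = (1::real)" if "\<rho> \<in> perms n" for \<rho>
  proof -
    have "\<rho> a \<in> {1..n}" using that assms(1) permutes_in_image[of \<rho> "{1..n}" a] by simp
    then show ?thesis by (simp add: of_bool_def)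
  qed
  then have "(\<Sum>b'=1..n. \<Sum>\<rho>\<in>perms n. of_bool (\<rho> a = b')) = (\<Sum>\<rho>\<in>perms n. 1::real)"
    by (subst sum.swap) (intro sum.cong refl; simp)
  then show ?thesis using eq by (simp add: card_perms)
qed

text \<open>With \<open>\<rho> a = b\<close> held fixed, transposing the other values leaves
  \<open>n - 1\<close> equally likely values for \<open>\<rho> a'\<close>.\<close>

lemma sum_perms_of_bool2:
  assumes "a \<in> {1..n}" "b \<in> {1..n}" "a' \<in> {1..n}" "b' \<in> {1..n}" "a \<noteq> a'" "b \<noteq> b'"
  shows "real n * (real n - 1) * (\<Sum>\<rho>\<in>perms n. of_bool (\<rho> a = b) * of_bool (\<rho> a' = b')) = fact n"
proof -
  have eq: "(\<Sum>\<rho>\<in>perms n. of_bool (\<rho> a = b) * of_bool (\<rho> a' = c)) =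
      (\<Sum>\<rho>\<in>perms n. of_bool (\<rho> a = b) * of_bool (\<rho> a' = b') :: real)" if "c \<in> {1..n} - {b}" for c
  proof (rule sum_perms_left_cancel)
    show "Transposition.transpose b' c permutes {1..n}" using that assms by (intro permutes_swap_id) auto
  qed (use that assms in \<open>auto simp: Transposition.transpose_def of_bool_def\<close>)
  have "(\<Sum>c\<in>{1..n} - {b}. of_bool (\<rho> a = b) * of_bool (\<rho> a' = c)) = (of_bool (\<rho> a = b) :: real)"
    if "\<rho> \<in> perms n" for \<rho>
  proof (cases "\<rho> a = b")
    case True
    have \<rho>: "\<rho> permutes {1..n}" using that by simp
    have "\<rho> a' \<in> {1..n}" using assms(3) permutes_in_image[OF \<rho>] by blast
    moreover have "\<rho> a' \<noteq> b" using True assms(5) permutes_inj[OF \<rho>] by (auto simp: inj_eq)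
    ultimately show ?thesis using True by (simp add: of_bool_def)
  qed simp
  then have "(\<Sum>c\<in>{1..n} - {b}. \<Sum>\<rho>\<in>perms n. of_bool (\<rho> a = b) * of_bool (\<rho> a' = c)) =
      (\<Sum>\<rho>\<in>perms n. of_bool (\<rho> a = b) :: real)"
    by (subst sum.swap) (intro sum.cong refl; simp)
  then have "(real n - 1) * (\<Sum>\<rho>\<in>perms n. of_bool (\<rho> a = b) * of_bool (\<rho> a' = b')) =
      (\<Sum>\<rho>\<in>perms n. of_bool (\<rho> a = b) :: real)"
    using eq assms(2) by (simp add: of_nat_diff)
  then show ?thesis using sum_perms_of_bool1[OF assms(1,2)] by (simp add: mult.assoc)
qed

lemma overlap_eq_sum:
  assumes "\<rho> permutes {1..n}"
  shows "real (overlap l j \<rho>) = (\<Sum>a=1..j. \<Sum>b=1..l. of_bool (\<rho> a = b))"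
proof -
  have "\<rho> ` {1..j} \<inter> {1..l} = \<rho> ` {a \<in> {1..j}. \<rho> a \<in> {1..l}}" by auto
  then have "overlap l j \<rho> = card {a \<in> {1..j}. \<rho> a \<in> {1..l}}"
    unfolding overlap_def using card_image[OF permutes_inj_on[OF assms]] by simp
  also have "real \<dots> = (\<Sum>a\<in>{a \<in> {1..j}. \<rho> a \<in> {1..l}}. 1)" by simp
  also have "\<dots> = (\<Sum>a=1..j. if \<rho> a \<in> {1..l} then 1 else 0)"
    by (rule sum.inter_filter) simp
  also have "\<dots> = (\<Sum>a=1..j. \<Sum>b=1..l. of_bool (\<rho> a = b))"
    by (intro sum.cong refl) (simp add: of_bool_def)
  finally show ?thesis .
qed

text \<open>The product counts ordered pairs of distinct matches. Since \<open>\<rho>\<close> is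
  injective, matches at different arguments also have different values, which restricts both inner
  sums.\<close>

lemma overlap_falling_eq_sum:
  assumes \<rho>: "\<rho> permutes {1..n}"
  shows "real (overlap l j \<rho>) * (real (overlap l j \<rho>) - 1) =
    (\<Sum>a=1..j. \<Sum>b=1..l. \<Sum>a'\<in>{1..j} - {a}. \<Sum>b'\<in>{1..l} - {b}. of_bool (\<rho> a = b) * of_bool (\<rho> a' = b'))"
proof -
  have *: "of_bool (\<rho> a = b) * (real (overlap l j \<rho>) - 1) =
      (\<Sum>a'\<in>{1..j} - {a}. \<Sum>b'\<in>{1..l} - {b}. of_bool (\<rho> a = b) * of_bool (\<rho> a' = b'))"
    if "a \<in> {1..j}" "b \<in> {1..l}" for a b
  proof (cases "\<rho> a = b")
    case True
    have "(\<Sum>b'=1..l. of_bool (\<rho> a' = b')) = (\<Sum>b'\<in>{1..l} - {b}. of_bool (\<rho> a' = b') :: real)"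
      if "a' \<in> {1..j} - {a}" for a'
    proof -
      have "\<rho> a' \<noteq> b" using that True permutes_inj[OF \<rho>] by (auto simp: inj_eq)
      then show ?thesis by (intro sum.mono_neutral_right) auto
    qed
    then have "(\<Sum>a'\<in>{1..j} - {a}. \<Sum>b'=1..l. of_bool (\<rho> a' = b')) =
        (\<Sum>a'\<in>{1..j} - {a}. \<Sum>b'\<in>{1..l} - {b}. of_bool (\<rho> a' = b') :: real)"
      by (rule sum.cong[OF refl])
    moreover have "(\<Sum>b'=1..l. of_bool (\<rho> a = b')) = (1::real)"
      using True that(2) by (simp add: of_bool_def)
    ultimately have "real (overlap l j \<rho>) = 1 + (\<Sum>a'\<in>{1..j} - {a}. \<Sum>b'\<in>{1..l} - {b}. of_bool (\<rho> a' = b'))"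
      unfolding overlap_eq_sum[OF \<rho>] sum.remove[OF finite_atLeastAtMost that(1)] by (simp only:)
    then show ?thesis
      by (simp only: True simp_thms(6) of_bool_eq mult_1_left add_diff_cancel_left')
  qed simp
  have "real (overlap l j \<rho>) * (real (overlap l j \<rho>) - 1) =
      (\<Sum>a=1..j. \<Sum>b=1..l. of_bool (\<rho> a = b) * (real (overlap l j \<rho>) - 1))"
    unfolding sum_distrib_right[symmetric] overlap_eq_sum[OF \<rho>, symmetric] ..
  also have "\<dots> = (\<Sum>a=1..j. \<Sum>b=1..l. \<Sum>a'\<in>{1..j} - {a}. \<Sum>b'\<in>{1..l} - {b}.
      of_bool (\<rho> a = b) * of_bool (\<rho> a' = b'))"
    by (intro sum.cong refl *)
  finally show ?thesis .
qed

text \<open>Linearity of expectation over the \<open>l j\<close> pairs \<open>(a, b)\<close>, each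
  matched with probability \<open>1 / n\<close>. Exactness for every admissible \<open>n\<close> is
  what later determines the coefficient of overlap 1.\<close>

lemma sum_perms_overlap:
  assumes "1 \<le> n" "l \<le> n" "j \<le> n"
  shows "real n / fact n * (\<Sum>\<rho>\<in>perms n. real (overlap l j \<rho>)) = real l * real j"
proof -
  have "real n * (\<Sum>\<rho>\<in>perms n. real (overlap l j \<rho>)) =
      real n * (\<Sum>\<rho>\<in>perms n. \<Sum>a=1..j. \<Sum>b=1..l. of_bool (\<rho> a = b))"
    by (rule arg_cong[of _ _ "(*) _"], rule sum.cong[OF refl overlap_eq_sum]) simp
  also have "(\<Sum>\<rho>\<in>perms n. \<Sum>a=1..j. \<Sum>b=1..l. of_bool (\<rho> a = b)) =
      (\<Sum>a=1..j. \<Sum>b=1..l. \<Sum>\<rho>\<in>perms n. of_bool (\<rho> a = b) :: real)"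
    by (simp only: sum.swap[where A = "perms n"])
  also have "real n * \<dots> = (\<Sum>a=1..j. \<Sum>b=1..l. real n * (\<Sum>\<rho>\<in>perms n. of_bool (\<rho> a = b)))"
    by (simp only: sum_distrib_left)
  also have "\<dots> = (\<Sum>a=1..j. \<Sum>b=1..l. fact n)"
    by (intro sum.cong refl sum_perms_of_bool1) (use assms in auto)
  finally show ?thesis by (simp add: field_simps)
qed

text \<open>At most l^2 j^2 quadruples occur, each with probability \<open>1 / (n (n - 1))\<close>.
  Only the order in \<open>n\<close> matters later, so the bound drops the restriction to distinct
  indices.\<close>

lemma sum_perms_overlap_falling:
  assumes "2 \<le> n" "l \<le> n" "j \<le> n"
  shows "real n * (real n - 1) * (\<Sum>\<rho>\<in>perms n. real (overlap l j \<rho>) * (real (overlap l j \<rho>) - 1)) \<le>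
    (real l)\<^sup>2 * (real j)\<^sup>2 * fact n"
proof -
  have "real n * (real n - 1) * (\<Sum>\<rho>\<in>perms n. real (overlap l j \<rho>) * (real (overlap l j \<rho>) - 1)) =
      real n * (real n - 1) * (\<Sum>\<rho>\<in>perms n. \<Sum>a=1..j. \<Sum>b=1..l. \<Sum>a'\<in>{1..j} - {a}. \<Sum>b'\<in>{1..l} - {b}.
        of_bool (\<rho> a = b) * of_bool (\<rho> a' = b'))"
    by (rule arg_cong[of _ _ "(*) _"], rule sum.cong[OF refl overlap_falling_eq_sum]) simp
  also have "\<dots> = (\<Sum>a=1..j. \<Sum>b=1..l. \<Sum>a'\<in>{1..j} - {a}. \<Sum>b'\<in>{1..l} - {b}.
      real n * (real n - 1) * (\<Sum>\<rho>\<in>perms n. of_bool (\<rho> a = b) * of_bool (\<rho> a' = b')))"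
    by (simp only: sum.swap[where A = "perms n"] sum_distrib_left)
  also have "\<dots> = (\<Sum>a=1..j. \<Sum>b=1..l. \<Sum>a'\<in>{1..j} - {a}. \<Sum>b'\<in>{1..l} - {b}. fact n)"
    by (intro sum.cong refl sum_perms_of_bool2) (use assms in auto)
  also have "\<dots> \<le> (\<Sum>a=1..j. \<Sum>b=1..l. \<Sum>a'=1..j. \<Sum>b'=1..l. fact n)"
    by (intro sum_mono sum_mono2 order_trans[OF sum_mono sum_mono2]) (auto intro: sum_nonneg)
  also have "\<dots> = (real l)\<^sup>2 * (real j)\<^sup>2 * fact n" by (simp add: power2_eq_square)
  finally show ?thesis .
qed

section \<open>Asymptotics of the coefficients\<close>

lemma coef_nonneg: "coef n l j r \<ge> 0"
  unfolding coef_def by simp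

lemma coef_eq_sum: "coef n l j r = real n / fact n * (\<Sum>\<rho>\<in>perms n. of_bool (overlap l j \<rho> = r))"
proof -
  have "(\<Sum>\<rho>\<in>perms n. of_bool (overlap l j \<rho> = r)) = real (card (perms n \<inter> {\<rho>. overlap l j \<rho> = r}))"
    by simp
  also have "perms n \<inter> {\<rho>. overlap l j \<rho> = r} = {\<rho> \<in> perms n. overlap l j \<rho> = r}" by blast
  finally show ?thesis unfolding coef_def by simp
qed

lemma sum_coef:
  assumes "1 \<le> n" "l \<le> n" "j \<le> n"
  shows "(\<Sum>r=1..min l j. real r * coef n l j r) = real l * real j"
proof -
  have *: "(\<Sum>r=1..min l j. real r * of_bool (overlap l j \<rho> = r)) = real (overlap l j \<rho>)" for \<rho>
  proof (cases "overlap l j \<rho> = 0")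
    case False
    then have "overlap l j \<rho> \<in> {1..min l j}" using overlap_le[of l j \<rho>] by auto
    then show ?thesis by (simp add: of_bool_def if_distrib[of "\<lambda>x. _ * x"] cong: if_cong)
  qed auto
  have "(\<Sum>r=1..min l j. real r * coef n l j r) =
      (\<Sum>r=1..min l j. \<Sum>\<rho>\<in>perms n. real n / fact n * (real r * of_bool (overlap l j \<rho> = r)))"
    unfolding coef_eq_sum sum_distrib_left by (intro sum.cong refl) (simp only: mult_ac)
  also have "\<dots> = real n / fact n * (\<Sum>\<rho>\<in>perms n. real (overlap l j \<rho>))"
    unfolding *[symmetric] sum_distrib_left by (rule sum.swap)
  also have "\<dots> = real l * real j" by (rule sum_perms_overlap[OF assms])
  finally show ?thesis .
qed

text \<open>For \<open>r \<ge> 2\<close> the indicator of overlap \<open>r\<close> is at most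
  \<open>overlap * (overlap - 1)\<close>, so the second factorial moment applies.\<close>

lemma coef_le:
  assumes "2 \<le> n" "l \<le> n" "j \<le> n" "2 \<le> r"
  shows "coef n l j r \<le> (real l)\<^sup>2 * (real j)\<^sup>2 / (real n - 1)"
proof -
  let ?o = "\<lambda>\<rho>. real (overlap l j \<rho>)"
  have "(\<Sum>\<rho>\<in>perms n. of_bool (overlap l j \<rho> = r)) \<le> (\<Sum>\<rho>\<in>perms n. ?o \<rho> * (?o \<rho> - 1))"
  proof (rule sum_mono)
    fix \<rho>
    show "of_bool (overlap l j \<rho> = r) \<le> ?o \<rho> * (?o \<rho> - 1)"
    proof (cases "overlap l j \<rho> = r")
      case True
      have "1 * 1 \<le> real r * (real r - 1)" using assms(4) by (intro mult_mono) auto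
      then show ?thesis using True by simp
    next
      case False
      then show ?thesis by (cases "overlap l j \<rho>") auto
    qed
  qed
  then have "real n * (real n - 1) * (\<Sum>\<rho>\<in>perms n. of_bool (overlap l j \<rho> = r)) \<le>
      real n * (real n - 1) * (\<Sum>\<rho>\<in>perms n. ?o \<rho> * (?o \<rho> - 1))"
    using assms(1) by (intro mult_left_mono) auto
  also have "\<dots> \<le> (real l)\<^sup>2 * (real j)\<^sup>2 * fact n" by (rule sum_perms_overlap_falling[OF assms(1-3)])
  finally show ?thesis unfolding coef_eq_sum using assms(1) by (simp add: field_simps)
qed

lemma coef_tendsto_0:
  assumes "2 \<le> r"
  shows "(\<lambda>n. coef n l j r) \<longlonglongrightarrow> 0"
proof (rule tendsto_sandwich[OF _ _ tendsto_const])
  show "\<forall>\<^sub>F n in sequentially. 0 \<le> coef n l j r" by (simp add: coef_nonneg)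
  show "\<forall>\<^sub>F n in sequentially. coef n l j r \<le> (real l)\<^sup>2 * (real j)\<^sup>2 / (real n - 1)"
    using eventually_ge_at_top[of "max 2 (max l j)"] by eventually_elim (rule coef_le, use assms in auto)
  have "filterlim (\<lambda>n. - 1 + real n) at_top sequentially"
    by (rule filterlim_tendsto_add_at_top[OF tendsto_const filterlim_real_sequentially])
  then have "filterlim (\<lambda>n. real n - 1) at_infinity sequentially"
    by (intro filterlim_at_top_imp_at_infinity) simp
  then show "(\<lambda>n. (real l)\<^sup>2 * (real j)\<^sup>2 / (real n - 1)) \<longlonglongrightarrow> 0"
    by (rule tendsto_divide_0[OF tendsto_const])
qed

text \<open>For \<open>r = 1\<close> the limit comes by subtraction: the weighted sum of all
  coefficients is exactly \<open>l j\<close> by \<open>sum_coef\<close>, and those with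
  \<open>r \<ge> 2\<close> die out.\<close>

lemma coef_tendsto:
  assumes "1 \<le> r" "1 \<le> l" "1 \<le> j"
  shows "(\<lambda>n. coef n l j r) \<longlonglongrightarrow> (if r = 1 then real l * real j else 0)"
proof (cases "r = 1")
  case True
  have "(\<lambda>n. real l * real j - (\<Sum>r=2..min l j. real r * coef n l j r)) \<longlonglongrightarrow>
      real l * real j - (\<Sum>r=2..min l j. real r * 0)"
    by (intro tendsto_intros coef_tendsto_0) auto
  moreover have "\<forall>\<^sub>F n in sequentially. real l * real j - (\<Sum>r=2..min l j. real r * coef n l j r) = coef n l j 1"
    using eventually_ge_at_top[of "max l j"]
  proof eventually_elim
    case (elim n)
    have "{1..min l j} = insert 1 {2..min l j}" using assms by auto
    then have "(\<Sum>r=1..min l j. real r * coef n l j r) = coef n l j 1 + (\<Sum>r=2..min l j. real r * coef n l j r)"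
      by simp
    moreover have "(\<Sum>r=1..min l j. real r * coef n l j r) = real l * real j"
      by (rule sum_coef) (use elim assms in auto)
    ultimately show ?case by linarith
  qed
  ultimately have "(\<lambda>n. coef n l j 1) \<longlonglongrightarrow> real l * real j"
    by (auto elim: Lim_transform_eventually)
  then show ?thesis using True by simp
next
  case False
  then show ?thesis using coef_tendsto_0[of r l j] assms(1) by simp
qed

section \<open>The limiting bracket on components\<close>

text \<open>The limit of \<open>star n l j f g\<close>, see \<open>star_tendsto\<close>: one shared
  particle survives, with weight \<open>l j\<close>.\<close>

definition beta :: "nat \<Rightarrow> nat \<Rightarrow> 'd::finite kfun \<Rightarrow> 'd kfun \<Rightarrow> 'd kfun" where
  "beta l j f g = (real l * real j) *\<^sub>R overlap_bracket l j 1 f g"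

lemma act_apply_skip:
  assumes "depends_on_first j h" "1 \<le> l" "1 \<le> j"
  shows "act (rep l j 1) h z = h (skip l z)"
  unfolding act_def
proof (rule depends_on_firstD[OF assms(1)])
  fix i assume "i \<in> {1..j}"
  then show "(z \<circ> rep l j 1) i = skip l z i"
    using rep_eq[of 1 l j i] assms(2,3) by (auto simp: skip_def)
qed

lemma wedge1_eq:
  assumes f: "depends_on_first l f" and g: "depends_on_first j g" and "1 \<le> l" "1 \<le> j"
  shows "wedge1 l j f g = (real l * real j) *\<^sub>R
    (\<Sum>c\<in>UNIV. px 1 c f * act (rep l j 1) (pv 1 c g) - px 1 c g * act (rep j l 1) (pv 1 c f))"
proof
  fix z
  have "act (rep l j 1) (pv 1 c g) z = pv 1 c g (skip l z)"
    "act (rep j l 1) (pv 1 c f) z = pv 1 c f (skip j z)" for c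
    unfolding pv_def by (rule act_apply_skip depends_on_first_partial assms)+
  then show "wedge1 l j f g z = ((real l * real j) *\<^sub>R
    (\<Sum>c\<in>UNIV. px 1 c f * act (rep l j 1) (pv 1 c g) - px 1 c g * act (rep j l 1) (pv 1 c f))) z"
    by (simp add: wedge1_def scaleR_fun_def sum_fun_apply grad_x_def grad_v_def px_def pv_def inner_vec_def sum_subtractf)
qed

text \<open>The two arguments share particle 1 alone and the representative fixes it, so the sum
  over particles collapses to one term.\<close>

lemma pb_rep_1:
  assumes f: "depends_on_first l f" and g: "depends_on_first j g" and lj: "1 \<le> l" "1 \<le> j"
  shows "pb (l + j - 1) f (act (rep l j 1) g) =
    (\<Sum>c\<in>UNIV. px 1 c f * act (rep l j 1) (pv 1 c g) - act (rep l j 1) (px 1 c g) * pv 1 c f)"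
proof
  fix z
  have r: "1 \<le> (1::nat)" "1 \<le> min l j" using lj by auto
  have i: "inv (rep l j 1) 1 = 1"
    using rep_eq[OF r, of 1] lj permutes_inv_eq[OF rep_permutes[OF r]] by auto
  have "l \<le> l + j - 1" using lj by auto
  show "pb (l + j - 1) f (act (rep l j 1) g) z =
    (\<Sum>c\<in>UNIV. px 1 c f * act (rep l j 1) (pv 1 c g) - act (rep l j 1) (px 1 c g) * pv 1 c f) z"
    unfolding pb_act_right[OF f g rep_permutes[OF r] \<open>l \<le> l + j - 1\<close>] overlap_rep(1)[OF r] sum_fun_apply
    using i by (simp add: act_def mult.commute)
qed

lemma block_swap:
  assumes "1 \<le> l" "1 \<le> j"
  obtains \<pi> where "\<pi> permutes {1..l + j - 1}" "\<And>i. i \<in> {1..j} \<Longrightarrow> \<pi> i = rep l j 1 i"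
    "\<And>i. i \<in> {1..l} \<Longrightarrow> \<pi> (rep j l 1 i) = i"
proof -
  \<comment> \<open>The block \<open>{2..j}\<close> moves behind index \<open>l\<close> and the
    indices after \<open>j\<close> move down to \<open>{2..l}\<close>, which exchanges the places of
    the variables that the two functions do not share.\<close>
  define q where "q i = (if i \<le> 1 then i else if i \<le> j then l + i - 1 else i - j + 1)" for i
  have "inj_on q {1..l + j - 1}" using assms by (auto simp: inj_on_def q_def)
  moreover have "q ` {1..l + j - 1} \<subseteq> {1..l + j - 1}" using assms by (auto simp: q_def)
  ultimately obtain \<pi> where \<pi>: "\<pi> permutes {1..l + j - 1}" "\<And>i. i \<in> {1..l + j - 1} \<Longrightarrow> \<pi> i = q i"
    using extend_inj_on_permutes[OF finite_atLeastAtMost subset_refl] by metis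
  have 1: "1 \<le> min l j" "1 \<le> min j l" using assms by auto
  show ?thesis
  proof (rule that[OF \<pi>(1)])
    fix i assume "i \<in> {1..j}"
    then show "\<pi> i = rep l j 1 i"
      using \<pi>(2)[of i] rep_eq[OF _ 1(1), of i] assms by (auto simp: q_def)
  next
    fix i assume i: "i \<in> {1..l}"
    have r: "rep j l 1 i = (if i \<le> 1 then i else j + i - 1)"
      using rep_eq[OF _ 1(2) i] by simp
    have "\<pi> (rep j l 1 i) = q (if i \<le> 1 then i else j + i - 1)"
      unfolding r by (rule \<pi>(2)) (use i assms in auto)
    also have "\<dots> = i" using i assms by (auto simp: q_def)
    finally show "\<pi> (rep j l 1 i) = i" .
  qed
qed

text \<open>The two formulas differ only in the second product: \<open>wedge1\<close> gives the
  leading variables to \<open>g\<close>, the bracket gives them to \<open>f\<close>. The permutation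
  of \<open>block_swap\<close> turns one product into the other and is invisible to
  \<open>Sym\<close>.\<close>

lemma Sym_wedge1:
  assumes f: "f \<in> g_space l" and g: "g \<in> g_space j" and lj: "1 \<le> l" "1 \<le> j"
  shows "Sym (l + j - 1) (wedge1 l j f g) = beta l j f g"
proof -
  let ?k = "l + j - 1"
  note df = g_space_depends[OF f] and dg = g_space_depends[OF g]
  obtain \<pi> where \<pi>: "\<pi> permutes {1..?k}" "\<And>i. i \<in> {1..j} \<Longrightarrow> \<pi> i = rep l j 1 i"
    "\<And>i. i \<in> {1..l} \<Longrightarrow> \<pi> (rep j l 1 i) = i" using block_swap[OF lj] by metis
  have *: "Sym ?k (px 1 c g * act (rep j l 1) (pv 1 c f)) = Sym ?k (act (rep l j 1) (px 1 c g) * pv 1 c f)" for c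
  proof -
    have dg': "depends_on_first j (px 1 c g)" unfolding px_def by (rule depends_on_first_partial[OF dg])
    have df': "depends_on_first l (pv 1 c f)" unfolding pv_def by (rule depends_on_first_partial[OF df])
    have "act \<pi> (px 1 c g) = act (rep l j 1) (px 1 c g)"
      by (rule act_cong[OF dg' \<pi>(2)])
    moreover have "act (\<pi> \<circ> rep j l 1) (pv 1 c f) = act id (pv 1 c f)"
      by (rule act_cong[OF df']) (simp only: comp_def id_apply \<pi>(3))
    ultimately have "act \<pi> (px 1 c g * act (rep j l 1) (pv 1 c f)) = act (rep l j 1) (px 1 c g) * pv 1 c f"
      by (simp only: act_mult act_act act_id)
    then show ?thesis using Sym_act[OF \<pi>(1), of "px 1 c g * act (rep j l 1) (pv 1 c f)"] by (simp only:)
  qed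
  show ?thesis
    unfolding wedge1_eq[OF df dg lj] beta_def overlap_bracket_def pb_rep_1[OF df dg lj]
      Sym_scaleR Sym_sum Sym_diff * ..
qed

section \<open>Antisymmetry and bilinearity of the limiting components\<close>

lemma wedge1_antisym: "wedge1 l j f g = - wedge1 j l g f"
  unfolding fun_eq_iff by (simp add: wedge1_def algebra_simps)

lemma Sym_minus: "Sym k (- h) = - Sym k h"
  using Sym_scaleR[of k "-1" h] by (simp only: scaleR_minus_left scaleR_one)

text \<open>Antisymmetry is hidden in \<open>overlap_bracket\<close>, whose representative treats
  \<open>l\<close> and \<open>j\<close> differently, but plain in \<open>wedge1\<close>, to which
  \<open>Sym_wedge1\<close> leads.\<close>

lemma beta_antisym:
  assumes "f \<in> g_space l" "g \<in> g_space j" "1 \<le> l" "1 \<le> j"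
  shows "beta l j f g = - beta j l g f"
proof -
  have "beta l j f g = Sym (l + j - 1) (- wedge1 j l g f)"
    unfolding Sym_wedge1[OF assms, symmetric] by (subst wedge1_antisym) (rule refl)
  also have "\<dots> = - beta j l g f"
    using Sym_wedge1[OF assms(2,1,4,3)] by (simp only: Sym_minus add.commute[of l j])
  finally show ?thesis .
qed

lemma beta_in_g_space:
  assumes "f \<in> g_space l" "g \<in> g_space j" "1 \<le> l" "1 \<le> j"
  shows "beta l j f g \<in> g_space (l + j - 1)"
  unfolding beta_def
  by (intro subspace_scale subspace_g_space overlap_bracket_in_g_space assms(1,2)) (use assms(3,4) in auto)

lemma beta_add_left:
  assumes "f \<in> g_space l" "f' \<in> g_space l"
  shows "beta l j (f + f') g = beta l j f g + beta l j f' g"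
  unfolding beta_def overlap_bracket_add_left[OF assms] by (rule scaleR_add_right)

lemma beta_scaleR_left:
  assumes "f \<in> g_space l"
  shows "beta l j (a *\<^sub>R f) g = a *\<^sub>R beta l j f g"
  unfolding beta_def overlap_bracket_scaleR_left[OF assms] by (rule scaleR_left_commute)

lemma beta_add_right:
  assumes "g \<in> g_space j" "g' \<in> g_space j" "1 \<le> l" "1 \<le> j"
  shows "beta l j f (g + g') = beta l j f g + beta l j f g'"
proof -
  have "1 \<le> (1::nat)" "1 \<le> min l j" using assms(3,4) by auto
  from overlap_bracket_add_right[OF assms(1,2) this] show ?thesis
    unfolding beta_def by (simp only: scaleR_add_right)
qed

lemma beta_scaleR_right:
  assumes "g \<in> g_space j" "1 \<le> l" "1 \<le> j"
  shows "beta l j f (a *\<^sub>R g) = a *\<^sub>R beta l j f g"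
proof -
  have "1 \<le> (1::nat)" "1 \<le> min l j" using assms(2,3) by auto
  from overlap_bracket_scaleR_right[OF assms(1) this] show ?thesis
    unfolding beta_def by (simp only: scaleR_left_commute)
qed

section \<open>Passage to the limit in single and iterated brackets\<close>

lemma sum_coef_limit:
  fixes y :: "nat \<Rightarrow> 'a::real_vector"
  assumes "1 \<le> l" "1 \<le> j"
  shows "(\<Sum>r=1..min l j. (if r = 1 then real l * real j else 0) *\<^sub>R y r) = (real l * real j) *\<^sub>R y 1"
proof -
  have "(\<Sum>r=1..min l j. (if r = 1 then real l * real j else 0) *\<^sub>R y r) =
      (\<Sum>r\<in>{1}. (if r = 1 then real l * real j else 0) *\<^sub>R y r)"
    by (rule sum.mono_neutral_right) (use assms in auto)
  then show ?thesis by simp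
qed

lemma star_tendsto:
  assumes "1 \<le> l" "1 \<le> j"
  shows "(\<lambda>n. star n l j f g z) \<longlonglongrightarrow> beta l j f g z"
proof -
  let ?y = "\<lambda>r. overlap_bracket l j r f g z"
  have "(\<lambda>n. \<Sum>r=1..min l j. coef n l j r *\<^sub>R ?y r) \<longlonglongrightarrow>
      (\<Sum>r=1..min l j. (if r = 1 then real l * real j else 0) *\<^sub>R ?y r)"
    by (intro tendsto_sum tendsto_scaleR tendsto_const coef_tendsto) (use assms in auto)
  then show ?thesis
    unfolding sum_coef_limit[OF assms, of ?y] star_def beta_def sum_fun_apply scaleR_fun_def .
qed

lemma star_sum_right:
  assumes "\<And>s. s \<in> A \<Longrightarrow> u s \<in> g_space j" "finite A"
  shows "star n l j f (\<Sum>s\<in>A. a s *\<^sub>R u s) = (\<Sum>s\<in>A. a s *\<^sub>R star n l j f (u s))"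
proof -
  have "overlap_bracket l j r f (\<Sum>s\<in>A. a s *\<^sub>R u s) = (\<Sum>s\<in>A. a s *\<^sub>R overlap_bracket l j r f (u s))"
    if r: "r \<in> {1..min l j}" for r
    using assms(2,1)
  proof (induction A rule: finite_induct)
    case empty
    have "overlap_bracket l j r f (0 *\<^sub>R 0) = 0 *\<^sub>R overlap_bracket l j r f 0"
      by (rule overlap_bracket_scaleR_right) (use r subspace_0[OF subspace_g_space] in auto)
    then show ?case by (simp only: sum.empty scaleR_zero_left)
  next
    case (insert x F)
    have 1: "a x *\<^sub>R u x \<in> g_space j" "(\<Sum>s\<in>F. a s *\<^sub>R u s) \<in> g_space j" "u x \<in> g_space j"
      using insert.prems by (auto intro!: subspace_sum subspace_scale subspace_g_space)
    have 2: "1 \<le> r" "r \<le> min l j" using r by auto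
    have 3: "overlap_bracket l j r f (\<Sum>s\<in>F. a s *\<^sub>R u s) = (\<Sum>s\<in>F. a s *\<^sub>R overlap_bracket l j r f (u s))"
      by (rule insert.IH) (rule insert.prems, rule insertI2)
    show ?case
      unfolding sum.insert[OF insert.hyps(1,2)] overlap_bracket_add_right[OF 1(1,2) 2]
        overlap_bracket_scaleR_right[OF 1(3) 2] 3 ..
  qed
  then have "star n l j f (\<Sum>s\<in>A. a s *\<^sub>R u s) =
      (\<Sum>r=1..min l j. \<Sum>s\<in>A. coef n l j r *\<^sub>R a s *\<^sub>R overlap_bracket l j r f (u s))"
    unfolding star_def by (intro sum.cong refl) (simp only: scaleR_sum_right)
  also have "\<dots> = (\<Sum>s\<in>A. \<Sum>r=1..min l j. a s *\<^sub>R coef n l j r *\<^sub>R overlap_bracket l j r f (u s))"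
    by (subst sum.swap) (simp only: scaleR_left_commute)
  finally show ?thesis unfolding star_def scaleR_sum_right .
qed

text \<open>Inner and outer bracket both vary with \<open>n\<close>. Expanding the inner one over
  the functions \<open>overlap_bracket j m s g h\<close> leaves a finite sum of products of a
  convergent coefficient and a convergent \<open>star\<close> of fixed arguments.\<close>

lemma star_star_tendsto:
  assumes g: "g \<in> g_space j" and h: "h \<in> g_space m" and "1 \<le> l" "1 \<le> j" "1 \<le> m"
  shows "(\<lambda>n. star n l (j + m - 1) f (star n j m g h) z) \<longlonglongrightarrow> beta l (j + m - 1) f (beta j m g h) z"
proof -
  let ?q = "j + m - 1"
  let ?u = "\<lambda>s. overlap_bracket j m s g h"
  have q: "1 \<le> ?q" using assms by auto
  have u: "?u s \<in> g_space ?q" if "s \<in> {1..min j m}" for s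
    by (rule overlap_bracket_in_g_space[OF g h]) (use that in auto)
  have "(\<lambda>n. \<Sum>s=1..min j m. coef n j m s *\<^sub>R star n l ?q f (?u s) z) \<longlonglongrightarrow>
      (\<Sum>s=1..min j m. (if s = 1 then real j * real m else 0) *\<^sub>R beta l ?q f (?u s) z)"
    by (intro tendsto_sum tendsto_scaleR coef_tendsto star_tendsto assms q) auto
  also have "(\<Sum>s=1..min j m. (if s = 1 then real j * real m else 0) *\<^sub>R beta l ?q f (?u s) z) =
      (real j * real m) *\<^sub>R beta l ?q f (?u 1) z"
    by (rule sum_coef_limit[OF assms(4,5)])
  also have "\<dots> = ((real j * real m) *\<^sub>R beta l ?q f (?u 1)) z" by (simp only: scaleR_fun_def)
  also have "(real j * real m) *\<^sub>R beta l ?q f (?u 1) = beta l ?q f (beta j m g h)"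
    unfolding beta_def[of j m] by (rule beta_scaleR_right[OF u \<open>1 \<le> l\<close> q, symmetric]) (use assms in auto)
  finally have lim: "(\<lambda>n. \<Sum>s=1..min j m. coef n j m s *\<^sub>R star n l ?q f (?u s) z) \<longlonglongrightarrow>
      beta l ?q f (beta j m g h) z" .
  have "star n l ?q f (star n j m g h) z = (\<Sum>s=1..min j m. coef n j m s *\<^sub>R star n l ?q f (?u s) z)" for n
  proof -
    have "star n l ?q f (star n j m g h) = (\<Sum>s=1..min j m. coef n j m s *\<^sub>R star n l ?q f (?u s))"
      unfolding star_def[of n j m] by (rule star_sum_right[OF u finite_atLeastAtMost])
    then show ?thesis by (simp only: sum_fun_apply scaleR_fun_def)
  qed
  with lim show ?thesis by (simp only:)
qed

section \<open>The Jacobi identity\<close>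

lemma poisson_jacobi_sum:
  fixes Xf Vf Xg Vg Xh Vh :: "'i \<Rightarrow> real" and XXf XVf VVf XXg XVg VVg XXh XVh VVh :: "'i \<Rightarrow> 'i \<Rightarrow> real"
  assumes sym: "\<And>p q. XXf p q = XXf q p" "\<And>p q. VVf p q = VVf q p" "\<And>p q. XXg p q = XXg q p"
    "\<And>p q. VVg p q = VVg q p" "\<And>p q. XXh p q = XXh q p" "\<And>p q. VVh p q = VVh q p"
  shows "(\<Sum>p\<in>I. Xf p * (\<Sum>q\<in>I. XVg q p * Vh q + Xg q * VVh p q - (VVg p q * Xh q + Vg q * XVh q p))
        - Vf p * (\<Sum>q\<in>I. XXg p q * Vh q + Xg q * XVh p q - (XVg p q * Xh q + Vg q * XXh p q)))
    + (\<Sum>p\<in>I. Xg p * (\<Sum>q\<in>I. XVh q p * Vf q + Xh q * VVf p q - (VVh p q * Xf q + Vh q * XVf q p))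
        - Vg p * (\<Sum>q\<in>I. XXh p q * Vf q + Xh q * XVf p q - (XVh p q * Xf q + Vh q * XXf p q)))
    + (\<Sum>p\<in>I. Xh p * (\<Sum>q\<in>I. XVf q p * Vg q + Xf q * VVg p q - (VVf p q * Xg q + Vf q * XVg q p))
        - Vh p * (\<Sum>q\<in>I. XXf p q * Vg q + Xf q * XVg p q - (XVf p q * Xg q + Vf q * XXg p q))) = 0"
    (is "?L = 0")
proof -
  \<comment> \<open>The derivatives of the three functions at one point are treated as plain
    numbers. The summand for \<open>(p, q)\<close> cancels against the one for
    \<open>(q, p)\<close>, by symmetry of the second derivatives.\<close>
  define t where "t p q =
      Xf p * (XVg q p * Vh q + Xg q * VVh p q - (VVg p q * Xh q + Vg q * XVh q p))
        - Vf p * (XXg p q * Vh q + Xg q * XVh p q - (XVg p q * Xh q + Vg q * XXh p q))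
    + (Xg p * (XVh q p * Vf q + Xh q * VVf p q - (VVh p q * Xf q + Vh q * XVf q p))
        - Vg p * (XXh p q * Vf q + Xh q * XVf p q - (XVh p q * Xf q + Vh q * XXf p q)))
    + (Xh p * (XVf q p * Vg q + Xf q * VVg p q - (VVf p q * Xg q + Vf q * XVg q p))
        - Vh p * (XXf p q * Vg q + Xf q * XVg p q - (XVf p q * Xg q + Vf q * XXg p q)))" for p q
  have L: "?L = (\<Sum>p\<in>I. \<Sum>q\<in>I. t p q)"
    unfolding t_def by (simp only: sum.distrib[symmetric] sum_subtractf[symmetric] sum_distrib_left)
  have "t p q + t q p = 0" for p q
    unfolding t_def sym[of q p] by algebra
  then have "(\<Sum>p\<in>I. \<Sum>q\<in>I. t p q + t q p) = 0" by simp
  then have "(\<Sum>p\<in>I. \<Sum>q\<in>I. t p q) + (\<Sum>p\<in>I. \<Sum>q\<in>I. t q p) = 0" by (simp only: sum.distrib)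
  moreover have "(\<Sum>p\<in>I. \<Sum>q\<in>I. t q p) = (\<Sum>p\<in>I. \<Sum>q\<in>I. t p q)" by (rule sum.swap)
  ultimately show ?thesis unfolding L by linarith
qed

lemma pb_pairs:
  "pb n f g z = (\<Sum>p\<in>{1..n} \<times> UNIV. px (fst p) (snd p) f z * pv (fst p) (snd p) g z
    - pv (fst p) (snd p) f z * px (fst p) (snd p) g z)"
  unfolding pb_apply sum.cartesian_product by (simp only: case_prod_unfold)

lemma px_pb:
  assumes "smooth_all f" "smooth_all g"
  shows "px i c (pb n f g) z = (\<Sum>q\<in>{1..n} \<times> UNIV.
      px i c (px (fst q) (snd q) f) z * pv (fst q) (snd q) g z + px (fst q) (snd q) f z * px i c (pv (fst q) (snd q) g) z
    - (px i c (pv (fst q) (snd q) f) z * px (fst q) (snd q) g z + pv (fst q) (snd q) f z * px i c (px (fst q) (snd q) g) z))"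
  unfolding pb_def sum.cartesian_product case_prod_unfold
  by (simp only: px_sum px_diff px_mult smooth_all_mult smooth_all_diff smooth_px smooth_pv assms sum_fun_apply
      minus_apply plus_fun_apply times_fun_apply)

lemma pv_pb:
  assumes "smooth_all f" "smooth_all g"
  shows "pv i c (pb n f g) z = (\<Sum>q\<in>{1..n} \<times> UNIV.
      pv i c (px (fst q) (snd q) f) z * pv (fst q) (snd q) g z + px (fst q) (snd q) f z * pv i c (pv (fst q) (snd q) g) z
    - (pv i c (pv (fst q) (snd q) f) z * px (fst q) (snd q) g z + pv (fst q) (snd q) f z * pv i c (px (fst q) (snd q) g) z))"
  unfolding pb_def sum.cartesian_product case_prod_unfold
  by (simp only: pv_sum pv_diff pv_mult smooth_all_mult smooth_all_diff smooth_px smooth_pv assms sum_fun_apply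
      minus_apply plus_fun_apply times_fun_apply)

lemma px_px: "smooth_all f \<Longrightarrow> px i c (px j b f) = px j b (px i c f)"
  and pv_pv: "smooth_all f \<Longrightarrow> pv i c (pv j b f) = pv j b (pv i c f)"
  and pv_px: "smooth_all f \<Longrightarrow> pv i c (px j b f) = px j b (pv i c f)"
  unfolding px_def pv_def by (rule partial_commute x_dir v_dir | assumption)+

lemma pb_jacobi:
  fixes f g h :: "'a::finite kfun"
  assumes s: "smooth_all f" "smooth_all g" "smooth_all h"
  shows "pb n f (pb n g h) + pb n g (pb n h f) + pb n h (pb n f g) = 0"
proof
  fix z :: "nat \<Rightarrow> 'a phase"
  let ?X = "\<lambda>a p. px (fst p) (snd p) a z" and ?V = "\<lambda>a p. pv (fst p) (snd p) a z"
  let ?XX = "\<lambda>a p q. px (fst p) (snd p) (px (fst q) (snd q) a) z"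
  \<comment> \<open>Mixed second derivatives are always written with \<open>px\<close> outside;
    \<open>pv_px\<close> brings the others to this order.\<close>
  let ?XV = "\<lambda>a p q. px (fst p) (snd p) (pv (fst q) (snd q) a) z"
  let ?VV = "\<lambda>a p q. pv (fst p) (snd p) (pv (fst q) (snd q) a) z"
  show "(pb n f (pb n g h) + pb n g (pb n h f) + pb n h (pb n f g)) z = 0 z"
    unfolding plus_fun_apply zero_fun_apply pb_pairs[of n _ "pb n _ _"]
      px_pb[OF s(2,3)] px_pb[OF s(3,1)] px_pb[OF s(1,2)] pv_pb[OF s(2,3)] pv_pb[OF s(3,1)] pv_pb[OF s(1,2)]
      s[THEN pv_px]
    by (rule poisson_jacobi_sum[where I = "{1..n} \<times> UNIV" and Xf = "?X f" and Vf = "?V f" and Xg = "?X g"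
          and Vg = "?V g" and Xh = "?X h" and Vh = "?V h" and XXf = "?XX f" and XVf = "?XV f" and VVf = "?VV f"
          and XXg = "?XX g" and XVg = "?XV g" and VVg = "?VV g" and XXh = "?XX h" and XVh = "?XV h" and VVh = "?VV h"])
      (simp_all only: px_px[OF s(1)] px_px[OF s(2)] px_px[OF s(3)] pv_pv[OF s(1)] pv_pv[OF s(2)] pv_pv[OF s(3)])
qed

lemma smooth_Sym: "smooth_all h \<Longrightarrow> smooth_all (Sym k h)"
  unfolding Sym_eq by (intro smooth_all_scaleR smooth_all_sum smooth_all_act) (auto simp: permutes_bij)

lemma g_bracket_jacobi:
  assumes s: "smooth_all f" "smooth_all g" "smooth_all h"
  shows "g_bracket n f (g_bracket n g h) + g_bracket n g (g_bracket n h f) + g_bracket n h (g_bracket n f g) = 0"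
  unfolding g_bracket_eq_pb pb_scaleR_right[OF smooth_pb[OF s(2,3)]] pb_scaleR_right[OF smooth_pb[OF s(3,1)]]
    pb_scaleR_right[OF smooth_pb[OF s(1,2)]] scaleR_add_right[symmetric] pb_jacobi[OF s] by (simp only: scaleR_zero_right)

text \<open>All three terms have the same degree \<open>l + j + m - 2\<close>, so a single embedding
  \<open>Sym n\<close> tests their sum; it turns iterated \<open>star\<close> into iterated
  \<open>g_bracket\<close>.\<close>

lemma star_jacobi:
  assumes f: "f \<in> g_space l" and g: "g \<in> g_space j" and h: "h \<in> g_space m"
    and p: "1 \<le> l" "1 \<le> j" "1 \<le> m" and n: "l + j + m - 2 \<le> n"
  shows "star n l (j + m - 1) f (star n j m g h) + star n j (m + l - 1) g (star n m l h f)
    + star n m (l + j - 1) h (star n l j f g) = 0"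
proof (rule Sym_eq_0_imp[OF _ n])
  have S: "star n a (b + c - 1) x (star n b c y w) \<in> g_space (a + b + c - 2) \<and>
      Sym n (star n a (b + c - 1) x (star n b c y w)) = g_bracket n (Sym n x) (g_bracket n (Sym n y) (Sym n w))"
    if "x \<in> g_space a" "y \<in> g_space b" "w \<in> g_space c" "1 \<le> a" "1 \<le> b" "1 \<le> c" "a + b + c - 2 \<le> n"
    for a b c and x y w :: "'a kfun"
  proof
    have e: "a + (b + c - 1) - 1 = a + b + c - 2" using that by auto
    have y: "star n b c y w \<in> g_space (b + c - 1)" by (rule star_in_g_space[OF that(2,3)])
    show "star n a (b + c - 1) x (star n b c y w) \<in> g_space (a + b + c - 2)"
      using star_in_g_space[OF that(1) y] unfolding e .
    have 1: "b + c - 1 \<le> n" "a + (b + c - 1) - 1 \<le> n" "1 \<le> b + c - 1" using that by auto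
    show "Sym n (star n a (b + c - 1) x (star n b c y w)) = g_bracket n (Sym n x) (g_bracket n (Sym n y) (Sym n w))"
      unfolding g_bracket_Sym[OF that(2,3) 1(1) that(5,6)] g_bracket_Sym[OF that(1) y 1(2) that(4) 1(3)] ..
  qed
  have e: "j + m + l - 2 = l + j + m - 2" "m + l + j - 2 = l + j + m - 2" by auto
  note 1 = S[OF f g h p n] and 2 = S[OF g h f p(2,3,1), unfolded e, OF n] and 3 = S[OF h f g p(3,1,2), unfolded e, OF n]
  show "star n l (j + m - 1) f (star n j m g h) + star n j (m + l - 1) g (star n m l h f)
    + star n m (l + j - 1) h (star n l j f g) \<in> g_space (l + j + m - 2)"
    using 1 2 3 by (intro subspace_add[OF subspace_g_space]) blast+
  show "Sym n (star n l (j + m - 1) f (star n j m g h) + star n j (m + l - 1) g (star n m l h f)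
    + star n m (l + j - 1) h (star n l j f g)) = 0"
    unfolding Sym_add 1[THEN conjunct2] 2[THEN conjunct2] 3[THEN conjunct2]
    by (rule g_bracket_jacobi[OF smooth_Sym[OF g_space_smooth[OF f]] smooth_Sym[OF g_space_smooth[OF g]]
        smooth_Sym[OF g_space_smooth[OF h]]])
qed

text \<open>Pointwise limits are enough here, since the claim is an identity between
  functions.\<close>

lemma beta_jacobi:
  assumes f: "f \<in> g_space l" and g: "g \<in> g_space j" and h: "h \<in> g_space m"
    and p: "1 \<le> l" "1 \<le> j" "1 \<le> m"
  shows "beta l (j + m - 1) f (beta j m g h) + beta j (m + l - 1) g (beta m l h f)
    + beta m (l + j - 1) h (beta l j f g) = 0"
proof
  fix z
  let ?s = "\<lambda>n. star n l (j + m - 1) f (star n j m g h) z + star n j (m + l - 1) g (star n m l h f) z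
    + star n m (l + j - 1) h (star n l j f g) z"
  have "?s \<longlonglongrightarrow> beta l (j + m - 1) f (beta j m g h) z + beta j (m + l - 1) g (beta m l h f) z
    + beta m (l + j - 1) h (beta l j f g) z"
    by (intro tendsto_add star_star_tendsto f g h p)
  moreover have "\<forall>\<^sub>F n in sequentially. ?s n = 0"
    using eventually_ge_at_top[of "l + j + m - 2"]
  proof eventually_elim
    case (elim n)
    show ?case using fun_cong[OF star_jacobi[OF f g h p elim], of z] by (simp only: plus_fun_apply zero_fun_apply)
  qed
  then have "?s \<longlonglongrightarrow> 0" by (rule tendsto_eventually)
  ultimately show "(beta l (j + m - 1) f (beta j m g h) + beta j (m + l - 1) g (beta m l h f)
    + beta m (l + j - 1) h (beta l j f g)) z = 0 z"
    unfolding plus_fun_apply zero_fun_apply by (rule LIMSEQ_unique)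
qed

section \<open>Topologies generated by directed families of seminorms\<close>

lemma seminorm_on_scaleR: "seminorm_on V p \<Longrightarrow> x \<in> V \<Longrightarrow> p (c *\<^sub>R x) = \<bar>c\<bar> * p x"
  unfolding seminorm_on_def by blast

lemma seminorm_on_zero: "seminorm_on V p \<Longrightarrow> 0 \<in> V \<Longrightarrow> p 0 = 0"
  using seminorm_on_scaleR[of V p 0 0] by simp

lemma seminorm_on_minus: "seminorm_on V p \<Longrightarrow> x \<in> V \<Longrightarrow> p (- x) = p x"
  using seminorm_on_scaleR[of V p x "-1"] by simp

lemma seminorm_on_nonneg:
  assumes "seminorm_on V p" "subspace V" "x \<in> V"
  shows "p x \<ge> 0"
proof -
  have "p (x + - x) \<le> p x + p (- x)"
    using assms(1,3) subspace_neg[OF assms(2,3)] unfolding seminorm_on_def by blast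
  then show ?thesis
    using seminorm_on_minus[OF assms(1,3)] seminorm_on_zero[OF assms(1) subspace_0[OF assms(2)]] by simp
qed

lemma continuous_mapI_pointwise:
  assumes "\<And>x. x \<in> topspace X \<Longrightarrow> f x \<in> topspace Y"
    and "\<And>x U. x \<in> topspace X \<Longrightarrow> openin Y U \<Longrightarrow> f x \<in> U \<Longrightarrow> \<exists>W. openin X W \<and> x \<in> W \<and> f ` W \<subseteq> U"
  shows "continuous_map X Y f"
  unfolding continuous_map_def
proof (intro conjI allI impI)
  show "f \<in> topspace X \<rightarrow> topspace Y" using assms(1) by blast
next
  fix U assume U: "openin Y U"
  show "openin X {x \<in> topspace X. f x \<in> U}"
  proof (subst openin_subopen, rule ballI)
    fix x assume "x \<in> {x \<in> topspace X. f x \<in> U}"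
    then obtain W where W: "openin X W" "x \<in> W" "f ` W \<subseteq> U" using assms(2)[OF _ U] by blast
    then show "\<exists>T. openin X T \<and> x \<in> T \<and> T \<subseteq> {x \<in> topspace X. f x \<in> U}"
      using openin_subset[OF W(1)] by blast
  qed
qed

text \<open>Directedness lets a ball of a single seminorm fit into any finite intersection of balls
  with the same centre. Both the seminorms of one summand and those of the direct sum form such
  families.\<close>

locale seminorm_family =
  fixes V :: "'a::real_vector set" and P :: "('a \<Rightarrow> real) set"
  assumes sub: "subspace V" and seminorm: "p \<in> P \<Longrightarrow> seminorm_on V p" and nonempty: "P \<noteq> {}"
    and directed: "p \<in> P \<Longrightarrow> q \<in> P \<Longrightarrow> \<exists>s\<in>P. \<forall>x\<in>V. p x \<le> s x \<and> q x \<le> s x"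
begin

abbreviation "T \<equiv> seminorm_topology V P"

lemma nonneg: "p \<in> P \<Longrightarrow> x \<in> V \<Longrightarrow> p x \<ge> 0"
  using seminorm_on_nonneg[OF seminorm sub] by blast

lemma zero: "p \<in> P \<Longrightarrow> p 0 = 0"
  using seminorm_on_zero[OF seminorm subspace_0[OF sub]] by blast

lemma triangle: "p \<in> P \<Longrightarrow> x \<in> V \<Longrightarrow> y \<in> V \<Longrightarrow> p (x + y) \<le> p x + p y"
  using seminorm unfolding seminorm_on_def by blast

lemma scale: "p \<in> P \<Longrightarrow> x \<in> V \<Longrightarrow> p (c *\<^sub>R x) = \<bar>c\<bar> * p x"
  using seminorm unfolding seminorm_on_def by blast

lemma diff_in: "x \<in> V \<Longrightarrow> y \<in> V \<Longrightarrow> x - y \<in> V"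
  using subspace_diff[OF sub] by blast

lemma triangle_diff:
  assumes "p \<in> P" "x \<in> V" "y \<in> V" "z \<in> V"
  shows "p (x - z) \<le> p (x - y) + p (y - z)"
  using triangle[OF assms(1) diff_in[OF assms(2,3)] diff_in[OF assms(3,4)]] by simp

text \<open>A generating ball is recentred at any of its points by the triangle inequality, and
  intersections use directedness; open sets are thus described by balls around their points, as for
  a metric.\<close>

lemma openin_T:
  "openin T U \<longleftrightarrow> U \<subseteq> V \<and> (\<forall>x\<in>U. \<exists>p\<in>P. \<exists>r>0. {y \<in> V. p (y - x) < r} \<subseteq> U)"
proof
  assume "openin T U"
  then have "generate_topology_on {{y \<in> V. p (y - x) < r} | p x r. p \<in> P \<and> x \<in> V \<and> r > 0} U"
    unfolding seminorm_topology_def openin_topology_generated_by_iff .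
  then show "U \<subseteq> V \<and> (\<forall>x\<in>U. \<exists>p\<in>P. \<exists>r>0. {y \<in> V. p (y - x) < r} \<subseteq> U)"
  proof (induction rule: generate_topology_on.induct)
    case (Int A B)
    have "\<exists>p\<in>P. \<exists>r>0. {y \<in> V. p (y - x) < r} \<subseteq> A \<inter> B" if x: "x \<in> A \<inter> B" for x
    proof -
      obtain p r where p: "p \<in> P" "r > 0" "{y \<in> V. p (y - x) < r} \<subseteq> A" using Int x by blast
      obtain q s where q: "q \<in> P" "s > 0" "{y \<in> V. q (y - x) < s} \<subseteq> B" using Int x by blast
      obtain u where u: "u \<in> P" "\<forall>x\<in>V. p x \<le> u x \<and> q x \<le> u x" using directed[OF p(1) q(1)] by blast
      have xV: "x \<in> V" using x Int by blast
      have "{y \<in> V. u (y - x) < min r s} \<subseteq> A \<inter> B"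
      proof
        fix y assume y: "y \<in> {y \<in> V. u (y - x) < min r s}"
        then have "p (y - x) \<le> u (y - x)" "q (y - x) \<le> u (y - x)" using u(2) diff_in[OF _ xV] by blast+
        then show "y \<in> A \<inter> B" using y p(3) q(3) by fastforce
      qed
      moreover have "min r s > 0" using p(2) q(2) by simp
      ultimately show ?thesis using u(1) by blast
    qed
    then show ?case using Int by blast
  next
    case (UN K)
    have "\<exists>p\<in>P. \<exists>r>0. {y \<in> V. p (y - x) < r} \<subseteq> \<Union>K" if x: "x \<in> \<Union>K" for x
    proof -
      obtain k where k: "k \<in> K" "x \<in> k" using x by blast
      then obtain p r where "p \<in> P" "r > 0" "{y \<in> V. p (y - x) < r} \<subseteq> k" using UN.IH by blast
      then show ?thesis using Union_upper[OF k(1)] by (meson subset_trans)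
    qed
    moreover have "\<Union>K \<subseteq> V" using UN.IH by blast
    ultimately show ?case by blast
  next
    case (Basis S)
    then obtain p x0 r where S: "S = {y \<in> V. p (y - x0) < r}" "p \<in> P" "x0 \<in> V" "r > 0" by blast
    have "\<exists>r'>0. {y \<in> V. p (y - x) < r'} \<subseteq> S" if x: "x \<in> S" for x
    proof (intro exI conjI)
      show "r - p (x - x0) > 0" using x S by simp
      show "{y \<in> V. p (y - x) < r - p (x - x0)} \<subseteq> S"
      proof
        fix y assume y: "y \<in> {y \<in> V. p (y - x) < r - p (x - x0)}"
        have "x \<in> V" using x S by simp
        then have "p (y - x0) \<le> p (y - x) + p (x - x0)" using triangle_diff[OF S(2) _ _ S(3)] y by blast
        then show "y \<in> S" using y S(1) by simp
      qed
    qed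
    then show ?case using S(1,2) by blast
  qed blast
next
  assume U: "U \<subseteq> V \<and> (\<forall>x\<in>U. \<exists>p\<in>P. \<exists>r>0. {y \<in> V. p (y - x) < r} \<subseteq> U)"
  show "openin T U"
  proof (subst openin_subopen, rule ballI)
    fix x assume x: "x \<in> U"
    then obtain p r where p: "p \<in> P" "r > 0" "{y \<in> V. p (y - x) < r} \<subseteq> U" using U by blast
    have xV: "x \<in> V" using x U by blast
    have "openin T {y \<in> V. p (y - x) < r}"
      unfolding seminorm_topology_def by (rule topology_generated_by_Basis) (use p xV in blast)
    moreover have "x \<in> {y \<in> V. p (y - x) < r}" using xV p(1,2) zero[OF p(1)] by simp
    ultimately show "\<exists>W. openin T W \<and> x \<in> W \<and> W \<subseteq> U" using p(3) by blast
  qed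
qed

lemma openin_ball:
  assumes "p \<in> P" "x \<in> V" "r > 0"
  shows "openin T {y \<in> V. p (y - x) < r}"
  unfolding seminorm_topology_def by (rule topology_generated_by_Basis) (use assms in blast)

lemma topspace_T: "topspace T = V"
proof
  show "topspace T \<subseteq> V" using openin_topspace[of T] by (simp only: openin_T)
  obtain p where p: "p \<in> P" using nonempty by blast
  have "{y \<in> V. p (y - x) < 1} \<subseteq> V" for x by blast
  then have "openin T V"
    unfolding openin_T by (intro conjI subset_refl ballI bexI[OF _ p] exI[of _ 1] zero_less_one)
  then show "V \<subseteq> topspace T" by (rule openin_subset)
qed

lemma zero_nbhd_T: "zero_nbhd T U \<longleftrightarrow> U \<subseteq> V \<and> (\<exists>p\<in>P. \<exists>r>0. {y \<in> V. p y < r} \<subseteq> U)"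
proof
  assume "zero_nbhd T U"
  then obtain W where W: "U \<subseteq> V" "openin T W" "0 \<in> W" "W \<subseteq> U" unfolding zero_nbhd_def topspace_T by blast
  then obtain p r where "p \<in> P" "r > 0" "{y \<in> V. p (y - 0) < r} \<subseteq> W" unfolding openin_T by blast
  moreover from this(3) W(4) have "{y \<in> V. p y < r} \<subseteq> U" by (simp only: diff_zero subset_trans)
  ultimately show "U \<subseteq> V \<and> (\<exists>p\<in>P. \<exists>r>0. {y \<in> V. p y < r} \<subseteq> U)" using W(1) by blast
next
  assume U: "U \<subseteq> V \<and> (\<exists>p\<in>P. \<exists>r>0. {y \<in> V. p y < r} \<subseteq> U)"
  then obtain p r where p: "p \<in> P" "r > 0" "{y \<in> V. p y < r} \<subseteq> U" by blast
  have "openin T {y \<in> V. p y < r}"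
    using openin_ball[OF p(1) subspace_0[OF sub] p(2)] by (simp only: diff_zero)
  moreover have "0 \<in> {y \<in> V. p y < r}" using p(2) zero[OF p(1)] subspace_0[OF sub] by simp
  ultimately show "zero_nbhd T U" unfolding zero_nbhd_def topspace_T using U p(3) by blast
qed

lemma continuous_map_to_T:
  assumes "\<And>x. x \<in> topspace X \<Longrightarrow> f x \<in> V"
    and "\<And>x p r. x \<in> topspace X \<Longrightarrow> p \<in> P \<Longrightarrow> r > 0 \<Longrightarrow>
      \<exists>W. openin X W \<and> x \<in> W \<and> (\<forall>y\<in>W. p (f y - f x) < r)"
  shows "continuous_map X T f"
proof (rule continuous_mapI_pointwise)
  fix x U assume x: "x \<in> topspace X" and U: "openin T U" "f x \<in> U"
  then obtain p r where p: "p \<in> P" "r > 0" "{y \<in> V. p (y - f x) < r} \<subseteq> U" unfolding openin_T by blast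
  obtain W where W: "openin X W" "x \<in> W" "\<forall>y\<in>W. p (f y - f x) < r" using assms(2)[OF x p(1,2)] by blast
  then have "f ` W \<subseteq> U" using p(3) assms(1) openin_subset[OF W(1)] by blast
  then show "\<exists>W. openin X W \<and> x \<in> W \<and> f ` W \<subseteq> U" using W by blast
qed (use assms(1) topspace_T in blast)

lemma continuous_map_from_T:
  fixes \<phi> :: "'a \<Rightarrow> real"
  assumes "p \<in> P" "\<And>x y. x \<in> V \<Longrightarrow> y \<in> V \<Longrightarrow> \<bar>\<phi> y - \<phi> x\<bar> \<le> C * p (y - x)" "C \<ge> 0"
  shows "continuous_map T euclideanreal \<phi>"
proof (rule continuous_mapI_pointwise)
  fix x U assume x: "x \<in> topspace T" and U: "openin euclideanreal U" "\<phi> x \<in> U"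
  have xV: "x \<in> V" using x topspace_T by simp
  obtain e where e: "e > 0" "\<And>t. \<bar>t - \<phi> x\<bar> < e \<Longrightarrow> t \<in> U"
    using U unfolding open_openin[symmetric] open_dist dist_real_def by metis
  \<comment> \<open>Dividing by \<open>C + 1\<close> instead of \<open>C\<close> covers
    \<open>C = 0\<close>.\<close>
  let ?W = "{y \<in> V. p (y - x) < e / (C + 1)}"
  have "openin T ?W" using assms(3) e by (intro openin_ball assms(1) xV) auto
  moreover have "x \<in> ?W" using xV assms(3) e(1) zero[OF assms(1)] by simp
  moreover have "\<phi> ` ?W \<subseteq> U"
  proof
    fix t assume "t \<in> \<phi> ` ?W"
    then obtain y where y: "y \<in> V" "p (y - x) < e / (C + 1)" "t = \<phi> y" by blast
    have "\<bar>\<phi> y - \<phi> x\<bar> \<le> C * p (y - x)" by (rule assms(2)[OF xV y(1)])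
    also have "\<dots> \<le> (C + 1) * p (y - x)" using nonneg[OF assms(1) diff_in[OF y(1) xV]] by (simp add: distrib_right)
    also have "\<dots> < e" using y(2) assms(3) by (simp add: field_simps)
    finally show "t \<in> U" using e(2) y(3) by blast
  qed
  ultimately show "\<exists>W. openin T W \<and> x \<in> W \<and> \<phi> ` W \<subseteq> U" by blast
qed simp

lemma continuous_seminorm:
  assumes "seminorm_on V s" "p \<in> P" "\<And>x. x \<in> V \<Longrightarrow> s x \<le> C * p x" "C \<ge> 0"
  shows "continuous_map T euclideanreal s"
proof (rule continuous_map_from_T[OF assms(2) _ assms(4)])
  fix x y assume xy: "x \<in> V" "y \<in> V"
  have tri: "s (a + b) \<le> s a + s b" if "a \<in> V" "b \<in> V" for a b
    using assms(1) that unfolding seminorm_on_def by blast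
  have "s y \<le> s (y - x) + s x" "s x \<le> s (x - y) + s y"
    using tri[OF diff_in[OF xy(2,1)] xy(1)] tri[OF diff_in[OF xy] xy(2)] by simp_all
  moreover have "s (x - y) = s (y - x)"
    using seminorm_on_minus[OF assms(1) diff_in[OF xy(2,1)]] by simp
  ultimately show "\<bar>s y - s x\<bar> \<le> C * p (y - x)"
    using assms(3)[OF diff_in[OF xy(2,1)]] by linarith
qed

text \<open>Continuity yields a ball \<open>p x < r\<close> on which \<open>s < 1\<close>, and
  homogeneity spreads this over \<open>V\<close>. Where \<open>p x = 0\<close>, all multiples of
  \<open>x\<close> lie in the ball, which forces \<open>s x \<le> 0\<close>.\<close>

lemma continuous_seminorm_bound:
  assumes s: "seminorm_on V s" and c: "continuous_map T euclideanreal s"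
  obtains p C where "p \<in> P" "C \<ge> 0" "\<And>x. x \<in> V \<Longrightarrow> s x \<le> C * p x"
proof -
  have "openin T {x \<in> topspace T. s x \<in> {..<1}}"
    by (rule openin_continuous_map_preimage[OF c]) (simp flip: open_openin)
  moreover have "0 \<in> {x \<in> topspace T. s x \<in> {..<1}}"
    using seminorm_on_zero[OF s] subspace_0[OF sub] topspace_T by simp
  ultimately obtain p r where p: "p \<in> P" "r > 0" "{y \<in> V. p (y - 0) < r} \<subseteq> {x \<in> topspace T. s x \<in> {..<1}}"
    unfolding openin_T by blast
  have small: "s x < 1" if "x \<in> V" "p x < r" for x using p(3) that by auto
  have ssc: "s (c *\<^sub>R x) = \<bar>c\<bar> * s x" if "x \<in> V" for c x using s that unfolding seminorm_on_def by blast
  have "s x \<le> (2 / r) * p x" if x: "x \<in> V" for x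
  proof (cases "p x = 0")
    case True
    have "s x \<le> e" if "e > 0" for e
    proof -
      have "s ((1 / e) *\<^sub>R x) < 1"
        using True scale[OF p(1) x] p(2) subspace_scale[OF sub x] by (intro small) auto
      then show ?thesis using that ssc[OF x] by (simp add: field_simps)
    qed
    then have "s x \<le> 0" by (rule field_le_epsilon[of _ 0, simplified])
    then show ?thesis using True by simp
  next
    case False
    then have pos: "p x > 0" using nonneg[OF p(1) x] by simp
    \<comment> \<open>\<open>x\<close> is scaled to \<open>p\<close>-size \<open>r / 2\<close>,
      strictly inside the ball; this is the origin of the constant \<open>2 / r\<close>.\<close>
    let ?c = "r / (2 * p x)"
    have "s (?c *\<^sub>R x) < 1"
      using pos scale[OF p(1) x, of ?c] p(2) subspace_scale[OF sub x] by (intro small) auto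
    moreover have "s (?c *\<^sub>R x) = ?c * s x" using ssc[OF x, of ?c] pos p(2) by simp
    ultimately have "?c * s x < 1" by (simp only:)
    then show ?thesis using pos p(2) by (simp add: field_simps)
  qed
  then show ?thesis using that[OF p(1), of "2 / r"] p(2) by simp
qed

lemma Hausdorff_T:
  assumes "\<And>x. x \<in> V \<Longrightarrow> x \<noteq> 0 \<Longrightarrow> \<exists>p\<in>P. p x \<noteq> 0"
  shows "Hausdorff_space T"
  unfolding Hausdorff_space_def topspace_T
proof (intro allI impI, elim conjE)
  fix x y assume xy: "x \<in> V" "y \<in> V" "x \<noteq> y"
  then obtain p where p: "p \<in> P" "p (x - y) \<noteq> 0" using assms[OF diff_in[OF xy(1,2)]] by auto
  then have pos: "p (x - y) > 0" using nonneg[OF p(1) diff_in[OF xy(1,2)]] by simp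
  let ?B = "\<lambda>u. {z \<in> V. p (z - u) < p (x - y) / 2}"
  have "disjnt (?B x) (?B y)"
    unfolding disjnt_iff
  proof (intro allI notI, elim conjE)
    fix z assume z: "z \<in> ?B x" "z \<in> ?B y"
    have "p (x - y) \<le> p (x - z) + p (z - y)" using triangle_diff[OF p(1) xy(1) _ xy(2)] z by blast
    moreover have "p (x - z) = p (z - x)"
      using seminorm_on_minus[OF seminorm[OF p(1)] diff_in[of z x]] z xy by simp
    ultimately show False using z by simp
  qed
  moreover have "openin T (?B x)" "openin T (?B y)" by (rule openin_ball[OF p(1)]; use xy pos in simp)+
  moreover have "x \<in> ?B x" "y \<in> ?B y" using xy pos zero[OF p(1)] by auto
  ultimately show "\<exists>U Va. openin T U \<and> openin T Va \<and> x \<in> U \<and> y \<in> Va \<and> disjnt U Va" by blast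
qed

lemma continuous_add: "continuous_map (prod_topology T T) T (\<lambda>(x, y). x + y)"
  unfolding case_prod_unfold
proof (rule continuous_map_to_T)
  fix w p and r :: real assume w: "w \<in> topspace (prod_topology T T)" and p: "p \<in> P" "r > 0"
  obtain x y where xy: "w = (x, y)" "x \<in> V" "y \<in> V" using w topspace_T by auto
  let ?B = "\<lambda>u. {z \<in> V. p (z - u) < r / 2}"
  have "openin (prod_topology T T) (?B x \<times> ?B y)"
    unfolding openin_prod_Times_iff
    using openin_ball[OF p(1) xy(2), of "r / 2"] openin_ball[OF p(1) xy(3), of "r / 2"] half_gt_zero[OF p(2)] by (intro disjI2 conjI)
  moreover have "w \<in> ?B x \<times> ?B y" using xy p(2) zero[OF p(1)] by simp
  moreover have "p (a + b - (x + y)) < r" if "a \<in> ?B x" "b \<in> ?B y" for a b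
  proof -
    have e: "a + b - (x + y) = (a - x) + (b - y)" by simp
    have "p (a + b - (x + y)) \<le> p (a - x) + p (b - y)"
      unfolding e by (rule triangle[OF p(1) diff_in diff_in]) (use that xy in simp_all)
    then show ?thesis using that by simp
  qed
  then have "p (fst u + snd u - (fst w + snd w)) < r" if "u \<in> ?B x \<times> ?B y" for u
    using that unfolding xy(1) fst_conv snd_conv mem_Times_iff by (elim conjE)
  ultimately show "\<exists>W. openin (prod_topology T T) W \<and> w \<in> W \<and>
      (\<forall>u\<in>W. p (fst u + snd u - (fst w + snd w)) < r)"
    by blast
qed (auto simp: topspace_T intro: subspace_add[OF sub])

lemma continuous_scaleR: "continuous_map (prod_topology euclideanreal T) T (\<lambda>(c, x). c *\<^sub>R x)"
  unfolding case_prod_unfold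
proof (rule continuous_map_to_T)
  fix w p and r :: real assume w: "w \<in> topspace (prod_topology euclideanreal T)" and p: "p \<in> P" "r > 0"
  obtain c x where cx: "w = (c, x)" "x \<in> V" using w topspace_T by auto
  have px: "p x \<ge> 0" by (rule nonneg[OF p(1) cx(2)])
  \<comment> \<open>\<open>d \<le> 1\<close> keeps the perturbed scalar below
    \<open>\<bar>c\<bar> + 1\<close>, and the \<open>1\<close> in \<open>p x + 1\<close> excludes
    division by zero; the two error terms get \<open>r / 2\<close> each.\<close>
  define d where "d = min 1 (r / (2 * (p x + 1)))"
  define e where "e = r / (2 * (\<bar>c\<bar> + 1))"
  have de: "d > 0" "e > 0" "d \<le> 1" using p(2) px by (auto simp: d_def e_def)
  let ?B = "{z \<in> V. p (z - x) < e}"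
  have "openin (prod_topology euclideanreal T) (ball c d \<times> ?B)"
    unfolding openin_prod_Times_iff using openin_ball[OF p(1) cx(2) de(2)] by (simp flip: open_openin)
  moreover have "w \<in> ball c d \<times> ?B" using cx de zero[OF p(1)] by simp
  moreover have "p (a *\<^sub>R y - c *\<^sub>R x) < r" if "a \<in> ball c d" "y \<in> ?B" for a y
  proof -
    have yV: "y \<in> V" and yx: "p (y - x) < e" and ac: "\<bar>a - c\<bar> < d"
      using that by (auto simp: dist_real_def abs_minus_commute)
    have "a *\<^sub>R y - c *\<^sub>R x = a *\<^sub>R (y - x) + (a - c) *\<^sub>R x" by (simp add: algebra_simps)
    then have "p (a *\<^sub>R y - c *\<^sub>R x) \<le> \<bar>a\<bar> * p (y - x) + \<bar>a - c\<bar> * p x"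
      using triangle[OF p(1) subspace_scale[OF sub diff_in[OF yV cx(2)]] subspace_scale[OF sub cx(2)], of a "a - c"]
        scale[OF p(1) diff_in[OF yV cx(2)]] scale[OF p(1) cx(2)] by simp
    also have "\<bar>a\<bar> * p (y - x) \<le> (\<bar>c\<bar> + 1) * p (y - x)"
      using ac de(3) nonneg[OF p(1) diff_in[OF yV cx(2)]] by (intro mult_right_mono) auto
    also have "\<dots> < r / 2" using yx by (simp add: e_def field_simps)
    also have "\<bar>a - c\<bar> * p x \<le> d * (p x + 1)" using ac px by (intro mult_mono) auto
    also have "\<dots> \<le> r / (2 * (p x + 1)) * (p x + 1)" using px by (intro mult_right_mono) (auto simp: d_def)
    also have "\<dots> = r / 2" using px by (simp add: field_simps)
    finally show ?thesis by simp
  qed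
  then have "p (fst u *\<^sub>R snd u - fst w *\<^sub>R snd w) < r" if "u \<in> ball c d \<times> ?B" for u
    using that unfolding cx(1) fst_conv snd_conv mem_Times_iff by (elim conjE)
  ultimately show "\<exists>W. openin (prod_topology euclideanreal T) W \<and> w \<in> W \<and>
      (\<forall>u\<in>W. p (fst u *\<^sub>R snd u - fst w *\<^sub>R snd w) < r)"
    by blast
qed (auto simp: topspace_T intro: subspace_scale[OF sub])

lemma locally_convex_T:
  assumes "\<And>x. x \<in> V \<Longrightarrow> x \<noteq> 0 \<Longrightarrow> \<exists>p\<in>P. p x \<noteq> 0"
  shows "locally_convex_space V T"
  unfolding locally_convex_space_def
proof (intro conjI allI impI sub topspace_T Hausdorff_T[OF assms] continuous_add continuous_scaleR)
  fix U assume "zero_nbhd T U"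
  then obtain p r where p: "p \<in> P" "r > 0" "{y \<in> V. p y < r} \<subseteq> U" unfolding zero_nbhd_T by blast
  have "convex {y \<in> V. p y < r}"
  proof (rule convexI)
    fix x y and u v :: real assume xy: "x \<in> {y \<in> V. p y < r}" "y \<in> {y \<in> V. p y < r}" and uv: "0 \<le> u" "0 \<le> v" "u + v = 1"
    have V: "u *\<^sub>R x \<in> V" "v *\<^sub>R y \<in> V" using xy subspace_scale[OF sub] by auto
    have "p (u *\<^sub>R x + v *\<^sub>R y) \<le> u * p x + v * p y"
      using triangle[OF p(1) V] scale[OF p(1), of x u] scale[OF p(1), of y v] xy uv by simp
    also have "\<dots> < r" using xy uv by (intro convex_bound_lt) auto
    finally show "u *\<^sub>R x + v *\<^sub>R y \<in> {y \<in> V. p y < r}" using subspace_add[OF sub V] by simp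
  qed
  moreover have "zero_nbhd T {y \<in> V. p y < r}" unfolding zero_nbhd_T using p by blast
  ultimately show "\<exists>W. zero_nbhd T W \<and> convex W \<and> W \<subseteq> U" using p(3) by blast
qed (use Hausdorff_T[OF assms] in blast)

lemma limitin_T:
  assumes "L \<in> V" "\<forall>\<^sub>F n in F. f n \<in> V" "\<And>p. p \<in> P \<Longrightarrow> ((\<lambda>n. p (f n - L)) \<longlongrightarrow> 0) F"
  shows "limitin T f L F"
  unfolding limitin_def topspace_T
proof (intro conjI allI impI assms(1), elim conjE)
  fix U assume U: "openin T U" "L \<in> U"
  then obtain p r where p: "p \<in> P" "r > 0" "{y \<in> V. p (y - L) < r} \<subseteq> U" unfolding openin_T by blast
  have "\<forall>\<^sub>F n in F. p (f n - L) < r" using order_tendstoD(2)[OF assms(3)[OF p(1)] p(2)] .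
  with assms(2) show "\<forall>\<^sub>F n in F. f n \<in> U" by eventually_elim (use p(3) in blast)
qed

lemma continuous_linear:
  assumes "\<And>x. x \<in> V \<Longrightarrow> f x \<in> V" "\<And>x y. x \<in> V \<Longrightarrow> y \<in> V \<Longrightarrow> f (y - x) = f y - f x"
    and "\<And>p. p \<in> P \<Longrightarrow> \<exists>q\<in>P. \<forall>x\<in>V. p (f x) \<le> q x"
  shows "continuous_map T T f"
proof (rule continuous_map_to_T)
  fix x p and r :: real assume x: "x \<in> topspace T" and p: "p \<in> P" "r > 0"
  obtain q where q: "q \<in> P" "\<forall>x\<in>V. p (f x) \<le> q x" using assms(3)[OF p(1)] by blast
  have xV: "x \<in> V" using x topspace_T by simp
  have "p (f y - f x) < r" if "y \<in> {y \<in> V. q (y - x) < r}" for y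
  proof -
    have "p (f (y - x)) \<le> q (y - x)" using q(2) diff_in[OF _ xV] that by blast
    then show ?thesis using assms(2)[OF xV, of y] that by simp
  qed
  moreover have "openin T {y \<in> V. q (y - x) < r}" by (rule openin_ball[OF q(1) xV p(2)])
  moreover have "x \<in> {y \<in> V. q (y - x) < r}" using xV zero[OF q(1)] p(2) by simp
  ultimately show "\<exists>W. openin T W \<and> x \<in> W \<and> (\<forall>y\<in>W. p (f y - f x) < r)" by blast
qed (use assms(1) topspace_T in blast)

text \<open>The unit ball of \<open>p\<close> is a neighbourhood of zero and absorbs
  \<open>B\<close>. Absorption is known only for factors beyond \<open>s\<close>, hence the bound
  \<open>s + 1\<close>.\<close>

lemma tvs_bounded_T:
  assumes "tvs_bounded T B" "p \<in> P"
  obtains C where "\<And>x. x \<in> B \<Longrightarrow> p x \<le> C"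
proof -
  have "zero_nbhd T {y \<in> V. p y < 1}" unfolding zero_nbhd_T using assms(2) zero_less_one by blast
  then obtain s where s: "s > 0" "\<forall>t>s. B \<subseteq> (\<lambda>x. t *\<^sub>R x) ` {y \<in> V. p y < 1}"
    using assms(1) unfolding tvs_bounded_def by blast
  have "p x \<le> s + 1" if "x \<in> B" for x
  proof -
    have "x \<in> (\<lambda>x. (s + 1) *\<^sub>R x) ` {y \<in> V. p y < 1}"
      using s(2)[rule_format, of "s + 1"] that by (simp add: subset_iff)
    then obtain y where y: "x = (s + 1) *\<^sub>R y" "y \<in> V" "p y < 1" by blast
    have "(s + 1) * p y \<le> (s + 1) * 1" using y s(1) by (intro mult_left_mono) auto
    then show ?thesis using scale[OF assms(2) y(2), of "s + 1"] y(1) s(1) by simp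
  qed
  then show ?thesis using that by blast
qed

end

section \<open>Seminorm estimates\<close>

lemma partials_snoc: "partials (\<alpha> @ [(i, b)]) f = partials \<alpha> (partial i b f)"
  by (simp add: partials_append)

lemma partials_add:
  assumes "smooth_all f" "smooth_all g" "\<alpha> \<in> lists (UNIV \<times> Basis)"
  shows "partials \<alpha> (f + g) = partials \<alpha> f + partials \<alpha> g"
  using assms(3)
proof (induction rule: lists.induct)
  case (Cons a \<alpha>)
  obtain i b where a: "a = (i, b)" by (cases a)
  have b: "b \<in> Basis" using Cons.hyps(1) unfolding a by blast
  show ?case
    unfolding a partials.simps Cons.IH
    by (rule partial_add[OF smooth_all_dir_differentiable[OF smooth_all_partials[OF assms(1) Cons.hyps(2)]]
          smooth_all_dir_differentiable[OF smooth_all_partials[OF assms(2) Cons.hyps(2)]] b])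
qed (simp only: partials.simps)

lemma partials_scaleR:
  assumes "smooth_all f" "\<alpha> \<in> lists (UNIV \<times> Basis)"
  shows "partials \<alpha> (c *\<^sub>R f) = c *\<^sub>R partials \<alpha> f"
  using assms(2)
proof (induction rule: lists.induct)
  case (Cons a \<alpha>)
  obtain i b where a: "a = (i, b)" by (cases a)
  have b: "b \<in> Basis" using Cons.hyps(1) unfolding a by blast
  show ?case
    unfolding a partials.simps Cons.IH
    by (rule partial_scaleR[OF smooth_all_dir_differentiable[OF smooth_all_partials[OF assms(1) Cons.hyps(2)]] b])
qed (simp only: partials.simps)

lemma partials_act:
  assumes "bij \<rho>"
  shows "partials \<alpha> (act \<rho> f) = act \<rho> (partials (map (apfst (inv \<rho>)) \<alpha>) f)"
proof (induction \<alpha>)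
  case (Cons a \<alpha>)
  obtain i b where a: "a = (i, b)" by (cases a)
  show ?case
    unfolding a list.map apfst_conv partials.simps Cons.IH by (rule partial_act[OF assms])
qed (simp only: partials.simps list.map)

text \<open>A bound at a single point and in all directions passes through relabelling, products and
  brackets without reference to \<open>k\<close> or \<open>K\<close>. Suprema are taken only at the
  end, by \<open>g_seminorm_le\<close>.\<close>

definition derivs_le :: "nat \<Rightarrow> real \<Rightarrow> 'd::finite kfun \<Rightarrow> (nat \<Rightarrow> 'd phase) \<Rightarrow> bool" where
  "derivs_le n A f z \<longleftrightarrow>
     (\<forall>\<alpha>\<in>lists (UNIV \<times> Basis). length \<alpha> \<le> n \<longrightarrow> \<bar>partials \<alpha> f z\<bar> \<le> A)"

lemma derivs_leD: "derivs_le n A f z \<Longrightarrow> \<alpha> \<in> lists (UNIV \<times> Basis) \<Longrightarrow> length \<alpha> \<le> n \<Longrightarrow> \<bar>partials \<alpha> f z\<bar> \<le> A"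
  unfolding derivs_le_def by blast

lemma derivs_le_nonneg: "derivs_le n A f z \<Longrightarrow> A \<ge> 0"
  using derivs_leD[of n A f z "[]"] by fastforce

lemma derivs_le_mono: "derivs_le n A f z \<Longrightarrow> m \<le> n \<Longrightarrow> A \<le> B \<Longrightarrow> derivs_le m B f z"
  unfolding derivs_le_def by (meson order_trans)

lemma derivs_le_zero: "derivs_le n 0 0 z"
  unfolding derivs_le_def partials_zero by simp

lemma derivs_le_add:
  assumes "smooth_all f" "smooth_all g" "derivs_le n A f z" "derivs_le n B g z"
  shows "derivs_le n (A + B) (f + g) z"
  unfolding derivs_le_def
proof (intro ballI impI)
  fix \<alpha> :: "(nat \<times> 'a phase) list" assume a: "\<alpha> \<in> lists (UNIV \<times> Basis)" "length \<alpha> \<le> n"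
  show "\<bar>partials \<alpha> (f + g) z\<bar> \<le> A + B"
    unfolding partials_add[OF assms(1,2) a(1)] plus_fun_apply
    using derivs_leD[OF assms(3) a] derivs_leD[OF assms(4) a] by linarith
qed

lemma derivs_le_scaleR:
  assumes "smooth_all f" "derivs_le n A f z"
  shows "derivs_le n (\<bar>c\<bar> * A) (c *\<^sub>R f) z"
  unfolding derivs_le_def
proof (intro ballI impI)
  fix \<alpha> :: "(nat \<times> 'a phase) list" assume a: "\<alpha> \<in> lists (UNIV \<times> Basis)" "length \<alpha> \<le> n"
  show "\<bar>partials \<alpha> (c *\<^sub>R f) z\<bar> \<le> \<bar>c\<bar> * A"
    unfolding partials_scaleR[OF assms(1) a(1)] unfolding scaleR_fun_def
    using derivs_leD[OF assms(2) a] by (simp add: abs_mult mult_left_mono)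
qed

lemma derivs_le_diff:
  assumes "smooth_all f" "smooth_all g" "derivs_le n A f z" "derivs_le n B g z"
  shows "derivs_le n (A + B) (f - g) z"
proof -
  have "derivs_le n (\<bar>-1\<bar> * B) (- 1 *\<^sub>R g) z" by (rule derivs_le_scaleR[OF assms(2,4)])
  then have "derivs_le n B (- g) z" by (simp only: scaleR_minus1_left abs_minus_cancel abs_one mult_1)
  from derivs_le_add[OF assms(1) smooth_all_minus[OF assms(2)] assms(3) this] show ?thesis
    unfolding diff_conv_add_uminus .
qed

lemma derivs_le_sum:
  assumes "\<And>x. x \<in> S \<Longrightarrow> smooth_all (f x)" "\<And>x. x \<in> S \<Longrightarrow> derivs_le n A (f x) z" "finite S"
  shows "derivs_le n (real (card S) * A) (sum f S) z"
  using assms(3,1,2)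
proof (induction S rule: finite_induct)
  case empty
  show ?case by (simp only: sum.empty card.empty of_nat_0 mult_zero_left derivs_le_zero)
next
  case (insert x S)
  have "derivs_le n (A + real (card S) * A) (f x + sum f S) z"
    using insert by (intro derivs_le_add smooth_all_sum) blast+
  then show ?case
    unfolding sum.insert[OF insert.hyps(1,2)] card_insert_disjoint[OF insert.hyps(1,2)]
    by (simp only: of_nat_Suc distrib_right mult_1_left add.commute)
qed

lemma derivs_le_partial:
  assumes "derivs_le (Suc n) A f z" "b \<in> Basis"
  shows "derivs_le n A (partial i b f) z"
  unfolding derivs_le_def partials_snoc[symmetric]
proof (intro ballI impI)
  fix \<alpha> :: "(nat \<times> 'a phase) list" assume a: "\<alpha> \<in> lists (UNIV \<times> Basis)" "length \<alpha> \<le> n"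
  show "\<bar>partials (\<alpha> @ [(i, b)]) f z\<bar> \<le> A"
    by (rule derivs_leD[OF assms(1)]) (use a assms(2) in auto)
qed

text \<open>Relabelling renames the particles in a multi-index and keeps its order, so the bound
  transfers unchanged.\<close>

lemma derivs_le_act:
  assumes "bij \<rho>" "derivs_le n A f (z \<circ> \<rho>)"
  shows "derivs_le n A (act \<rho> f) z"
  unfolding derivs_le_def partials_act[OF assms(1)]
proof (intro ballI impI)
  fix \<alpha> :: "(nat \<times> 'a phase) list" assume a: "\<alpha> \<in> lists (UNIV \<times> Basis)" "length \<alpha> \<le> n"
  show "\<bar>act \<rho> (partials (map (apfst (inv \<rho>)) \<alpha>) f) z\<bar> \<le> A"
    unfolding act_def by (rule derivs_leD[OF assms(2)]) (use a in \<open>auto simp: lists_eq_set\<close>)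
qed

text \<open>Peeling off the innermost derivative keeps the statement within products, so the Leibniz
  rule costs a factor 2 per derivative.\<close>

lemma derivs_le_mult:
  assumes "smooth_all f" "smooth_all g" "derivs_le n A f z" "derivs_le n B g z"
  shows "derivs_le n (2 ^ n * (A * B)) (f * g) z"
  using assms
proof (induction n arbitrary: f g)
  case 0
  have "\<bar>f z\<bar> \<le> A" "\<bar>g z\<bar> \<le> B" using derivs_leD[OF 0(3), of "[]"] derivs_leD[OF 0(4), of "[]"] by simp_all
  then have "\<bar>f z * g z\<bar> \<le> A * B" unfolding abs_mult by (intro mult_mono) auto
  then show ?case unfolding derivs_le_def by simp
next
  case (Suc n)
  have AB: "A * B \<ge> 0" using derivs_le_nonneg Suc.prems by (meson mult_nonneg_nonneg)
  show ?case unfolding derivs_le_def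
  proof (intro ballI impI)
    fix \<alpha> :: "(nat \<times> 'a phase) list" assume a: "\<alpha> \<in> lists (UNIV \<times> Basis)" "length \<alpha> \<le> Suc n"
    show "\<bar>partials \<alpha> (f * g) z\<bar> \<le> 2 ^ Suc n * (A * B)"
    proof (cases \<alpha> rule: rev_exhaust)
      case Nil
      have "\<bar>f z\<bar> \<le> A" "\<bar>g z\<bar> \<le> B"
        using derivs_leD[OF Suc.prems(3), of "[]"] derivs_leD[OF Suc.prems(4), of "[]"] by simp_all
      then have "\<bar>f z * g z\<bar> \<le> 1 * (A * B)" unfolding abs_mult mult_1_left by (intro mult_mono) auto
      also have "\<dots> \<le> 2 ^ Suc n * (A * B)" using AB by (intro mult_right_mono one_le_power) auto
      finally show ?thesis using Nil by simp
    next
      case (snoc \<beta> x)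
      obtain i b where x: "x = (i, b)" by (cases x)
      have \<beta>: "\<beta> \<in> lists (UNIV \<times> Basis)" "length \<beta> \<le> n" and b: "b \<in> Basis"
        using a unfolding snoc x by auto
      note d = smooth_all_dir_differentiable
      have s: "smooth_all (partial i b f)" "smooth_all (partial i b g)"
        using Suc.prems(1,2) b by (auto intro: smooth_all_partial)
      have n: "derivs_le n A f z" "derivs_le n B g z" using Suc.prems(3,4) by (auto intro: derivs_le_mono)
      have 1: "derivs_le n (2 ^ n * (A * B)) (partial i b f * g) z"
        by (rule Suc.IH[OF s(1) Suc.prems(2) derivs_le_partial[OF Suc.prems(3) b] n(2)])
      have 2: "derivs_le n (2 ^ n * (A * B)) (f * partial i b g) z"
        by (rule Suc.IH[OF Suc.prems(1) s(2) n(1) derivs_le_partial[OF Suc.prems(4) b]])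
      have "derivs_le n (2 ^ n * (A * B) + 2 ^ n * (A * B)) (partial i b f * g + f * partial i b g) z"
        by (rule derivs_le_add[OF smooth_all_mult[OF s(1) Suc.prems(2)] smooth_all_mult[OF Suc.prems(1) s(2)] 1 2])
      then have "\<bar>partials \<beta> (partial i b (f * g)) z\<bar> \<le> 2 ^ n * (A * B) + 2 ^ n * (A * B)"
        unfolding partial_mult[OF d[OF Suc.prems(1)] d[OF Suc.prems(2)] b] by (rule derivs_leD[OF _ \<beta>])
      then show ?thesis unfolding snoc x partials_snoc by (simp add: mult_ac)
    qed
  qed
qed

text \<open>One order is lost to the derivatives inside the bracket. The constant counts particles,
  coordinates and two products, each with the factor \<open>2 ^ n\<close> of
  \<open>derivs_le_mult\<close>.\<close>

lemma derivs_le_pb: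
  fixes f g :: "'d::finite kfun"
  assumes s: "smooth_all f" "smooth_all g" and d: "derivs_le (Suc n) A f z" "derivs_le (Suc n) B g z"
  shows "derivs_le n (real k * (real CARD('d) * (2 ^ n * (A * B) + 2 ^ n * (A * B)))) (pb k f g) z"
proof -
  have t: "derivs_le n (2 ^ n * (A * B) + 2 ^ n * (A * B)) (px i c f * pv i c g - pv i c f * px i c g) z" for i c
    unfolding px_def pv_def
    by (intro derivs_le_diff derivs_le_mult smooth_all_mult smooth_all_partial s derivs_le_partial[OF d(1)] derivs_le_partial[OF d(2)]
        x_dir v_dir)
  have u: "derivs_le n (real CARD('d) * (2 ^ n * (A * B) + 2 ^ n * (A * B)))
      (\<Sum>c\<in>UNIV. px i c f * pv i c g - pv i c f * px i c g) z" for i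
    by (intro derivs_le_sum t smooth_all_diff smooth_all_mult smooth_px smooth_pv s finite)
  have "derivs_le n (real (card {1..k}) * (real CARD('d) * (2 ^ n * (A * B) + 2 ^ n * (A * B)))) (pb k f g) z"
    unfolding pb_def
    by (intro derivs_le_sum u smooth_all_sum smooth_all_diff smooth_all_mult smooth_px smooth_pv s finite_atLeastAtMost)
  then show ?thesis by (simp only: card_atLeastAtMost diff_Suc_1 diff_Suc_1')
qed

section \<open>The seminorms of a single summand\<close>

lemma finite_directions: "finite (directions k :: (nat \<times> 'd::finite phase) set)"
  unfolding directions_def by simp

lemma lists_directions_subset: "lists (directions k) \<subseteq> lists (UNIV \<times> (Basis :: 'd::finite phase set))"
  unfolding directions_def by (rule lists_mono) blast

text \<open>A real supremum carries information only for sets bounded above. There are finitely many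
  multi-indices up to order \<open>n\<close>, and each derivative is continuous on the compact
  \<open>K\<close>.\<close>

lemma g_seminorm_bdd:
  fixes f :: "'d::finite kfun"
  assumes "smooth_all f" "compact K"
  shows "bdd_above ((\<lambda>(\<alpha>, z). \<bar>partials \<alpha> f z\<bar>) ` ({\<alpha> \<in> lists (directions k). length \<alpha> \<le> n} \<times> K))"
proof -
  let ?L = "{\<alpha> \<in> lists (directions k :: (nat \<times> 'd phase) set). length \<alpha> \<le> n}"
  have "?L = {xs. set xs \<subseteq> directions k \<and> length xs \<le> n}" by (auto simp: lists_eq_set)
  then have fin: "finite ?L" using finite_lists_length_le[OF finite_directions] by simp
  have "bdd_above ((\<lambda>z. \<bar>partials \<alpha> f z\<bar>) ` K)" if "\<alpha> \<in> ?L" for \<alpha>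
  proof -
    have "\<alpha> \<in> lists (UNIV \<times> Basis)" using that lists_directions_subset by blast
    then have "continuous_on UNIV (partials \<alpha> f)" by (rule smooth_all_continuous[OF smooth_all_partials[OF assms(1)]])
    then have "continuous_on K (\<lambda>z. \<bar>partials \<alpha> f z\<bar>)"
      by (intro continuous_on_rabs) (rule continuous_on_subset, auto)
    then have "compact ((\<lambda>z. \<bar>partials \<alpha> f z\<bar>) ` K)" using assms(2) by (rule compact_continuous_image)
    then show ?thesis by (intro bounded_imp_bdd_above compact_imp_bounded)
  qed
  then have "bdd_above (\<Union>\<alpha>\<in>?L. (\<lambda>z. \<bar>partials \<alpha> f z\<bar>) ` K)" using fin by (simp add: bdd_above_UN)
  moreover have "(\<lambda>(\<alpha>, z). \<bar>partials \<alpha> f z\<bar>) ` (?L \<times> K) = (\<Union>\<alpha>\<in>?L. (\<lambda>z. \<bar>partials \<alpha> f z\<bar>) ` K)"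
    unfolding Sigma_def image_UN by auto
  ultimately show ?thesis by simp
qed

lemma g_seminorm_derivs_le:
  assumes f: "f \<in> g_space k" and "compact K" "z \<in> K"
  shows "derivs_le n (g_seminorm k n K f) f z"
  unfolding derivs_le_def
proof (intro ballI impI)
  note bdd = g_seminorm_bdd[OF g_space_smooth[OF f] assms(2)]
  have *: "\<bar>partials \<alpha> f z\<bar> \<le> g_seminorm k n K f" if "\<alpha> \<in> lists (directions k)" "length \<alpha> \<le> n" for \<alpha>
    using cSUP_upper[OF _ bdd, of "(\<alpha>, z)"] that assms(3) unfolding g_seminorm_def by simp
  fix \<alpha> :: "(nat \<times> 'a phase) list" assume a: "\<alpha> \<in> lists (UNIV \<times> Basis)" "length \<alpha> \<le> n"
  show "\<bar>partials \<alpha> f z\<bar> \<le> g_seminorm k n K f"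
  proof (cases "\<alpha> \<in> lists (directions k)")
    case False
    \<comment> \<open>The derivative in question is zero; the empty multi-index serves to show that
      the seminorm is nonnegative.\<close>
    have "\<bar>partials [] f z\<bar> \<le> g_seminorm k n K f" by (rule *) auto
    then show ?thesis
      unfolding partials_depends_on_first[OF g_space_depends[OF f] a(1) False] by simp
  qed (use * a in blast)
qed

lemma g_seminorm_le:
  fixes f :: "'d::finite kfun"
  assumes "K \<noteq> {}" "\<And>z. z \<in> K \<Longrightarrow> derivs_le n C f z"
  shows "g_seminorm k n K f \<le> C"
  unfolding g_seminorm_def
proof (rule cSUP_least)
  obtain z where "z \<in> K" using assms(1) by blast
  then have "([], z) \<in> {\<alpha> \<in> lists (directions k). length \<alpha> \<le> n} \<times> K" by simp
  then show "{\<alpha> \<in> lists (directions k). length \<alpha> \<le> n} \<times> K \<noteq> {}" by blast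
next
  fix x :: "(nat \<times> 'd phase) list \<times> (nat \<Rightarrow> 'd phase)" assume "x \<in> {\<alpha> \<in> lists (directions k). length \<alpha> \<le> n} \<times> K"
  then obtain \<alpha> :: "(nat \<times> 'd phase) list" and z where x: "x = (\<alpha>, z)" "\<alpha> \<in> lists (directions k)" "length \<alpha> \<le> n" "z \<in> K" by blast
  have "\<bar>partials \<alpha> f z\<bar> \<le> C"
    by (rule derivs_leD[OF assms(2)[OF x(4)] _ x(3)]) (use x(2) lists_directions_subset in blast)
  then show "(case x of (\<alpha>, z) \<Rightarrow> \<bar>partials \<alpha> f z\<bar>) \<le> C" using x(1) by simp
qed

lemma g_seminorm_zero: "K \<noteq> {} \<Longrightarrow> compact K \<Longrightarrow> g_seminorm k n K 0 = 0"
  by (intro antisym g_seminorm_le derivs_le_zero)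
    (use derivs_le_nonneg[OF g_seminorm_derivs_le] subspace_0[OF subspace_g_space] in blast)+

lemma g_seminorm_nonneg: "f \<in> g_space k \<Longrightarrow> K \<noteq> {} \<Longrightarrow> compact K \<Longrightarrow> g_seminorm k n K f \<ge> 0"
  using derivs_le_nonneg[OF g_seminorm_derivs_le] by blast

lemma g_seminorm_mono:
  assumes "f \<in> g_space k" "K \<noteq> {}" "compact K'" "K \<subseteq> K'" "n \<le> n'"
  shows "g_seminorm k n K f \<le> g_seminorm k n' K' f"
proof (rule g_seminorm_le[OF assms(2)])
  fix z assume "z \<in> K"
  then have "z \<in> K'" using assms(4) by blast
  from g_seminorm_derivs_le[OF assms(1,3) this, of n'] show "derivs_le n (g_seminorm k n' K' f) f z"
    by (rule derivs_le_mono[OF _ assms(5) order_refl])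
qed

lemma seminorm_on_g_seminorm:
  assumes K: "K \<noteq> {}" "compact K"
  shows "seminorm_on (g_space k) (g_seminorm k n K)"
  unfolding seminorm_on_def
proof (intro conjI ballI allI)
  fix f g :: "'a kfun" assume f: "f \<in> g_space k" and g: "g \<in> g_space k"
  show "g_seminorm k n K (f + g) \<le> g_seminorm k n K f + g_seminorm k n K g"
    by (intro g_seminorm_le[OF K(1)] derivs_le_add g_space_smooth[OF f] g_space_smooth[OF g]
        g_seminorm_derivs_le[OF f K(2)] g_seminorm_derivs_le[OF g K(2)])
next
  fix c and f :: "'a kfun" assume f: "f \<in> g_space k"
  have le: "g_seminorm k n K (c *\<^sub>R f) \<le> \<bar>c\<bar> * g_seminorm k n K f" if f: "f \<in> g_space k" for c and f :: "'a kfun"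
    by (intro g_seminorm_le[OF K(1)] derivs_le_scaleR g_space_smooth[OF f] g_seminorm_derivs_le[OF f K(2)])
  show "g_seminorm k n K (c *\<^sub>R f) = \<bar>c\<bar> * g_seminorm k n K f"
  proof (cases "c = 0")
    case True
    then show ?thesis using g_seminorm_zero[OF K] by (simp only: scaleR_zero_left abs_zero mult_zero_left)
  next
    case False
    \<comment> \<open>Equality follows from the one-sided estimate, applied to \<open>c\<close> and
      to its inverse.\<close>
    have "g_seminorm k n K ((1 / c) *\<^sub>R (c *\<^sub>R f)) \<le> \<bar>1 / c\<bar> * g_seminorm k n K (c *\<^sub>R f)"
      by (rule le[OF subspace_scale[OF subspace_g_space f]])
    moreover have "(1 / c) *\<^sub>R (c *\<^sub>R f) = f" using False by simp
    ultimately have "g_seminorm k n K f \<le> \<bar>1 / c\<bar> * g_seminorm k n K (c *\<^sub>R f)" by (simp only:)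
    then have "\<bar>c\<bar> * g_seminorm k n K f \<le> g_seminorm k n K (c *\<^sub>R f)"
      using False by (simp add: abs_divide pos_le_divide_eq mult.commute)
    then show ?thesis using le[OF f, of c] by linarith
  qed
qed

abbreviation g_seminorms :: "nat \<Rightarrow> ('d::finite kfun \<Rightarrow> real) set" where
  "g_seminorms k \<equiv> {g_seminorm k n K | n K. compact K \<and> K \<noteq> {}}"

lemma seminorm_family_g_space:
  "seminorm_family (g_space k :: 'd::finite kfun set) (g_seminorms k)"
proof
  show "subspace (g_space k :: 'd kfun set)" by (rule subspace_g_space)
  have "compact {0 :: nat \<Rightarrow> 'd phase}" by simp
  then show "{g_seminorm k n K | n K :: (nat \<Rightarrow> 'd phase) set. compact K \<and> K \<noteq> {}} \<noteq> {}" by blast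
  fix p :: "'d kfun \<Rightarrow> real" assume "p \<in> g_seminorms k"
  then obtain n K where p: "p = g_seminorm k n K" "compact K" "K \<noteq> {}" by blast
  show "seminorm_on (g_space k) p" unfolding p(1) by (rule seminorm_on_g_seminorm[OF p(3,2)])
  fix q :: "'d kfun \<Rightarrow> real" assume "q \<in> g_seminorms k"
  then obtain m L where q: "q = g_seminorm k m L" "compact L" "L \<noteq> {}" by blast
  have KL: "compact (K \<union> L)" "K \<union> L \<noteq> {}" using p q compact_Un by auto
  show "\<exists>s\<in>g_seminorms k. \<forall>x\<in>g_space k. p x \<le> s x \<and> q x \<le> s x"
  \<comment> \<open>Orders are merged by maximum and compact sets by union.\<close>
  proof (rule bexI[of _ "g_seminorm k (max n m) (K \<union> L)"])
    show "g_seminorm k (max n m) (K \<union> L) \<in> g_seminorms k" using KL by blast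
    show "\<forall>x\<in>g_space k. p x \<le> g_seminorm k (max n m) (K \<union> L) x \<and> q x \<le> g_seminorm k (max n m) (K \<union> L) x"
      unfolding p(1) q(1) by (intro ballI conjI g_seminorm_mono KL(1) p(3) q(3)) auto
  qed
qed

lemma continuous_on_comp_right: "continuous_on S (\<lambda>z. z \<circ> (\<rho> :: nat \<Rightarrow> nat) :: nat \<Rightarrow> 'a::topological_space)"
  unfolding comp_def
  by (rule continuous_on_coordinatewise_then_product) (rule continuous_on_subset[OF continuous_on_product_coordinates], simp)

text \<open>Symmetrization and the representative evaluate \<open>f\<close> and \<open>g\<close> at
  permuted points, so \<open>K\<close> grows to the union of its permuted copies; the bracket costs
  one derivative.\<close>

lemma g_seminorm_beta_le:
  fixes K :: "(nat \<Rightarrow> 'd::finite phase) set"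
  assumes lj: "1 \<le> l" "1 \<le> j" and K: "compact K" "K \<noteq> {}"
  obtains C K' where "C \<ge> 0" "compact K'" "K' \<noteq> {}"
    "\<And>f g. f \<in> g_space l \<Longrightarrow> g \<in> g_space j \<Longrightarrow>
      g_seminorm (l + j - 1) n K (beta l j f g) \<le> C * (g_seminorm l (Suc n) K' f * g_seminorm j (Suc n) K' g)"
proof -
  let ?k = "l + j - 1"
  define K' where "K' = (\<Union>\<sigma>\<in>perms ?k. (\<lambda>z. z \<circ> \<sigma>) ` K)"
  \<comment> \<open>The averaging factor cancels against the number of permutations, so only the
    weight \<open>l j\<close> and the constant of \<open>derivs_le_pb\<close> remain.\<close>
  define C where "C = real l * real j * (real ?k * (real CARD('d) * (2 ^ n + 2 ^ n)))"
  have "compact K'"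
    unfolding K'_def by (intro compact_UN finite_perms compact_continuous_image continuous_on_comp_right K)
  have mem: "z \<circ> \<sigma> \<in> K'" if "z \<in> K" "\<sigma> permutes {1..?k}" for z \<sigma>
    unfolding K'_def using that by (intro UN_I[of \<sigma>] imageI) (simp only: mem_perms)
  obtain z0 where "z0 \<in> K" using K by blast
  then have "K' \<noteq> {}" using mem[OF _ permutes_id] by blast
  have r: "1 \<le> (1::nat)" "1 \<le> min l j" using lj by auto
  note \<rho> = rep_permutes[OF r]
  have le: "g_seminorm ?k n K (beta l j f g) \<le> C * (g_seminorm l (Suc n) K' f * g_seminorm j (Suc n) K' g)"
    if f: "f \<in> g_space l" and g: "g \<in> g_space j" for f g :: "'d kfun"
  proof (rule g_seminorm_le[OF K(2)])
    fix z assume z: "z \<in> K"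
    let ?A = "g_seminorm l (Suc n) K' f" and ?B = "g_seminorm j (Suc n) K' g"
    let ?h = "pb ?k f (act (rep l j 1) g)"
    let ?M = "real ?k * (real CARD('d) * (2 ^ n * (?A * ?B) + 2 ^ n * (?A * ?B)))"
    note sf = g_space_smooth[OF f] and sg = smooth_rep[OF g_space_smooth[OF g] r]
    have h: "derivs_le n ?M (act \<pi> ?h) z" if "\<pi> \<in> perms ?k" for \<pi>
    proof -
      have \<pi>: "\<pi> permutes {1..?k}" using that by simp
      have "derivs_le (Suc n) ?B (act (rep l j 1) g) (z \<circ> \<pi>)"
      proof (rule derivs_le_act[OF permutes_bij[OF \<rho>]])
        have "z \<circ> \<pi> \<circ> rep l j 1 \<in> K'"
          unfolding comp_assoc by (rule mem[OF z permutes_compose[OF \<rho> \<pi>]])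
        then show "derivs_le (Suc n) ?B g (z \<circ> \<pi> \<circ> rep l j 1)"
          by (rule g_seminorm_derivs_le[OF g \<open>compact K'\<close>])
      qed
      then have "derivs_le n ?M ?h (z \<circ> \<pi>)"
        by (rule derivs_le_pb[OF sf sg g_seminorm_derivs_le[OF f \<open>compact K'\<close> mem[OF z \<pi>]]])
      then show ?thesis by (rule derivs_le_act[OF permutes_bij[OF \<pi>]])
    qed
    have s: "smooth_all (act \<pi> ?h)" if "\<pi> \<in> perms ?k" for \<pi>
      using that by (intro smooth_all_act smooth_pb sf sg permutes_bij) simp
    have "derivs_le n (\<bar>real l * real j\<bar> * (\<bar>1 / fact ?k\<bar> * (real (card (perms ?k)) * ?M))) (beta l j f g) z"
      unfolding beta_def overlap_bracket_def Sym_eq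
      by (intro derivs_le_scaleR derivs_le_sum smooth_all_scaleR smooth_all_sum h s finite_perms)
    moreover have "\<bar>real l * real j\<bar> * (\<bar>1 / fact ?k\<bar> * (real (card (perms ?k)) * ?M)) = C * (?A * ?B)"
      unfolding card_perms C_def by (simp add: algebra_simps)
    ultimately show "derivs_le n (C * (?A * ?B)) (beta l j f g) z" by (simp only:)
  qed
  show ?thesis
    by (rule that[OF _ \<open>compact K'\<close> \<open>K' \<noteq> {}\<close> le]) (simp_all add: C_def)
qed

section \<open>Continuous seminorms on the direct sum\<close>

definition cont_seminorms :: "((nat \<Rightarrow> 'd::finite kfun) \<Rightarrow> real) set" where
  "cont_seminorms = {p. seminorm_on G_inf p \<and>
          (\<forall>k\<ge>1. continuous_map (g_topology k) euclideanreal (p \<circ> incl k))}"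

lemma G_inf_topology_eq: "G_inf_topology = seminorm_topology G_inf cont_seminorms"
  unfolding G_inf_topology_def cont_seminorms_def ..

lemma zero_in_g_space: "0 \<in> g_space k"
  by (rule subspace_0[OF subspace_g_space])

lemma G_inf_component: "F \<in> G_inf \<Longrightarrow> 1 \<le> k \<Longrightarrow> F k \<in> g_space k"
  and G_inf_0: "F \<in> G_inf \<Longrightarrow> F 0 = 0"
  and G_inf_finite: "F \<in> G_inf \<Longrightarrow> finite {k. F k \<noteq> 0}"
  unfolding G_inf_def by auto

lemma support_scaleR:
  fixes F :: "nat \<Rightarrow> 'd::finite kfun"
  shows "{k. c *\<^sub>R F k \<noteq> 0} \<subseteq> {k. F k \<noteq> 0}"
proof (intro subsetI CollectI notI)
  fix k assume "k \<in> {k. c *\<^sub>R F k \<noteq> 0}" "F k = 0"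
  then show False by (simp only: mem_Collect_eq scaleR_zero_right simp_thms)
qed

lemma subspace_G_inf: "subspace (G_inf :: (nat \<Rightarrow> 'd::finite kfun) set)"
  unfolding subspace_def
proof (intro conjI ballI allI)
  show "(0 :: nat \<Rightarrow> 'd kfun) \<in> G_inf"
    unfolding G_inf_def by (auto simp: zero_in_g_space)
next
  fix F G :: "nat \<Rightarrow> 'd kfun" assume F: "F \<in> G_inf" and G: "G \<in> G_inf"
  have "{k. (F + G) k \<noteq> 0} \<subseteq> {k. F k \<noteq> 0} \<union> {k. G k \<noteq> 0}"
  proof (rule subsetI, rule ccontr)
    fix k assume k: "k \<in> {k. (F + G) k \<noteq> 0}" "k \<notin> {k. F k \<noteq> 0} \<union> {k. G k \<noteq> 0}"
    then have "F k = 0" "G k = 0" by blast+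
    then have "(F + G) k = 0" unfolding plus_fun_apply[of F] by (simp only: add_0)
    then show False using k by blast
  qed
  then have "finite {k. (F + G) k \<noteq> 0}"
    by (rule finite_subset) (intro finite_UnI G_inf_finite F G)
  moreover have "(F + G) k \<in> g_space k" if "k \<ge> 1" for k
    unfolding plus_fun_apply[of F]
    by (rule subspace_add[OF subspace_g_space G_inf_component[OF F that] G_inf_component[OF G that]])
  moreover have "(F + G) 0 = 0"
    unfolding plus_fun_apply[of F] G_inf_0[OF F] G_inf_0[OF G] by (rule add_0)
  ultimately show "F + G \<in> G_inf" unfolding G_inf_def by blast
next
  fix c and F :: "nat \<Rightarrow> 'd kfun" assume F: "F \<in> G_inf"
  have e: "(c *\<^sub>R F) k = c *\<^sub>R F k" for k by (rule fun_cong[OF scaleR_fun_def])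
  have "{k. (c *\<^sub>R F) k \<noteq> 0} \<subseteq> {k. F k \<noteq> 0}"
    unfolding e by (rule support_scaleR)
  then have "finite {k. (c *\<^sub>R F) k \<noteq> 0}"
    by (rule finite_subset) (rule G_inf_finite[OF F])
  moreover have "(c *\<^sub>R F) k \<in> g_space k" if "k \<ge> 1" for k
    unfolding e by (rule subspace_scale[OF subspace_g_space G_inf_component[OF F that]])
  moreover have "(c *\<^sub>R F) 0 = 0"
    unfolding e G_inf_0[OF F] by (rule scaleR_zero_right)
  ultimately show "c *\<^sub>R F \<in> G_inf" unfolding G_inf_def by blast
qed

lemma incl_add: "incl k (f + g) = incl k f + incl k g"
  by (rule ext) (simp add: incl_def)

lemma incl_zero: "incl k 0 = 0"
  by (rule ext) (simp add: incl_def)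

lemma incl_scaleR: "incl k (c *\<^sub>R f) = c *\<^sub>R incl k f"
proof
  fix m
  have "(c *\<^sub>R incl k f) m = c *\<^sub>R incl k f m" by (rule fun_cong[OF scaleR_fun_def])
  then show "incl k (c *\<^sub>R f) m = (c *\<^sub>R incl k f) m"
    unfolding incl_def by (cases "m = k") (simp_all only: if_True if_False scaleR_zero_right simp_thms(6))
qed

lemma incl_diff: "incl k (f - g) = incl k f - incl k g"
  by (rule ext) (simp add: incl_def)

lemma incl_sum: "incl k (sum f A) = (\<Sum>x\<in>A. incl k (f x))"
proof (induction A rule: infinite_finite_induct)
  case (insert x A)
  then show ?case by (simp only: sum.insert[OF insert.hyps(1,2)] incl_add)
qed (simp_all only: sum.infinite sum.empty incl_zero not_False_eq_True)

lemma incl_in_G_inf: "1 \<le> k \<Longrightarrow> f \<in> g_space k \<Longrightarrow> incl k f \<in> G_inf"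
  unfolding G_inf_def
proof (intro CollectI conjI allI impI)
  assume k: "1 \<le> k" and f: "f \<in> g_space k"
  show "incl k f 0 = 0" using k by (simp add: incl_def)
  show "incl k f m \<in> g_space m" if "1 \<le> m" for m
    using f zero_in_g_space unfolding incl_def by (cases "m = k") simp_all
  have "{m. incl k f m \<noteq> 0} \<subseteq> {k}" by (auto simp: incl_def)
  then show "finite {m. incl k f m \<noteq> 0}" by (rule finite_subset) simp
qed

lemma cont_seminorms_seminorm: "p \<in> cont_seminorms \<Longrightarrow> seminorm_on G_inf p"
  unfolding cont_seminorms_def by blast

lemma seminorm_on_incl:
  assumes "seminorm_on G_inf p" "1 \<le> k"
  shows "seminorm_on (g_space k) (p \<circ> incl k)"
  using assms(1) incl_in_G_inf[OF assms(2)] unfolding seminorm_on_def comp_apply incl_add incl_scaleR by blast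

lemma cont_seminorms_zero: "(\<lambda>_. 0) \<in> cont_seminorms"
  unfolding cont_seminorms_def seminorm_on_def comp_def by simp

lemma cont_seminorms_add:
  fixes p q :: "(nat \<Rightarrow> 'd::finite kfun) \<Rightarrow> real"
  assumes "p \<in> cont_seminorms" "q \<in> cont_seminorms"
  shows "(\<lambda>x. p x + q x) \<in> cont_seminorms"
proof -
  have "continuous_map (g_topology k) euclideanreal ((\<lambda>x. p x + q x) \<circ> incl k)" if "1 \<le> k" for k
    using continuous_map_add[of "g_topology k" "p \<circ> incl k" "q \<circ> incl k"] assms that unfolding cont_seminorms_def comp_def by blast
  moreover have "seminorm_on G_inf (\<lambda>x. p x + q x)"
    unfolding seminorm_on_def
  proof (intro conjI ballI allI)
    fix x y :: "nat \<Rightarrow> 'd kfun" assume x: "x \<in> G_inf" and y: "y \<in> G_inf"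
    have "p (x + y) \<le> p x + p y" "q (x + y) \<le> q x + q y"
      using assms[THEN cont_seminorms_seminorm] x y unfolding seminorm_on_def by blast+
    then show "p (x + y) + q (x + y) \<le> p x + q x + (p y + q y)" by linarith
  next
    fix c and x :: "nat \<Rightarrow> 'd kfun" assume x: "x \<in> G_inf"
    show "p (c *\<^sub>R x) + q (c *\<^sub>R x) = \<bar>c\<bar> * (p x + q x)"
      using seminorm_on_scaleR[OF cont_seminorms_seminorm[OF assms(1)] x] seminorm_on_scaleR[OF cont_seminorms_seminorm[OF assms(2)] x]
      by (simp only: distrib_left)
  qed
  ultimately show ?thesis unfolding cont_seminorms_def by blast
qed

lemma cont_seminorms_sum:
  assumes "\<And>i. i \<in> A \<Longrightarrow> q i \<in> cont_seminorms"
  shows "(\<lambda>x. \<Sum>i\<in>A. q i x) \<in> cont_seminorms"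
  using assms
proof (induction A rule: infinite_finite_induct)
  case (insert i A)
  then show ?case using cont_seminorms_add[of "q i" "\<lambda>x. \<Sum>i\<in>A. q i x"] by simp
qed (simp_all add: cont_seminorms_zero)

lemma seminorm_family_G_inf: "seminorm_family (G_inf :: (nat \<Rightarrow> 'd::finite kfun) set) cont_seminorms"
proof
  fix p q :: "(nat \<Rightarrow> 'd kfun) \<Rightarrow> real" assume p: "p \<in> cont_seminorms"
  show "seminorm_on G_inf p" using p by (rule cont_seminorms_seminorm)
  assume q: "q \<in> cont_seminorms"
  show "\<exists>s\<in>cont_seminorms. \<forall>x\<in>G_inf. p x \<le> s x \<and> q x \<le> s x"
    using cont_seminorms_add[OF p q] seminorm_on_nonneg[OF cont_seminorms_seminorm[OF p] subspace_G_inf]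
      seminorm_on_nonneg[OF cont_seminorms_seminorm[OF q] subspace_G_inf] by (intro bexI[of _ "\<lambda>x. p x + q x"]) auto
qed (use subspace_G_inf cont_seminorms_zero in blast)+

interpretation G: seminorm_family "G_inf :: (nat \<Rightarrow> 'd::finite kfun) set" cont_seminorms
  by (rule seminorm_family_G_inf)

lemma cont_seminorms_nonneg: "p \<in> cont_seminorms \<Longrightarrow> F \<in> G_inf \<Longrightarrow> p F \<ge> 0"
  by (rule G.nonneg)

lemma cont_seminorms_sum_le:
  assumes "p \<in> cont_seminorms" "\<And>x. x \<in> A \<Longrightarrow> f x \<in> G_inf"
  shows "p (sum f A) \<le> (\<Sum>x\<in>A. p (f x))"
  using assms(2)
proof (induction A rule: infinite_finite_induct)
  case (insert x A)
  have "p (f x + sum f A) \<le> p (f x) + p (sum f A)"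
    using insert.prems by (intro G.triangle[OF assms(1)] subspace_sum subspace_G_inf) blast+
  also have "p (sum f A) \<le> (\<Sum>x\<in>A. p (f x))" using insert by blast
  finally show ?case unfolding sum.insert[OF insert.hyps(1,2)] by (simp only: add_left_mono)
qed (simp_all add: G.zero[OF assms(1)] del: zero_fun_apply)

text \<open>Continuity on a summand, which is abstract in the definition of the topology, becomes an
  estimate by one defining seminorm.\<close>

lemma cont_seminorms_incl_bound:
  assumes "p \<in> cont_seminorms" "1 \<le> k"
  obtains C n K where "C \<ge> 0" "compact K" "K \<noteq> {}" "\<And>f. f \<in> g_space k \<Longrightarrow> p (incl k f) \<le> C * g_seminorm k n K f"
proof -
  interpret g: seminorm_family "g_space k" "g_seminorms k"
    by (rule seminorm_family_g_space)
  have "continuous_map g.T euclideanreal (p \<circ> incl k)"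
    using assms unfolding cont_seminorms_def g_topology_def by blast
  then show ?thesis
  proof (rule g.continuous_seminorm_bound[OF seminorm_on_incl[OF cont_seminorms_seminorm[OF assms(1)] assms(2)]])
    fix s C assume s: "s \<in> g_seminorms k" "C \<ge> 0"
      "\<And>f. f \<in> g_space k \<Longrightarrow> (p \<circ> incl k) f \<le> C * s f"
    obtain n K where nK: "s = g_seminorm k n K" "compact K" "K \<noteq> {}" using s(1) by blast
    show ?thesis by (rule that[OF s(2) nK(2,3) s(3)[unfolded nK(1) comp_apply]])
  qed
qed

text \<open>Weights, orders and compact sets may vary freely with the component; this freedom is
  what detects unbounded supports in \<open>bounded_support\<close>. On \<open>G_inf\<close> the sum
  is finite.\<close>

definition weighted_seminorm :: "(nat \<Rightarrow> real) \<Rightarrow> (nat \<Rightarrow> nat) \<Rightarrow> (nat \<Rightarrow> (nat \<Rightarrow> 'd phase) set) \<Rightarrow>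
    (nat \<Rightarrow> 'd::finite kfun) \<Rightarrow> real" where
  "weighted_seminorm a n K F = (\<Sum>j | F j \<noteq> 0. a j * g_seminorm j (n j) (K j) (F j))"

context
  fixes a :: "nat \<Rightarrow> real" and n :: "nat \<Rightarrow> nat" and K :: "nat \<Rightarrow> (nat \<Rightarrow> 'd::finite phase) set"
  assumes a: "\<And>j. a j \<ge> 0" and K: "\<And>j. compact (K j)" "\<And>j. K j \<noteq> {}"
begin

text \<open>The supports of two sequences and of their sum differ, so comparing the three values
  needs a common index set; extra indices contribute the seminorm of zero.\<close>

lemma weighted_seminorm_superset:
  assumes "finite S" "{j. F j \<noteq> 0} \<subseteq> S"
  shows "weighted_seminorm a n K F = (\<Sum>j\<in>S. a j * g_seminorm j (n j) (K j) (F j))"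
  unfolding weighted_seminorm_def
  by (rule sum.mono_neutral_left[OF assms]) (use g_seminorm_zero[OF K(2,1)] in auto)

text \<open>Restricted to one summand it is a multiple of a single defining seminorm, hence
  continuous there.\<close>

lemma weighted_seminorm_in_PG: "weighted_seminorm a n K \<in> cont_seminorms"
proof -
  have sn: "seminorm_on (g_space j) (g_seminorm j (n j) (K j))" for j
    by (rule seminorm_on_g_seminorm[OF K(2,1)])
  have s: "seminorm_on G_inf (weighted_seminorm a n K)"
    unfolding seminorm_on_def
  proof (intro conjI ballI allI)
    fix F G :: "nat \<Rightarrow> 'd kfun" assume F: "F \<in> G_inf" and G: "G \<in> G_inf"
    let ?S = "{j. F j \<noteq> 0} \<union> {j. G j \<noteq> 0} \<union> {j. (F + G) j \<noteq> 0}"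
    have fin: "finite ?S" by (intro finite_UnI G_inf_finite F G subspace_add[OF subspace_G_inf F G])
    have "a j * g_seminorm j (n j) (K j) ((F + G) j) \<le>
        a j * g_seminorm j (n j) (K j) (F j) + a j * g_seminorm j (n j) (K j) (G j)" for j
    proof (cases "j = 0")
      case True
      show ?thesis
        unfolding True G_inf_0[OF F] G_inf_0[OF G] G_inf_0[OF subspace_add[OF subspace_G_inf F G]]
          g_seminorm_zero[OF K(2,1)] by simp
    next
      case False
      then have "F j \<in> g_space j" "G j \<in> g_space j" using F G by (auto intro: G_inf_component)
      then have "g_seminorm j (n j) (K j) (F j + G j) \<le> g_seminorm j (n j) (K j) (F j) + g_seminorm j (n j) (K j) (G j)"
        using sn unfolding seminorm_on_def by blast
      from mult_left_mono[OF this a] show ?thesis unfolding plus_fun_apply[of F] by (simp only: distrib_left)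
    qed
    then have "(\<Sum>j\<in>?S. a j * g_seminorm j (n j) (K j) ((F + G) j)) \<le>
        (\<Sum>j\<in>?S. a j * g_seminorm j (n j) (K j) (F j)) + (\<Sum>j\<in>?S. a j * g_seminorm j (n j) (K j) (G j))"
      unfolding sum.distrib[symmetric] by (intro sum_mono)
    moreover have sub: "{j. F j \<noteq> 0} \<subseteq> ?S" "{j. G j \<noteq> 0} \<subseteq> ?S" "{j. (F + G) j \<noteq> 0} \<subseteq> ?S"
      by (rule subset_trans[OF Un_upper1 Un_upper1] subset_trans[OF Un_upper2 Un_upper1] Un_upper2)+
    ultimately show "weighted_seminorm a n K (F + G) \<le> weighted_seminorm a n K F + weighted_seminorm a n K G"
      unfolding weighted_seminorm_superset[OF fin sub(1)] weighted_seminorm_superset[OF fin sub(2)] weighted_seminorm_superset[OF fin sub(3)] by (simp only:)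
  next
    fix c and F :: "nat \<Rightarrow> 'd kfun" assume F: "F \<in> G_inf"
    let ?S = "{j. F j \<noteq> 0}"
    have e: "(c *\<^sub>R F) j = c *\<^sub>R F j" for j by (rule fun_cong[OF scaleR_fun_def])
    have "{j. (c *\<^sub>R F) j \<noteq> 0} \<subseteq> ?S" unfolding e by (rule support_scaleR)
    then have "weighted_seminorm a n K (c *\<^sub>R F) = (\<Sum>j\<in>?S. a j * g_seminorm j (n j) (K j) ((c *\<^sub>R F) j))"
      by (rule weighted_seminorm_superset[OF G_inf_finite[OF F]])
    also have "\<dots> = (\<Sum>j\<in>?S. a j * g_seminorm j (n j) (K j) (c *\<^sub>R F j))"
      unfolding e ..
    also have "\<dots> = (\<Sum>j\<in>?S. \<bar>c\<bar> * (a j * g_seminorm j (n j) (K j) (F j)))"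
    proof (rule sum.cong[OF refl])
      fix j assume "j \<in> ?S"
      then have "j \<noteq> 0" using G_inf_0[OF F] by auto
      then have "F j \<in> g_space j" using F by (auto intro: G_inf_component)
      then have "g_seminorm j (n j) (K j) (c *\<^sub>R F j) = \<bar>c\<bar> * g_seminorm j (n j) (K j) (F j)"
        using sn unfolding seminorm_on_def by blast
      then show "a j * g_seminorm j (n j) (K j) (c *\<^sub>R F j) = \<bar>c\<bar> * (a j * g_seminorm j (n j) (K j) (F j))"
        by (simp only: mult.left_commute)
    qed
    also have "\<dots> = \<bar>c\<bar> * weighted_seminorm a n K F"
      unfolding weighted_seminorm_def by (rule sum_distrib_left[symmetric])
    finally show "weighted_seminorm a n K (c *\<^sub>R F) = \<bar>c\<bar> * weighted_seminorm a n K F" .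
  qed
  have "continuous_map (g_topology k) euclideanreal (weighted_seminorm a n K \<circ> incl k)" if k: "1 \<le> k" for k
  proof -
    interpret g: seminorm_family "g_space k :: 'd kfun set" "g_seminorms k"
      by (rule seminorm_family_g_space)
    have eq: "(weighted_seminorm a n K \<circ> incl k) f = a k * g_seminorm k (n k) (K k) f" for f :: "'d kfun"
    proof -
      have "{j. incl k f j \<noteq> 0} \<subseteq> {k}" by (auto simp: incl_def)
      from weighted_seminorm_superset[OF _ this] show ?thesis by (simp add: incl_def)
    qed
    have mem: "g_seminorm k (n k) (K k) \<in> g_seminorms k"
      by (rule CollectI, rule exI[of _ "n k"], rule exI[of _ "K k"]) (intro conjI refl K)
    show ?thesis
      unfolding g_topology_def
      by (rule g.continuous_seminorm[OF seminorm_on_incl[OF s k] mem eq_refl[OF eq] a])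
  qed
  then show ?thesis unfolding cont_seminorms_def by (intro CollectI conjI allI impI s)
qed

lemma weighted_seminorm_ge:
  assumes F: "F \<in> G_inf" and "1 \<le> k"
  shows "a k * g_seminorm k (n k) (K k) (F k) \<le> weighted_seminorm a n K F"
proof -
  let ?S = "insert k {j. F j \<noteq> 0}"
  have "a j * g_seminorm j (n j) (K j) (F j) \<ge> 0" if "j \<in> ?S" for j
  proof -
    have "j \<noteq> 0" using that G_inf_0[OF F] \<open>1 \<le> k\<close> by auto
    then show ?thesis using G_inf_component[OF F, of j] a K g_seminorm_nonneg[OF _ K(2,1)] by simp
  qed
  then have "a k * g_seminorm k (n k) (K k) (F k) \<le> (\<Sum>j\<in>?S. a j * g_seminorm j (n j) (K j) (F j))"
    using G_inf_finite[OF F] by (intro member_le_sum) auto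
  moreover have "finite ?S" using G_inf_finite[OF F] by simp
  ultimately show ?thesis using weighted_seminorm_superset[OF _ subset_insertI] by (simp only:)
qed

end

text \<open>A nonzero sequence is nonzero in some component at some point \<open>z\<close>; the
  evaluation there is dominated by the weighted seminorm of order \<open>0\<close> over the compact
  set \<open>{z}\<close>.\<close>

lemma G_inf_separated:
  assumes F: "F \<in> G_inf" and "F \<noteq> 0"
  shows "\<exists>p\<in>cont_seminorms. p F \<noteq> 0"
proof -
  obtain k where k: "F k \<noteq> 0" using assms(2) by (metis ext zero_fun_apply)
  then obtain z where z: "F k z \<noteq> 0" by (metis ext zero_fun_apply)
  have "1 \<le> k" using k G_inf_0[OF F] by (cases k) auto
  have Fk: "F k \<in> g_space k" by (rule G_inf_component[OF F \<open>1 \<le> k\<close>])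
  let ?p = "weighted_seminorm (\<lambda>_. 1) (\<lambda>_. 0) (\<lambda>_. {z})"
  have "\<bar>F k z\<bar> \<le> g_seminorm k 0 {z} (F k)"
    using derivs_leD[OF g_seminorm_derivs_le[OF Fk, of "{z}" z], of "[]"] by simp
  also have "\<dots> \<le> ?p F" using weighted_seminorm_ge[of "\<lambda>_. 1" "\<lambda>_. {z}" F k "\<lambda>_. 0"] F \<open>1 \<le> k\<close> by simp
  finally have "?p F \<noteq> 0" using z by auto
  moreover have "?p \<in> cont_seminorms" by (rule weighted_seminorm_in_PG) auto
  ultimately show ?thesis by blast
qed

text \<open>If the supports were not uniformly bounded, pick for each index \<open>k\<close> of the union of the supports a
  member with nonzero \<open>k\<close>-th component at some point and weigh the evaluations there so that this member
  has seminorm at least \<open>k\<close>.\<close>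

lemma bounded_support:
  assumes B: "B \<subseteq> G_inf" and bd: "\<And>p. p \<in> cont_seminorms \<Longrightarrow> \<exists>C. \<forall>F\<in>B. p F \<le> C"
  obtains M where "\<And>F k. F \<in> B \<Longrightarrow> F k \<noteq> 0 \<Longrightarrow> k \<in> {1..M}"
proof -
  define S where "S = {k. \<exists>F\<in>B. F k \<noteq> 0}"
  have "\<exists>F z. k \<in> S \<longrightarrow> F \<in> B \<and> F k z \<noteq> 0" for k
  proof (cases "k \<in> S")
    case True
    then obtain F where F: "F \<in> B" "F k \<noteq> 0" unfolding S_def by blast
    then obtain z where "F k z \<noteq> 0" by (metis ext zero_fun_apply)
    then show ?thesis using F by blast
  qed blast
  then obtain Fc zc where c: "\<And>k. k \<in> S \<Longrightarrow> Fc k \<in> B" "\<And>k. k \<in> S \<Longrightarrow> Fc k k (zc k) \<noteq> 0" by metis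
  let ?a = "\<lambda>k. real k / \<bar>Fc k k (zc k)\<bar>"
  let ?p = "weighted_seminorm ?a (\<lambda>_. 0) (\<lambda>k. {zc k})"
  have "?p \<in> cont_seminorms" by (rule weighted_seminorm_in_PG) auto
  then obtain C where C: "\<forall>F\<in>B. ?p F \<le> C" using bd by blast
  have S0: "1 \<le> k" if "k \<in> S" for k
  proof (rule ccontr)
    assume "\<not> 1 \<le> k"
    then have "k = 0" by simp
    then show False using that G_inf_0 B unfolding S_def by blast
  qed
  have "real k \<le> C" if k: "k \<in> S" for k
  proof -
    have F: "Fc k \<in> G_inf" using c(1)[OF k] B by blast
    have "\<bar>Fc k k (zc k)\<bar> \<le> g_seminorm k 0 {zc k} (Fc k k)"
      using derivs_leD[OF g_seminorm_derivs_le[OF G_inf_component[OF F S0[OF k]], of "{zc k}" "zc k"], of "[]"] by simp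
    then have "?a k * \<bar>Fc k k (zc k)\<bar> \<le> ?a k * g_seminorm k 0 {zc k} (Fc k k)" by (rule mult_left_mono) simp
    also have "\<dots> \<le> ?p (Fc k)" by (rule weighted_seminorm_ge[of ?a "\<lambda>k. {zc k}", OF _ _ _ F S0[OF k]]) auto
    also have "\<dots> \<le> C" using C c(1)[OF k] by blast
    finally show ?thesis using c(2)[OF k] by simp
  qed
  then have le: "k \<le> nat \<lceil>C\<rceil>" if "k \<in> S" for k
    using order_trans[OF _ real_nat_ceiling_ge] that by (simp only: of_nat_le_iff[where 'a = real, symmetric])
  show ?thesis
  proof (rule that[of "nat \<lceil>C\<rceil>"])
    fix F k assume "F \<in> B" "F k \<noteq> 0"
    then have "k \<in> S" unfolding S_def by blast
    then show "k \<in> {1..nat \<lceil>C\<rceil>}" using S0 le by simp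
  qed
qed

section \<open>The limiting Lie bracket\<close>

text \<open>An explicit form that carries all algebra and estimates; \<open>bracket_inf\<close>,
  defined through limits, is identified with it in \<open>bracket_inf_eq\<close>.\<close>

definition lie_bracket :: "(nat \<Rightarrow> 'd::finite kfun) \<Rightarrow> (nat \<Rightarrow> 'd kfun) \<Rightarrow> nat \<Rightarrow> 'd kfun" where
  "lie_bracket F G k = (\<Sum>x\<in>pairs k. beta (fst x) (snd x) (F (fst x)) (G (snd x)))"

lemma pairsD: "x \<in> pairs k \<Longrightarrow> 1 \<le> fst x" "x \<in> pairs k \<Longrightarrow> 1 \<le> snd x" "x \<in> pairs k \<Longrightarrow> fst x + snd x - 1 = k"
  unfolding pairs_def by auto

lemma beta_zero_left: "beta l j 0 g = 0"
  using beta_scaleR_left[OF zero_in_g_space, of l j 0 g] by (simp only: scaleR_zero_left)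

lemma beta_zero_right: "1 \<le> l \<Longrightarrow> 1 \<le> j \<Longrightarrow> beta l j f 0 = 0"
  using beta_scaleR_right[OF zero_in_g_space, of l j f 0] by (simp only: scaleR_zero_left)

lemma beta_sum_right:
  assumes "\<And>x. x \<in> A \<Longrightarrow> u x \<in> g_space j" "1 \<le> l" "1 \<le> j"
  shows "beta l j f (sum u A) = (\<Sum>x\<in>A. beta l j f (u x))"
  using assms(1)
proof (induction A rule: infinite_finite_induct)
  case (insert x A)
  have "beta l j f (u x + sum u A) = beta l j f (u x) + beta l j f (sum u A)"
    using insert.prems by (intro beta_add_right assms(2,3) subspace_sum subspace_g_space) blast+
  also have "beta l j f (sum u A) = (\<Sum>x\<in>A. beta l j f (u x))" using insert by blast
  finally show ?case unfolding sum.insert[OF insert.hyps(1,2)] .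
qed (simp_all only: sum.infinite sum.empty beta_zero_right assms(2,3) not_False_eq_True)

lemma beta_pairs_in_g_space:
  assumes "F \<in> G_inf" "G \<in> G_inf" "x \<in> pairs k"
  shows "beta (fst x) (snd x) (F (fst x)) (G (snd x)) \<in> g_space k"
  using beta_in_g_space[OF G_inf_component[OF assms(1) pairsD(1)[OF assms(3)]]
      G_inf_component[OF assms(2) pairsD(2)[OF assms(3)]] pairsD(1,2)[OF assms(3)]]
  unfolding pairsD(3)[OF assms(3)] .

lemma lie_bracket_in_g_space:
  "F \<in> G_inf \<Longrightarrow> G \<in> G_inf \<Longrightarrow> lie_bracket F G k \<in> g_space k"
  unfolding lie_bracket_def by (intro subspace_sum subspace_g_space beta_pairs_in_g_space)

text \<open>The sums over all components are regrouped into one finite double sum of included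
  pieces. \<open>L\<close> and \<open>J\<close> may be larger than the supports, so that one
  \<open>L\<close> can serve a whole bounded set.\<close>

lemma lie_bracket_eq_sum:
  assumes "finite L" "finite J" "\<And>l. F l \<noteq> 0 \<Longrightarrow> l \<in> L" "\<And>j. G j \<noteq> 0 \<Longrightarrow> j \<in> J" "\<And>l. l \<in> L \<Longrightarrow> 1 \<le> l"
    "\<And>j. j \<in> J \<Longrightarrow> 1 \<le> j"
  shows "lie_bracket F G = (\<Sum>l\<in>L. \<Sum>j\<in>J. incl (l + j - 1) (beta l j (F l) (G j)))"
proof
  fix k
  let ?b = "\<lambda>x. beta (fst x) (snd x) (F (fst x)) (G (snd x))"
  have "(\<Sum>l\<in>L. \<Sum>j\<in>J. incl (l + j - 1) (beta l j (F l) (G j))) k =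
      (\<Sum>x\<in>L \<times> J. if fst x + snd x - 1 = k then ?b x else 0)"
    unfolding sum_fun_apply[of _ _ k] sum.cartesian_product case_prod_unfold incl_def
    by (intro sum.cong refl if_cong) auto
  also have "\<dots> = (\<Sum>x\<in>{x \<in> L \<times> J. fst x + snd x - 1 = k}. ?b x)"
    using assms(1,2) by (intro sum.inter_filter[symmetric]) simp
  also have "\<dots> = (\<Sum>x\<in>pairs k. ?b x)"
  proof (rule sum.mono_neutral_left)
    show "{x \<in> L \<times> J. fst x + snd x - 1 = k} \<subseteq> pairs k"
      using assms(5,6) by (auto simp: pairs_def)
    show "\<forall>x\<in>pairs k - {x \<in> L \<times> J. fst x + snd x - 1 = k}. ?b x = 0"
    proof
      fix x assume x: "x \<in> pairs k - {x \<in> L \<times> J. fst x + snd x - 1 = k}"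
      then have p: "x \<in> pairs k" by blast
      then have "fst x \<notin> L \<or> snd x \<notin> J" using x pairsD(3)[OF p] by (auto simp: mem_Times_iff)
      then have "F (fst x) = 0 \<or> G (snd x) = 0" using assms(3,4) by blast
      then show "?b x = 0"
      proof
        assume "F (fst x) = 0"
        then show ?thesis by (simp only: beta_zero_left)
      next
        assume "G (snd x) = 0"
        then show ?thesis by (simp only: beta_zero_right[OF pairsD(1,2)[OF p]])
      qed
    qed
  qed simp
  finally show "lie_bracket F G k = (\<Sum>l\<in>L. \<Sum>j\<in>J. incl (l + j - 1) (beta l j (F l) (G j))) k"
    unfolding lie_bracket_def by (rule sym)
qed

lemma G_inf_support_ge: "F \<in> G_inf \<Longrightarrow> l \<in> {l. F l \<noteq> 0} \<Longrightarrow> 1 \<le> l"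
  using G_inf_0[of F] by (cases l) auto

lemma incl_beta_in_G_inf:
  assumes "F \<in> G_inf" "G \<in> G_inf" "1 \<le> l" "1 \<le> j"
  shows "incl (l + j - 1) (beta l j (F l) (G j)) \<in> G_inf"
proof (rule incl_in_G_inf)
  show "1 \<le> l + j - 1" using assms(3,4) by simp
  show "beta l j (F l) (G j) \<in> g_space (l + j - 1)"
    by (rule beta_in_g_space[OF G_inf_component[OF assms(1,3)] G_inf_component[OF assms(2,4)] assms(3,4)])
qed

lemma lie_bracket_in_G_inf:
  assumes F: "F \<in> G_inf" and G: "G \<in> G_inf"
  shows "lie_bracket F G \<in> G_inf"
proof -
  have "lie_bracket F G = (\<Sum>l | F l \<noteq> 0. \<Sum>j | G j \<noteq> 0. incl (l + j - 1) (beta l j (F l) (G j)))"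
    by (rule lie_bracket_eq_sum[OF G_inf_finite[OF F] G_inf_finite[OF G]])
      (use G_inf_support_ge[OF F] G_inf_support_ge[OF G] in blast)+
  also have "\<dots> \<in> G_inf"
    by (intro subspace_sum subspace_G_inf incl_beta_in_G_inf F G G_inf_support_ge[OF F] G_inf_support_ge[OF G])
  finally show ?thesis .
qed

lemma lie_bracket_antisym:
  assumes F: "F \<in> G_inf" and G: "G \<in> G_inf"
  shows "lie_bracket F G = - lie_bracket G F"
proof
  fix k
  have "lie_bracket F G k = (\<Sum>x\<in>pairs k. - beta (snd x) (fst x) (G (snd x)) (F (fst x)))"
    unfolding lie_bracket_def
  proof (rule sum.cong[OF refl])
    fix x assume x: "x \<in> pairs k"
    show "beta (fst x) (snd x) (F (fst x)) (G (snd x)) = - beta (snd x) (fst x) (G (snd x)) (F (fst x))"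
      by (rule beta_antisym[OF G_inf_component[OF F] G_inf_component[OF G]]) (use pairsD[OF x] in auto)
  qed
  also have "\<dots> = - (\<Sum>x\<in>pairs k. beta (snd x) (fst x) (G (snd x)) (F (fst x)))" by (rule sum_negf)
  also have "(\<Sum>x\<in>pairs k. beta (snd x) (fst x) (G (snd x)) (F (fst x))) = lie_bracket G F k"
    unfolding lie_bracket_def
    by (rule sum.reindex_bij_witness[of _ prod.swap prod.swap]) (auto simp: pairs_def)
  finally show "lie_bracket F G k = (- lie_bracket G F) k" unfolding fun_Compl_def .
qed

lemma lie_bracket_add_left:
  assumes "F \<in> G_inf" "F' \<in> G_inf"
  shows "lie_bracket (F + F') G = lie_bracket F G + lie_bracket F' G"
proof
  fix k
  show "lie_bracket (F + F') G k = (lie_bracket F G + lie_bracket F' G) k"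
    unfolding plus_fun_apply[of "lie_bracket F G"] lie_bracket_def plus_fun_apply[of F] sum.distrib[symmetric]
    by (rule sum.cong[OF refl], rule beta_add_left) (use assms pairsD in \<open>auto intro: G_inf_component\<close>)
qed

lemma lie_bracket_scaleR_left:
  assumes "F \<in> G_inf"
  shows "lie_bracket (c *\<^sub>R F) G = c *\<^sub>R lie_bracket F G"
proof
  fix k
  have e: "(c *\<^sub>R H) m = c *\<^sub>R H m" for H :: "nat \<Rightarrow> 'a kfun" and m by (rule fun_cong[OF scaleR_fun_def])
  show "lie_bracket (c *\<^sub>R F) G k = (c *\<^sub>R lie_bracket F G) k"
    unfolding e lie_bracket_def scaleR_sum_right
    by (rule sum.cong[OF refl], rule beta_scaleR_left) (use assms pairsD in \<open>auto intro: G_inf_component\<close>)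
qed

lemma bilinear_lie_bracket: "bilinear_on G_inf lie_bracket"
  unfolding bilinear_on_def
proof (intro conjI ballI allI)
  fix F G :: "nat \<Rightarrow> 'a kfun" assume F: "F \<in> G_inf" and G: "G \<in> G_inf"
  show "lie_bracket F G \<in> G_inf" by (rule lie_bracket_in_G_inf[OF F G])
  fix c
  show "lie_bracket (c *\<^sub>R F) G = c *\<^sub>R lie_bracket F G" by (rule lie_bracket_scaleR_left[OF F])
  have "lie_bracket F (c *\<^sub>R G) = - (c *\<^sub>R lie_bracket G F)"
    unfolding lie_bracket_antisym[OF F subspace_scale[OF subspace_G_inf G]] lie_bracket_scaleR_left[OF G] ..
  then show "lie_bracket F (c *\<^sub>R G) = c *\<^sub>R lie_bracket F G"
    unfolding lie_bracket_antisym[OF F G] scaleR_minus_right .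
  fix H :: "nat \<Rightarrow> 'a kfun" assume H: "H \<in> G_inf"
  show "lie_bracket (F + G) H = lie_bracket F H + lie_bracket G H" by (rule lie_bracket_add_left[OF F G])
  have "lie_bracket H (F + G) = - (lie_bracket F H + lie_bracket G H)"
    unfolding lie_bracket_antisym[OF H subspace_add[OF subspace_G_inf F G]] lie_bracket_add_left[OF F G] ..
  then show "lie_bracket H (F + G) = lie_bracket H F + lie_bracket H G"
    unfolding lie_bracket_antisym[OF H F] lie_bracket_antisym[OF H G] minus_add_distrib .
qed

text \<open>The offset \<open>2\<close> arises because each of two nested brackets lowers the total
  degree by one.\<close>

definition triples :: "nat \<Rightarrow> (nat \<times> nat \<times> nat) set" where
  "triples k = {(l, j, m). 1 \<le> l \<and> 1 \<le> j \<and> 1 \<le> m \<and> l + j + m = k + 2}"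

lemma lie_bracket_lie_bracket:
  assumes F: "F \<in> G_inf" and G: "G \<in> G_inf" and H: "H \<in> G_inf"
  shows "lie_bracket F (lie_bracket G H) k =
    (\<Sum>(l, j, m)\<in>triples k. beta l (j + m - 1) (F l) (beta j m (G j) (H m)))"
proof -
  let ?t = "\<lambda>x y. beta (fst x) (snd x) (F (fst x)) (beta (fst y) (snd y) (G (fst y)) (H (snd y)))"
  have "lie_bracket F (lie_bracket G H) k = (\<Sum>x\<in>pairs k. \<Sum>y\<in>pairs (snd x). ?t x y)"
    unfolding lie_bracket_def[of F]
  proof (rule sum.cong[OF refl])
    fix x assume x: "x \<in> pairs k"
    show "beta (fst x) (snd x) (F (fst x)) (lie_bracket G H (snd x)) = (\<Sum>y\<in>pairs (snd x). ?t x y)"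
      unfolding lie_bracket_def by (rule beta_sum_right[OF beta_pairs_in_g_space[OF G H] pairsD(1,2)[OF x]])
  qed
  also have "\<dots> = (\<Sum>(x, y)\<in>(SIGMA x:pairs k. pairs (snd x)). ?t x y)"
    by (rule sum.Sigma) auto
  also have "\<dots> = (\<Sum>(l, j, m)\<in>triples k. beta l (j + m - 1) (F l) (beta j m (G j) (H m)))"
    by (rule sum.reindex_bij_witness[of _ "\<lambda>(l, j, m). ((l, j + m - 1), (j, m))" "\<lambda>(x, y). (fst x, fst y, snd y)"])
      (auto simp: pairs_def triples_def)
  finally show ?thesis .
qed

text \<open>Cyclic reindexing brings the three double brackets to the same triples, where
  \<open>beta_jacobi\<close> cancels them term by term.\<close>

lemma lie_bracket_jacobi:
  assumes F: "F \<in> G_inf" and G: "G \<in> G_inf" and H: "H \<in> G_inf"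
  shows "lie_bracket F (lie_bracket G H) + lie_bracket G (lie_bracket H F) + lie_bracket H (lie_bracket F G) = 0"
proof
  fix k
  let ?a = "\<lambda>x. beta (fst x) (fst (snd x) + snd (snd x) - 1) (F (fst x))
      (beta (fst (snd x)) (snd (snd x)) (G (fst (snd x))) (H (snd (snd x))))"
  let ?b = "\<lambda>x. beta (fst (snd x)) (snd (snd x) + fst x - 1) (G (fst (snd x)))
      (beta (snd (snd x)) (fst x) (H (snd (snd x))) (F (fst x)))"
  let ?c = "\<lambda>x. beta (snd (snd x)) (fst x + fst (snd x) - 1) (H (snd (snd x)))
      (beta (fst x) (fst (snd x)) (F (fst x)) (G (fst (snd x))))"
  have a: "lie_bracket F (lie_bracket G H) k = (\<Sum>x\<in>triples k. ?a x)"
    unfolding lie_bracket_lie_bracket[OF F G H] by (simp only: case_prod_unfold)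
  have b: "lie_bracket G (lie_bracket H F) k = (\<Sum>x\<in>triples k. ?b x)"
    unfolding lie_bracket_lie_bracket[OF G H F]
    by (rule sum.reindex_bij_witness[of _ "\<lambda>(l, j, m). (j, m, l)" "\<lambda>(j, m, l). (l, j, m)"]) (auto simp: triples_def)
  have c: "lie_bracket H (lie_bracket F G) k = (\<Sum>x\<in>triples k. ?c x)"
    unfolding lie_bracket_lie_bracket[OF H F G]
    by (rule sum.reindex_bij_witness[of _ "\<lambda>(l, j, m). (m, l, j)" "\<lambda>(m, l, j). (l, j, m)"]) (auto simp: triples_def)
  have "?a x + ?b x + ?c x = 0" if "x \<in> triples k" for x
  proof -
    have x: "1 \<le> fst x" "1 \<le> fst (snd x)" "1 \<le> snd (snd x)" using that by (auto simp: triples_def)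
    show ?thesis by (rule beta_jacobi[OF G_inf_component[OF F x(1)] G_inf_component[OF G x(2)] G_inf_component[OF H x(3)] x])
  qed
  then have "(\<Sum>x\<in>triples k. ?a x + ?b x + ?c x) = 0" by (rule sum.neutral[OF ballI])
  then have "lie_bracket F (lie_bracket G H) k + lie_bracket G (lie_bracket H F) k + lie_bracket H (lie_bracket F G) k = 0"
    unfolding a b c sum.distrib[symmetric] .
  then show "(lie_bracket F (lie_bracket G H) + lie_bracket G (lie_bracket H F) + lie_bracket H (lie_bracket F G)) k = 0 k"
    unfolding plus_fun_apply[of "lie_bracket F (lie_bracket G H)"]
      plus_fun_apply[of "lie_bracket F (lie_bracket G H) + lie_bracket G (lie_bracket H F)"]
      zero_fun_apply[of k] .
qed

section \<open>Continuity estimates\<close>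

lemma cont_seminorms_beta_bound:
  assumes p: "p \<in> cont_seminorms" and lj: "1 \<le> l" "1 \<le> j" and B: "B \<subseteq> G_inf" and bd: "\<And>q. q \<in> cont_seminorms \<Longrightarrow> \<exists>C. \<forall>F\<in>B. q F \<le> C"
  shows "\<exists>a n K. a \<ge> 0 \<and> compact K \<and> K \<noteq> {} \<and>
    (\<forall>F\<in>B. \<forall>g\<in>g_space j. p (incl (l + j - 1) (beta l j (F l) g)) \<le> a * g_seminorm j n K g)"
proof -
  have k: "1 \<le> l + j - 1" using lj by auto
  obtain C n K where C: "C \<ge> 0" "compact K" "K \<noteq> {}"
    "\<And>f. f \<in> g_space (l + j - 1) \<Longrightarrow> p (incl (l + j - 1) f) \<le> C * g_seminorm (l + j - 1) n K f"
    using cont_seminorms_incl_bound[OF p k] by metis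
  obtain C' K' where C': "C' \<ge> 0" "compact K'" "K' \<noteq> {}"
    "\<And>f g. f \<in> g_space l \<Longrightarrow> g \<in> g_space j \<Longrightarrow> g_seminorm (l + j - 1) n K (beta l j f g) \<le>
        C' * (g_seminorm l (Suc n) K' f * g_seminorm j (Suc n) K' g)"
    using g_seminorm_beta_le[OF lj C(2,3)] by metis
  \<comment> \<open>With weight \<open>1\<close> and the same order and compact set in every
    component, this seminorm dominates the one of \<open>F l\<close>, so boundedness of
    \<open>B\<close> bounds \<open>F l\<close> uniformly.\<close>
  let ?q = "weighted_seminorm (\<lambda>_. 1) (\<lambda>_. Suc n) (\<lambda>_. K')"
  have "?q \<in> cont_seminorms" by (rule weighted_seminorm_in_PG) (use C' in auto)
  then obtain D where D: "\<forall>F\<in>B. ?q F \<le> D" using bd by blast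
  \<comment> \<open>\<open>max 0 D\<close> keeps the constant nonnegative even when \<open>B\<close>
    is empty and \<open>D\<close> arbitrary.\<close>
  have "p (incl (l + j - 1) (beta l j (F l) g)) \<le> (C * (C' * max 0 D)) * g_seminorm j (Suc n) K' g"
    if F: "F \<in> B" and g: "g \<in> g_space j" for F g
  proof -
    have Fi: "F \<in> G_inf" using F B by blast
    have Fl: "F l \<in> g_space l" by (rule G_inf_component[OF Fi lj(1)])
    have "1 * g_seminorm l (Suc n) K' (F l) \<le> ?q F"
      by (rule weighted_seminorm_ge[of "\<lambda>_. 1" "\<lambda>_. K'", OF _ C'(2,3) Fi lj(1)]) simp
    also have "\<dots> \<le> max 0 D" using D F by (simp add: le_max_iff_disj)
    finally have d: "g_seminorm l (Suc n) K' (F l) \<le> max 0 D" by simp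
    have "p (incl (l + j - 1) (beta l j (F l) g)) \<le> C * g_seminorm (l + j - 1) n K (beta l j (F l) g)"
      by (rule C(4)[OF beta_in_g_space[OF Fl g lj]])
    also have "\<dots> \<le> C * (C' * (g_seminorm l (Suc n) K' (F l) * g_seminorm j (Suc n) K' g))"
      by (rule mult_left_mono[OF C'(4)[OF Fl g] C(1)])
    also have "\<dots> \<le> C * (C' * (max 0 D * g_seminorm j (Suc n) K' g))"
      by (intro mult_left_mono mult_right_mono d C(1) C'(1) g_seminorm_nonneg[OF g C'(3,2)])
    finally show ?thesis by (simp only: mult.assoc)
  qed
  moreover have "C * (C' * max 0 D) \<ge> 0" using C(1) C'(1) by simp
  ultimately show ?thesis using C'(2,3) by blast
qed

text \<open>With \<open>l\<close> confined to \<open>{1..M}\<close> by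
  \<open>bounded_support\<close>, each \<open>l\<close> needs one weighted seminorm of
  \<open>G\<close>, whose order and compact set may depend on the component \<open>j\<close>. The
  finite sum of these is again a continuous seminorm.\<close>

lemma lie_bracket_bound:
  fixes B :: "(nat \<Rightarrow> 'd::finite kfun) set"
  assumes p: "p \<in> cont_seminorms" and B: "B \<subseteq> G_inf" and bd: "\<And>q. q \<in> cont_seminorms \<Longrightarrow> \<exists>C. \<forall>F\<in>B. q F \<le> C"
  shows "\<exists>q\<in>cont_seminorms. \<forall>F\<in>B. \<forall>G\<in>G_inf. p (lie_bracket F G) \<le> q G"
proof -
  obtain M where M: "\<And>F k. F \<in> B \<Longrightarrow> F k \<noteq> 0 \<Longrightarrow> k \<in> {1..M}" using bounded_support[OF B bd] by metis
  define Q where "Q l j a n K \<longleftrightarrow> a \<ge> 0 \<and> compact K \<and> K \<noteq> {} \<and>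
    (\<forall>F\<in>B. \<forall>g\<in>g_space j. p (incl (l + j - 1) (beta l j (F l) g)) \<le> a * g_seminorm j n K g)" for l j a n K
  have "\<exists>a n K. Q l j a n K" if "1 \<le> l" "1 \<le> j" for l j
    unfolding Q_def by (rule cont_seminorms_beta_bound[OF p that B bd])
  then obtain a n K where Q: "\<And>l j. 1 \<le> l \<Longrightarrow> 1 \<le> j \<Longrightarrow> Q l j (a l j) (n l j) (K l j)"
    by metis
  note aK = Q[unfolded Q_def]
  \<comment> \<open>Component \<open>0\<close> is a dummy for which no estimate was obtained;
    harmless values there keep \<open>weighted_seminorm\<close> admissible.\<close>
  let ?K = "\<lambda>l j. if j = 0 then {0} else K l j" and ?a = "\<lambda>l j. if j = 0 then 0 else a l j"
  have w: "weighted_seminorm (?a l) (n l) (?K l) \<in> cont_seminorms" if "1 \<le> l" for l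
    by (rule weighted_seminorm_in_PG) (use aK[OF that] in auto)
  let ?q = "\<lambda>G. \<Sum>l=1..M. weighted_seminorm (?a l) (n l) (?K l) G"
  have q: "?q \<in> cont_seminorms" by (rule cont_seminorms_sum) (use w in auto)
  have "p (lie_bracket F G) \<le> ?q G" if F: "F \<in> B" and G: "G \<in> G_inf" for F G
  proof -
    have Fi: "F \<in> G_inf" using F B by blast
    let ?J = "{j. G j \<noteq> 0}"
    let ?t = "\<lambda>l j. incl (l + j - 1) (beta l j (F l) (G j))"
    have t: "?t l j \<in> G_inf" if "l \<in> {1..M}" "j \<in> ?J" for l j
      by (rule incl_beta_in_G_inf[OF Fi G _ G_inf_support_ge[OF G that(2)]]) (use that(1) in simp)
    have "lie_bracket F G = (\<Sum>l=1..M. \<Sum>j\<in>?J. ?t l j)"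
    proof (rule lie_bracket_eq_sum[OF finite_atLeastAtMost G_inf_finite[OF G]])
      show "l \<in> {1..M}" if "F l \<noteq> 0" for l using M[OF F that] .
      show "j \<in> ?J" if "G j \<noteq> 0" for j using that by (rule CollectI)
      show "1 \<le> l" if "l \<in> {1..M}" for l using that by simp
      show "1 \<le> j" if "j \<in> ?J" for j using that by (rule G_inf_support_ge[OF G])
    qed
    then have "p (lie_bracket F G) = p (\<Sum>l=1..M. \<Sum>j\<in>?J. ?t l j)" by (rule arg_cong[where f = p])
    also have "\<dots> \<le> (\<Sum>l=1..M. p (\<Sum>j\<in>?J. ?t l j))"
      by (rule cont_seminorms_sum_le[OF p subspace_sum[OF subspace_G_inf t]])
    also have "\<dots> \<le> (\<Sum>l=1..M. \<Sum>j\<in>?J. p (?t l j))"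
      by (intro sum_mono cont_seminorms_sum_le[OF p] t)
    also have "\<dots> \<le> ?q G"
    proof (rule sum_mono)
      fix l assume l: "l \<in> {1..M}"
      show "(\<Sum>j\<in>?J. p (?t l j)) \<le> weighted_seminorm (?a l) (n l) (?K l) G"
        unfolding weighted_seminorm_def
      proof (rule sum_mono)
        fix j assume j: "j \<in> ?J"
        have j1: "1 \<le> j" by (rule G_inf_support_ge[OF G j])
        have "p (?t l j) \<le> a l j * g_seminorm j (n l j) (K l j) (G j)"
          using aK[of l j] l j1 F G_inf_component[OF G j1] by auto
        then show "p (?t l j) \<le> ?a l j * g_seminorm j (n l j) (?K l j) (G j)" using j1 by simp
      qed
    qed
    finally show ?thesis .
  qed
  then show ?thesis by (intro bexI[OF _ q] ballI)
qed

section \<open>Convergence and the main theorem\<close>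

text \<open>The same finitely many functions appear in both brackets, so the difference carries only
  scalar errors, each tending to \<open>0\<close>.\<close>

lemma bracket_N_diff:
  assumes k: "k < n" and F: "F \<in> G_inf" and G: "G \<in> G_inf"
  shows "bracket_N n F G k - lie_bracket F G k = (\<Sum>x\<in>pairs k. \<Sum>r=1..min (fst x) (snd x).
    (coef n (fst x) (snd x) r - (if r = 1 then real (fst x) * real (snd x) else 0)) *\<^sub>R
      overlap_bracket (fst x) (snd x) r (F (fst x)) (G (snd x)))"
proof -
  have "bracket_N n F G k = (\<Sum>x\<in>pairs k. star n (fst x) (snd x) (F (fst x)) (G (snd x)))"
    using bracket_N_eq[OF k G_inf_component[OF F] G_inf_component[OF G]] unfolding case_prod_unfold .
  moreover have "lie_bracket F G k = (\<Sum>x\<in>pairs k. \<Sum>r=1..min (fst x) (snd x).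
    (if r = 1 then real (fst x) * real (snd x) else 0) *\<^sub>R
      overlap_bracket (fst x) (snd x) r (F (fst x)) (G (snd x)))"
    unfolding lie_bracket_def beta_def
    by (rule sum.cong[OF refl], rule sum_coef_limit[symmetric]) (use pairsD in auto)
  ultimately show ?thesis
    unfolding star_def scaleR_diff_left sum_subtractf by (simp only:)
qed

text \<open>In each continuous seminorm the difference is at most a finite sum of scalar errors
  times numbers independent of \<open>n\<close>, which gives convergence in the direct sum topology
  itself.\<close>

lemma bracket_N_limit:
  assumes F: "F \<in> G_inf" and G: "G \<in> G_inf" and k: "1 \<le> k"
  shows "limitin G_inf_topology (\<lambda>n. incl k (bracket_N n F G k)) (incl k (lie_bracket F G k)) sequentially"
  unfolding G_inf_topology_eq
proof (rule G.limitin_T)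
  let ?T = "\<lambda>x r. overlap_bracket (fst x) (snd x) r (F (fst x)) (G (snd x))"
  let ?d = "\<lambda>n x r. coef n (fst x) (snd x) r - (if r = 1 then real (fst x) * real (snd x) else 0)"
  have T: "?T x r \<in> g_space k" if "x \<in> pairs k" "r \<in> {1..min (fst x) (snd x)}" for x r
  proof -
    have r: "1 \<le> r" "r \<le> min (fst x) (snd x)" using that(2) by auto
    show ?thesis
      using overlap_bracket_in_g_space[OF G_inf_component[OF F pairsD(1)[OF that(1)]]
          G_inf_component[OF G pairsD(2)[OF that(1)]] r]
      unfolding pairsD(3)[OF that(1)] .
  qed
  show L: "incl k (lie_bracket F G k) \<in> G_inf" by (rule incl_in_G_inf[OF k lie_bracket_in_g_space[OF F G]])
  have dT: "(\<Sum>x\<in>pairs k. \<Sum>r=1..min (fst x) (snd x). ?d n x r *\<^sub>R ?T x r) \<in> g_space k" for n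
    by (intro subspace_sum subspace_scale subspace_g_space T)
  have eq: "incl k (bracket_N n F G k) - incl k (lie_bracket F G k) =
      (\<Sum>x\<in>pairs k. \<Sum>r=1..min (fst x) (snd x). ?d n x r *\<^sub>R incl k (?T x r))" if "k < n" for n
    unfolding incl_diff[symmetric] bracket_N_diff[OF that F G] incl_sum incl_scaleR ..
  show "\<forall>\<^sub>F n in sequentially. incl k (bracket_N n F G k) \<in> G_inf"
    using eventually_gt_at_top[of k]
  proof eventually_elim
    case (elim n)
    have "bracket_N n F G k - lie_bracket F G k \<in> g_space k"
      unfolding bracket_N_diff[OF elim F G] by (rule dT)
    from subspace_add[OF subspace_g_space this lie_bracket_in_g_space[OF F G, of k]]
    have "bracket_N n F G k \<in> g_space k" unfolding diff_add_cancel .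
    then show ?case by (rule incl_in_G_inf[OF k])
  qed
  fix p :: "(nat \<Rightarrow> 'a kfun) \<Rightarrow> real" assume p: "p \<in> cont_seminorms"
  show "(\<lambda>n. p (incl k (bracket_N n F G k) - incl k (lie_bracket F G k))) \<longlonglongrightarrow> 0"
  proof (rule tendsto_sandwich[OF _ _ tendsto_const])
    show "\<forall>\<^sub>F n in sequentially. 0 \<le> p (incl k (bracket_N n F G k) - incl k (lie_bracket F G k))"
      using eventually_gt_at_top[of k]
    proof eventually_elim
      case (elim n)
      show ?case unfolding eq[OF elim]
        by (intro cont_seminorms_nonneg[OF p] subspace_sum subspace_scale subspace_G_inf incl_in_G_inf[OF k] T)
    qed
    show "\<forall>\<^sub>F n in sequentially. p (incl k (bracket_N n F G k) - incl k (lie_bracket F G k)) \<le>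
        (\<Sum>x\<in>pairs k. \<Sum>r=1..min (fst x) (snd x). \<bar>?d n x r\<bar> * p (incl k (?T x r)))"
      using eventually_gt_at_top[of k]
    proof eventually_elim
      case (elim n)
      have "p (\<Sum>x\<in>pairs k. \<Sum>r=1..min (fst x) (snd x). ?d n x r *\<^sub>R incl k (?T x r)) \<le>
          (\<Sum>x\<in>pairs k. p (\<Sum>r=1..min (fst x) (snd x). ?d n x r *\<^sub>R incl k (?T x r)))"
        by (intro cont_seminorms_sum_le[OF p] subspace_sum subspace_scale subspace_G_inf incl_in_G_inf[OF k] T)
      also have "\<dots> \<le> (\<Sum>x\<in>pairs k. \<Sum>r=1..min (fst x) (snd x). p (?d n x r *\<^sub>R incl k (?T x r)))"
        by (intro sum_mono cont_seminorms_sum_le[OF p] subspace_scale subspace_G_inf incl_in_G_inf[OF k] T)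
      also have "\<dots> = (\<Sum>x\<in>pairs k. \<Sum>r=1..min (fst x) (snd x). \<bar>?d n x r\<bar> * p (incl k (?T x r)))"
        by (intro sum.cong refl seminorm_on_scaleR[OF cont_seminorms_seminorm[OF p]] incl_in_G_inf[OF k] T)
      finally show ?case unfolding eq[OF elim] .
    qed
    have "(\<lambda>n. ?d n x r) \<longlonglongrightarrow> 0" if "x \<in> pairs k" "r \<in> {1..min (fst x) (snd x)}" for x r
      using coef_tendsto[of r "fst x" "snd x"] that pairsD(1,2)[OF that(1)] by (intro LIM_zero) simp
    then have "(\<lambda>n. \<Sum>x\<in>pairs k. \<Sum>r=1..min (fst x) (snd x). \<bar>?d n x r\<bar> * p (incl k (?T x r))) \<longlonglongrightarrow>
        (\<Sum>x\<in>pairs k. \<Sum>r=1..min (fst x) (snd x). 0 * p (incl k (?T x r)))"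
      by (intro tendsto_sum tendsto_mult tendsto_const tendsto_rabs_zero)
    then show "(\<lambda>n. \<Sum>x\<in>pairs k. \<Sum>r=1..min (fst x) (snd x). \<bar>?d n x r\<bar> * p (incl k (?T x r))) \<longlonglongrightarrow> 0"
      by simp
  qed
qed

lemma locally_convex_G_inf: "locally_convex_space G_inf G_inf_topology"
  unfolding G_inf_topology_eq by (rule G.locally_convex_T[OF G_inf_separated])

text \<open>The space is Hausdorff, so the description by \<open>THE\<close> singles out the limit
  already found.\<close>

lemma bracket_inf_lim_eq:
  assumes "F \<in> G_inf" "G \<in> G_inf" "1 \<le> k"
  shows "bracket_inf_lim F G k = incl k (lie_bracket F G k)"
  unfolding bracket_inf_lim_def
proof (rule the_equality)
  show "limitin G_inf_topology (\<lambda>n. incl k (bracket_N n F G k)) (incl k (lie_bracket F G k)) sequentially"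
    by (rule bracket_N_limit[OF assms])
  fix L assume "limitin G_inf_topology (\<lambda>n. incl k (bracket_N n F G k)) L sequentially"
  then show "L = incl k (lie_bracket F G k)"
    using limitin_Hausdorff_unique[OF _ bracket_N_limit[OF assms]] locally_convex_G_inf
    unfolding locally_convex_space_def by (metis trivial_limit_sequentially)
qed

lemma bracket_inf_eq:
  assumes "F \<in> G_inf" "G \<in> G_inf"
  shows "bracket_inf F G = lie_bracket F G"
proof
  fix k
  show "bracket_inf F G k = lie_bracket F G k"
  proof (cases "k = 0")
    case True
    then show ?thesis
      using G_inf_0[OF lie_bracket_in_G_inf[OF assms]] by (simp only: bracket_inf_def if_True simp_thms)
  next
    case False
    then have "1 \<le> k" by simp
    then show ?thesis
      using False unfolding bracket_inf_def bracket_inf_lim_eq[OF assms \<open>1 \<le> k\<close>] by (simp add: incl_def)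
  qed
qed

section \<open>Lie algebra structure and hypocontinuity of the bracket\<close>

lemma bilinear_bracket_inf: "bilinear_on G_inf bracket_inf"
  unfolding bilinear_on_def
  by (intro conjI ballI allI)
    (simp_all only: bracket_inf_eq bilinear_lie_bracket[unfolded bilinear_on_def] subspace_add[OF subspace_G_inf]
      subspace_scale[OF subspace_G_inf])

lemma lie_algebra_G_inf: "lie_algebra G_inf G_inf_topology bracket_inf"
  unfolding lie_algebra_def
proof (intro conjI ballI locally_convex_G_inf bilinear_bracket_inf)
  fix F G :: "nat \<Rightarrow> 'a kfun" assume F: "F \<in> G_inf" and G: "G \<in> G_inf"
  show "bracket_inf F G = - bracket_inf G F"
    unfolding bracket_inf_eq[OF F G] bracket_inf_eq[OF G F] by (rule lie_bracket_antisym[OF F G])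
  fix H :: "nat \<Rightarrow> 'a kfun" assume H: "H \<in> G_inf"
  note m = lie_bracket_in_G_inf
  show "bracket_inf F (bracket_inf G H) + bracket_inf G (bracket_inf H F) + bracket_inf H (bracket_inf F G) = 0"
    unfolding bracket_inf_eq[OF F G] bracket_inf_eq[OF G H] bracket_inf_eq[OF H F]
      bracket_inf_eq[OF F m[OF G H]] bracket_inf_eq[OF G m[OF H F]] bracket_inf_eq[OF H m[OF F G]]
    by (rule lie_bracket_jacobi[OF F G H])
qed

text \<open>Antisymmetry carries the estimate over to the other argument, as a seminorm ignores
  signs.\<close>

lemma bracket_inf_bound:
  assumes p: "p \<in> cont_seminorms" and B: "B \<subseteq> G_inf" and bd: "\<And>q. q \<in> cont_seminorms \<Longrightarrow> \<exists>C. \<forall>F\<in>B. q F \<le> C"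
  shows "\<exists>q\<in>cont_seminorms. \<forall>F\<in>B. \<forall>G\<in>G_inf. p (bracket_inf F G) \<le> q G \<and> p (bracket_inf G F) \<le> q G"
proof -
  obtain q where q: "q \<in> cont_seminorms" "\<forall>F\<in>B. \<forall>G\<in>G_inf. p (lie_bracket F G) \<le> q G"
    using lie_bracket_bound[OF p B bd] by blast
  have 1: "p (bracket_inf F G) \<le> q G" if "F \<in> B" "G \<in> G_inf" for F G
    using q(2) that B bracket_inf_eq[of F G] by auto
  have 2: "p (bracket_inf G F) \<le> q G" if F: "F \<in> B" and G: "G \<in> G_inf" for F G
  proof -
    have Fi: "F \<in> G_inf" using F B by blast
    have "p (bracket_inf G F) = p (lie_bracket F G)"
      unfolding bracket_inf_eq[OF G Fi] lie_bracket_antisym[OF G Fi]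
      by (rule seminorm_on_minus[OF cont_seminorms_seminorm[OF p] lie_bracket_in_G_inf[OF Fi G]])
    then show ?thesis using q(2) F G by simp
  qed
  show ?thesis by (intro bexI[OF _ q(1)] ballI conjI 1 2)
qed

lemma bracket_inf_in_G_inf: "F \<in> G_inf \<Longrightarrow> G \<in> G_inf \<Longrightarrow> bracket_inf F G \<in> G_inf"
  using lie_bracket_in_G_inf by (simp only: bracket_inf_eq)

lemma bilinear_on_diff:
  assumes "bilinear_on V b" "subspace V" "x \<in> V" "y \<in> V" "z \<in> V"
  shows "b x (y - z) = b x y - b x z" "b (y - z) x = b y x - b z x"
proof -
  have m: "- 1 *\<^sub>R z \<in> V" by (rule subspace_scale[OF assms(2,5)])
  have e: "y - z = y + - 1 *\<^sub>R z" by simp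
  have "b x (y + - 1 *\<^sub>R z) = b x y + b x (- 1 *\<^sub>R z)" "b (y + - 1 *\<^sub>R z) x = b y x + b (- 1 *\<^sub>R z) x"
    "b x (- 1 *\<^sub>R z) = - 1 *\<^sub>R b x z" "b (- 1 *\<^sub>R z) x = - 1 *\<^sub>R b z x"
    using assms m unfolding bilinear_on_def by blast+
  then show "b x (y - z) = b x y - b x z" "b (y - z) x = b y x - b z x" unfolding e by simp_all
qed

lemma hypocontinuous_bracket_inf: "boundedly_hypocontinuous G_inf G_inf_topology bracket_inf"
  unfolding boundedly_hypocontinuous_def
proof (intro conjI ballI allI impI bilinear_bracket_inf)
  fix F :: "nat \<Rightarrow> 'a kfun" assume F: "F \<in> G_inf"
  \<comment> \<open>Separate continuity is the estimate for the bounded set consisting of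
    \<open>F\<close> alone.\<close>
  have bd: "\<exists>q\<in>cont_seminorms. \<forall>G\<in>G_inf. p (bracket_inf F G) \<le> q G \<and> p (bracket_inf G F) \<le> q G" if p: "p \<in> cont_seminorms" for p
    using bracket_inf_bound[OF p, of "{F}"] F by auto
  show "continuous_map G_inf_topology G_inf_topology (bracket_inf F)"
    unfolding G_inf_topology_eq
    by (rule G.continuous_linear) (use bd bracket_inf_in_G_inf[OF F]
      bilinear_on_diff(1)[OF bilinear_bracket_inf subspace_G_inf F] in blast)+
  show "continuous_map G_inf_topology G_inf_topology (\<lambda>G. bracket_inf G F)"
    unfolding G_inf_topology_eq
    by (rule G.continuous_linear) (use bd bracket_inf_in_G_inf[OF _ F]
      bilinear_on_diff(2)[OF bilinear_bracket_inf subspace_G_inf F] in blast)+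
next
  fix B U :: "(nat \<Rightarrow> 'a kfun) set"
  assume "tvs_bounded G_inf_topology B \<and> zero_nbhd G_inf_topology U"
  then have B: "tvs_bounded G.T B" and U: "zero_nbhd G.T U" unfolding G_inf_topology_eq by blast+
  obtain p r where p: "p \<in> cont_seminorms" "r > 0" "{y \<in> G_inf. p y < r} \<subseteq> U" using U unfolding G.zero_nbhd_T by blast
  have BG: "B \<subseteq> G_inf" using B unfolding tvs_bounded_def G.topspace_T by blast
  have bd: "\<exists>C. \<forall>F\<in>B. q F \<le> C" if "q \<in> cont_seminorms" for q
    using G.tvs_bounded_T[OF B that] by metis
  obtain q where q: "q \<in> cont_seminorms" "\<forall>F\<in>B. \<forall>G\<in>G_inf. p (bracket_inf F G) \<le> q G \<and> p (bracket_inf G F) \<le> q G"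
    using bracket_inf_bound[OF p(1) BG bd] by blast
  show "\<exists>W. zero_nbhd G_inf_topology W \<and> (\<forall>b\<in>B. \<forall>w\<in>W. bracket_inf b w \<in> U \<and> bracket_inf w b \<in> U)"
    unfolding G_inf_topology_eq
  proof (intro exI conjI ballI)
    \<comment> \<open>On this ball \<open>p\<close> of either bracket is at most \<open>q w\<close>,
      so the radius \<open>r\<close> taken from \<open>U\<close> can be kept.\<close>
    show "zero_nbhd G.T {y \<in> G_inf. q y < r}" unfolding G.zero_nbhd_T using q(1) p(2) by blast
    fix b w assume b: "b \<in> B" and w: "w \<in> {y \<in> G_inf. q y < r}"
    then have bG: "b \<in> G_inf" and wG: "w \<in> G_inf" and wr: "q w < r" using BG by blast+
    have "p (bracket_inf b w) < r" "p (bracket_inf w b) < r" using q(2)[rule_format, OF b wG] wr by linarith+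
    then show "bracket_inf b w \<in> U" "bracket_inf w b \<in> U"
      using p(3) bracket_inf_in_G_inf[OF bG wG] bracket_inf_in_G_inf[OF wG bG] by blast+
  qed
qed

theorem theorem2p8:
  shows "(\<forall>F \<in> G_inf :: (nat \<Rightarrow> 'd::finite kfun) set. \<forall>G \<in> G_inf. \<forall>k\<ge>1.
            (\<exists>L. limitin G_inf_topology (\<lambda>N. incl k (bracket_N N F G k)) L sequentially) \<and>
            bracket_inf_lim F G k =
              incl k (\<Sum>(l, j) \<in> {(l, j). l \<ge> 1 \<and> j \<ge> 1 \<and> l + j - 1 = k}.
                        Sym k (wedge1 l j (F l) (G j)))) \<and>
         lie_algebra (G_inf :: (nat \<Rightarrow> 'd kfun) set) G_inf_topology bracket_inf \<and>
         boundedly_hypocontinuous (G_inf :: (nat \<Rightarrow> 'd kfun) set) G_inf_topology bracket_inf"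
proof (intro conjI ballI allI impI lie_algebra_G_inf hypocontinuous_bracket_inf)
  fix F G :: "nat \<Rightarrow> 'd kfun" and k :: nat
  assume F: "F \<in> G_inf" and G: "G \<in> G_inf" and k: "1 \<le> k"
  show "\<exists>L. limitin G_inf_topology (\<lambda>N. incl k (bracket_N N F G k)) L sequentially"
    by (rule exI[of _ "incl k (lie_bracket F G k)"], rule bracket_N_limit[OF F G k])
  have "lie_bracket F G k = (\<Sum>x\<in>pairs k. Sym k (wedge1 (fst x) (snd x) (F (fst x)) (G (snd x))))"
    unfolding lie_bracket_def
  proof (rule sum.cong[OF refl])
    fix x assume x: "x \<in> pairs k"
    show "beta (fst x) (snd x) (F (fst x)) (G (snd x)) = Sym k (wedge1 (fst x) (snd x) (F (fst x)) (G (snd x)))"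
      using Sym_wedge1[OF G_inf_component[OF F pairsD(1)[OF x]] G_inf_component[OF G pairsD(2)[OF x]] pairsD(1,2)[OF x]]
      unfolding pairsD(3)[OF x] by (rule sym)
  qed
  then show "bracket_inf_lim F G k =
      incl k (\<Sum>(l, j) \<in> {(l, j). l \<ge> 1 \<and> j \<ge> 1 \<and> l + j - 1 = k}. Sym k (wedge1 l j (F l) (G j)))"
    unfolding bracket_inf_lim_eq[OF F G k] pairs_def[symmetric] by (simp only: case_prod_unfold)
qed

end
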